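(* Let $a(s)=a_2s^2+a_1s+a_0$ and $b(s)=b_2s^2+b_1s+b_0$ be coprime real polynomials, with $a_2,b_2$ not both zero and $b_i>0$ for at least one $i\in\{0,1,2\}$, and let $Z=a/b$. Let the polynomials $\alpha,\beta,f_0,f_1,c_0,c_1,c_2\in\mathbb{R}[u]$ and $d_0,d_1,d_2,\eta,\gamma_1,\gamma_2,\gamma_3,\lambda_1,\lambda_2,\lambda_3,\lambda_4\in\mathbb{R}[u,v]$, the number $F_0=F_0(a,b)$, the conditions (Q5)--(Q8), (F1)--(F4) on real numbers $\tilde x,\tilde z$, and the network classes be as defined in the context. If $Z$ is the impedance of a network from one of the classes $\mathcal{N}_{10},\mathcal{N}_{11},\mathcal{N}_{12},\mathcal{N}_{13}$, then either $Z\in\mathcal{Z}_{1,1}$, or $Z\in\mathcal{Z}_{0,2}$, or there exist $\tilde x\ge0$ and $\tilde z\ne0$ such that one of the following pairs of conditions holds: (a) (Q5) and (F1); (b) (Q6) and (F2); (c) (Q7) and (F3); or (d) (Q8) and (F4). If $Z\in\mathcal{Z}_{1,1}$ or $Z\in\mathcal{Z}_{0,2}$, then $Z$ is the impedance of one of the two-energy-storage-element networks $N_5$--$N_9$ with the explicit element values listed in the context (under the applicable condition listed there). Otherwise an explicit realization is obtained as follows (all polynomials evaluated at $(u,v)=(\tilde x,\tilde z)$): 1. If $\tilde x\ge0$ and $\tilde z\ne0$ are such that (Q5) holds, then $\beta,d_0,d_2\ne0$, $\gamma_1>0$, and $Z$ is the impedance of $N_{10}$ with $R_1=\frac{c_0}{d_0}$,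 $R_2=\frac{\gamma_2}{d_0d_2}$, $G_3=\frac{-d_2\lambda_1}{\beta^3\eta F_0}$, $R_4=\frac\alpha\beta$, $R_5=\frac{\tilde x}{\beta\tilde z}$, $C_1=\frac{-d_2^2\gamma_1}{\beta^3\eta F_0}$, $L_1=\frac{\gamma_1}{d_0^2}$, $L_2=\frac1{\beta\tilde z}$. In particular, if (F1) holds, then $G_3=0$, so this network is from class $\mathcal{N}_{17}$. 2. If $\tilde x\ge0$ and $\tilde z\ne0$ are such that (Q6) holds, then $\beta,d_0,d_2\ne0$, $\gamma_3<0$, and $Z$ is the impedance of $N_{11}$ with $R_1=\frac{c_2}{d_2}$, $R_2=\frac{-\gamma_2}{d_0d_2}$, $G_3=\frac{-d_0\lambda_3}{\beta^3\eta F_0}$, $R_4=\frac\alpha\beta$, $R_5=\frac{\tilde x}{\beta\tilde z}$, $C_1=\frac{-d_2^2}{\gamma_3}$, $L_1=\frac{\beta^3\eta F_0}{d_0^2\gamma_3}$, $L_2=\frac1{\beta\tilde z}$. In particular, if (F2) holds, then $G_3=0$, so this network is from class $\mathcal{N}_{20}$. 3. If $\tilde x\ge0$ and $\tilde z\ne0$ are such that (Q7) holds, then $\beta,c_0,c_2\ne0$, $\gamma_1<0$, and $Z$ is the impedance of $N_{12}$ with $G_1=\frac{d_0}{c_0}$, $G_2=\frac{-\gamma_2}{c_0c_2}$, $R_3=\frac{-c_2\lambda_4}{\beta^3\eta F_0}$, $R_4=\frac\alpha\beta$, $R_5=\frac{\tilde x}{\beta\tilde z}$, $C_1=\frac{-\gamma_1}{c_0^2}$,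 $L_1=\frac{c_2^2\gamma_1}{\beta^3\eta F_0}$, $L_2=\frac1{\beta\tilde z}$. In particular, if (F3)(i) (resp. (F3)(ii)) holds, then $R_3=0$ (resp. $G_1=0$), so this network is from class $\mathcal{N}_{23}$ (resp. $\mathcal{N}_{22}$). 4. If $\tilde x\ge0$ and $\tilde z\ne0$ are such that (Q8) holds, then $\beta,c_0,c_2\ne0$, $\gamma_3>0$, and $Z$ is the impedance of $N_{13}$ with $G_1=\frac{d_2}{c_2}$, $G_2=\frac{\gamma_2}{c_0c_2}$, $R_3=\frac{-c_0\lambda_2}{\beta^3\eta F_0}$, $R_4=\frac\alpha\beta$, $R_5=\frac{\tilde x}{\beta\tilde z}$, $C_1=\frac{-\beta^3\eta F_0}{c_0^2\gamma_3}$, $L_1=\frac{c_2^2}{\gamma_3}$, $L_2=\frac1{\beta\tilde z}$. In particular, if (F4)(i) (resp. (F4)(ii)) holds, then $R_3=0$ (resp. $G_1=0$), so this network is from class $\mathcal{N}_{26}$ (resp. $\mathcal{N}_{25}$).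
   Context: **Networks.** One-port networks are built from resistors (impedance $R$), inductors (impedance $Ls$, $L>0$) and capacitors (impedance $1/(Cs)$, $C>0$). A single element is series-parallel, and a series connection (impedances add, written $+$) or parallel connection ($1/(Z_1\parallel Z_2)=1/Z_1+1/Z_2$) of two series-parallel networks is series-parallel. A resistor of resistance $R=0$ is a short circuit; a resistor of conductance $G=0$, written $1/G$, is an open circuit. $\mathcal{Z}_{m,n}$ is the set of impedances of series-parallel networks containing at most $m$ capacitors and at most $n$ inductors. The class $\mathcal{N}_k$ ($k=10,\ldots,13$) is the set of all networks of the form $N_k$ with all $R_j\ge0$, $G_j\ge0$ and $C_1,L_1,L_2>0$, where - $N_{10}$: $R_4+\left[(R_5+L_2s)\parallel\left(R_1+\left(L_1s\parallel\left(R_2+\left(\frac1{G_3}\parallel\frac1{C_1s}\right)\right)\right)\right)\right]$; - $N_{11}$: $R_4+\left[(R_5+L_2s)\parallel\left(R_1+\left(\frac1{C_1s}\parallel\left(R_2+\left(\frac1{G_3}\parallel L_1s\right)\right)\right)\right)\right]$; - $N_{12}$: $R_4+\left[(R_5+L_2s)\parallel\frac1{G_1}\parallel\left(\frac1{C_1s}+\left(\frac1{G_2}\parallel(R_3+L_1s)\right)\right)\right]$; - $N_{13}$: $R_4+\left[(R_5+L_2s)\parallel\frac1{G_1}\parallel\left(L_1s+\left(\frac1{G_2}\parallel\left(R_3+\frac1{C_1s}\right)\right)\right)\right]$. Subclasses: $\mathcal{N}_{17}$ is $\mathcal{N}_{10}$ with $G_3=0$; $\mathcal{N}_{20}$ is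 $\mathcal{N}_{11}$ with $G_3=0$; $\mathcal{N}_{22},\mathcal{N}_{23}$ are $\mathcal{N}_{12}$ with $G_1=0$, $R_3=0$ respectively; $\mathcal{N}_{25},\mathcal{N}_{26}$ are $\mathcal{N}_{13}$ with $G_1=0$, $R_3=0$ respectively. **Algebra.** $F_0(a,b)$ is the determinant of the $4\times4$ matrix with rows $(b_2,b_1,b_0,0)$, $(a_2,a_1,a_0,0)$, $(0,b_2,b_1,b_0)$, $(0,a_2,a_1,a_0)$. $\mathcal{B}(a,b)$ is the $2\times2$ matrix with $\frac{a(z)b(w)-b(z)a(w)}{z-w}=\sum_{i,j=1}^2\mathcal{B}_{ij}z^{i-1}w^{j-1}$. Define $\alpha(u)=a_2u^2-a_1u+a_0$, $\beta(u)=b_2u^2-b_1u+b_0$, $[f_0\ f_1](u)=[1\ -u]\,\mathcal{B}(a,b)$, $c_2(u)=f_1(u)$, $c_1(u)=f_0(u)+uf_1(u)$, $c_0(u)=uf_0(u)$, $d_2(u,v)=\beta(u)b_2$, $d_1(u,v)=\beta(u)(b_1-vf_1(u))$, $d_0(u,v)=\beta(u)(b_0-vf_0(u))$, $\eta(u,v)=b_2u^2-(b_1-vf_1(u))u+b_0-vf_0(u)$, and $\gamma_1=c_1d_0-c_0d_1$, $\gamma_2=c_2d_0-c_0d_2$, $\gamma_3=c_2d_1-c_1d_2$, $\lambda_1=d_1\gamma_1-d_0\gamma_2$, $\lambda_2=c_1\gamma_3-c_2\gamma_2$, $\lambda_3=d_2\gamma_2-d_1\gamma_3$, $\lambda_4=c_0\gamma_2-c_1\gamma_1$.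 Real numbers "have the same sign" if all are non-negative or all are non-positive. **Conditions** (polynomials evaluated at $(\tilde x,\tilde z)$). (Q5) $a_i,b_i\ge0$ for $i=0,1,2$; $\alpha,\beta,\tilde z,d_0,d_1,d_2,f_0,f_1,\lambda_1$ have the same sign; $\gamma_2\ge0$ and $-\beta\eta F_0\ge0$; $\eta,F_0\ne0$. (Q6) $a_i,b_i\ge0$ for $i=0,1,2$; $\alpha,\beta,\tilde z,d_0,d_1,d_2,f_0,f_1,\lambda_3$ have the same sign; $\gamma_2\le0$ and $\beta\eta F_0\le0$; $\eta,F_0\ne0$. (Q7) $a_i,b_i\ge0$ for $i=0,1,2$; $\alpha,\beta,\tilde z,d_0,d_1,d_2,f_0,f_1,\lambda_4$ have the same sign; $\gamma_2\le0$ and $\beta\eta F_0\le0$; $\eta,F_0\ne0$. (Q8) $a_i,b_i\ge0$ for $i=0,1,2$; $\alpha,\beta,\tilde z,d_0,d_1,d_2,f_0,f_1,\lambda_2$ have the same sign; $\gamma_2\ge0$ and $-\beta\eta F_0\ge0$; $\eta,F_0\ne0$. (F1) $\lambda_1=0$. (F2) $\lambda_3=0$. (F3) (i) $\lambda_4=0$ or (ii) $d_0=0$. (F4) (i) $\lambda_2=0$ or (ii) $d_2=0$. **Two-energy-storage-element realizations.** Let $\Gamma_1=a_1b_0-a_0b_1$, $\Gamma_2=a_2b_0-a_0b_2$, $\Gamma_3=a_2b_1-a_1b_2$, $\Lambda_1=b_1\Gamma_1-b_0\Gamma_2$, $\Lambda_2=a_1\Gamma_3-a_2\Gamma_2$,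 $\Lambda_3=b_2\Gamma_2-b_1\Gamma_3$, $\Lambda_4=a_0\Gamma_2-a_1\Gamma_1$. Consider (Q1): $a_0,a_1,a_2,b_0,b_1,b_2,\Lambda_1$ have the same sign and $\Gamma_2\ge0$; (Q2): the same with $\Lambda_2$ in place of $\Lambda_1$, $\Gamma_2\ge0$; (Q3): the same with $\Lambda_3$, and $\Gamma_2\le0$; (Q4): the same with $\Lambda_4$, and $\Gamma_2\le0$. The listed networks are: - under (Q1) and $F_0<0$: $N_6$: $R_1+(L_1s\parallel(R_2+(\frac1{G_3}\parallel\frac1{C_1s})))$ with $R_1=\frac{a_0}{b_0}$, $R_2=\frac{\Gamma_2}{b_0b_2}$, $G_3=\frac{-b_2\Lambda_1}{F_0}$, $C_1=\frac{-b_2^2\Gamma_1}{F_0}$, $L_1=\frac{\Gamma_1}{b_0^2}$; - under (Q3) and $F_0<0$: $N_7$: $R_1+(\frac1{C_1s}\parallel(R_2+(\frac1{G_3}\parallel L_1s)))$ with $R_1=\frac{a_2}{b_2}$, $R_2=\frac{-\Gamma_2}{b_0b_2}$, $G_3=\frac{-b_0\Lambda_3}{F_0}$, $C_1=\frac{-b_2^2}{\Gamma_3}$, $L_1=\frac{F_0}{b_0^2\Gamma_3}$; - under (Q4) and $F_0<0$: $N_8$: $\frac1{G_1}\parallel(\frac1{C_1s}+(\frac1{G_2}\parallel(R_3+L_1s)))$ with $G_1=\frac{b_0}{a_0}$, $G_2=\frac{-\Gamma_2}{a_0a_2}$, $R_3=\frac{-a_2\Lambda_4}{F_0}$, $C_1=\frac{-\Gamma_1}{a_0^2}$,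 $L_1=\frac{a_2^2\Gamma_1}{F_0}$; - under (Q2) and $F_0<0$: $N_9$: $\frac1{G_1}\parallel(L_1s+(\frac1{G_2}\parallel(R_3+\frac1{C_1s})))$ with $G_1=\frac{b_2}{a_2}$, $G_2=\frac{\Gamma_2}{a_0a_2}$, $R_3=\frac{-a_0\Lambda_2}{F_0}$, $C_1=\frac{-F_0}{a_0^2\Gamma_3}$, $L_1=\frac{a_2^2}{\Gamma_3}$; - under (Q1) and $F_0>0$: $N_5$: $R_1+(L_2s\parallel(R_2+(\frac1{G_3}\parallel L_1s)))$ with $R_1=\frac{a_0}{b_0}$, $R_2=\frac{\Gamma_1^2}{b_0\Lambda_1}$, $G_3=\frac{b_2\Lambda_1}{F_0}$, $L_1=\frac{\Gamma_1F_0}{\Lambda_1^2}$, $L_2=\frac{\Gamma_1}{b_0^2}$. *)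

theory Defs
  imports "HOL-Analysis.Analysis" "HOL-Computational_Algebra.Polynomial_Factorial"
begin

section \<open>Series-parallel networks and their impedances\<close>

text \<open>
  \<open>Conductor G\<close> is a resistor specified by its conductance, so that an open circuit (\<open>G = 0\<close>)
  is available besides the short circuit \<open>Resistor 0\<close>.
\<close>

datatype network =
    Resistor real
  | Conductor real
  | Inductor real
  | Capacitor real
  | Series network network  (infixl "\<oplus>" 65)
  | Parallel network network  (infixl "\<parallel>" 70)

primrec admissible :: "network \<Rightarrow> bool" where
  "admissible (Resistor R) \<longleftrightarrow> R \<ge> 0"
| "admissible (Conductor G) \<longleftrightarrow> G \<ge> 0"
| "admissible (Inductor L) \<longleftrightarrow> L > 0"
| "admissible (Capacitor C) \<longleftrightarrow> C > 0"
| "admissible (N \<oplus> M) \<longleftrightarrow> admissible N \<and> admissible M"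
| "admissible (N \<parallel> M) \<longleftrightarrow> admissible N \<and> admissible M"

primrec num_capacitors :: "network \<Rightarrow> nat" where
  "num_capacitors (Resistor R) = 0"
| "num_capacitors (Conductor G) = 0"
| "num_capacitors (Inductor L) = 0"
| "num_capacitors (Capacitor C) = 1"
| "num_capacitors (N \<oplus> M) = num_capacitors N + num_capacitors M"
| "num_capacitors (N \<parallel> M) = num_capacitors N + num_capacitors M"

primrec num_inductors :: "network \<Rightarrow> nat" where
  "num_inductors (Resistor R) = 0"
| "num_inductors (Conductor G) = 0"
| "num_inductors (Inductor L) = 1"
| "num_inductors (Capacitor C) = 0"
| "num_inductors (N \<oplus> M) = num_inductors N + num_inductors M"
| "num_inductors (N \<parallel> M) = num_inductors N + num_inductors M"

text \<open>
  Impedances are elements of \<open>\<real>(s)\<close> together with a point at infinity, represented by \<open>None\<close>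
  (the impedance of an open circuit). The indeterminate \<open>s\<close> is the polynomial \<open>[:0, 1:]\<close>.
\<close>

type_synonym impedance = "real poly fract option"

fun add_imp :: "impedance \<Rightarrow> impedance \<Rightarrow> impedance" where
  "add_imp (Some x) (Some y) = Some (x + y)"
| "add_imp _ _ = None"

fun recip_imp :: "impedance \<Rightarrow> impedance" where
  "recip_imp None = Some 0"
| "recip_imp (Some x) = (if x = 0 then None else Some (inverse x))"

primrec impedance :: "network \<Rightarrow> impedance" where
  "impedance (Resistor R) = Some (Fract [:R:] 1)"
| "impedance (Conductor G) = recip_imp (Some (Fract [:G:] 1))"
| "impedance (Inductor L) = Some (Fract [:0, L:] 1)"
| "impedance (Capacitor C) = recip_imp (Some (Fract [:0, C:] 1))"
| "impedance (N \<oplus> M) = add_imp (impedance N) (impedance M)"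
| "impedance (N \<parallel> M) =
     recip_imp (add_imp (recip_imp (impedance N)) (recip_imp (impedance M)))"

definition SP_impedances :: "nat \<Rightarrow> nat \<Rightarrow> impedance set" where
  "SP_impedances m n =
     {impedance N | N. admissible N \<and> num_capacitors N \<le> m \<and> num_inductors N \<le> n}"

subsection \<open>Networks with two energy storage elements\<close>

definition N5 :: "real \<Rightarrow> real \<Rightarrow> real \<Rightarrow> real \<Rightarrow> real \<Rightarrow> network" where
  "N5 R1 R2 G3 L1 L2 =
     Resistor R1 \<oplus> (Inductor L2 \<parallel> (Resistor R2 \<oplus> (Conductor G3 \<parallel> Inductor L1)))"

definition N6 :: "real \<Rightarrow> real \<Rightarrow> real \<Rightarrow> real \<Rightarrow> real \<Rightarrow> network" where
  "N6 R1 R2 G3 C1 L1 =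
     Resistor R1 \<oplus> (Inductor L1 \<parallel> (Resistor R2 \<oplus> (Conductor G3 \<parallel> Capacitor C1)))"

definition N7 :: "real \<Rightarrow> real \<Rightarrow> real \<Rightarrow> real \<Rightarrow> real \<Rightarrow> network" where
  "N7 R1 R2 G3 C1 L1 =
     Resistor R1 \<oplus> (Capacitor C1 \<parallel> (Resistor R2 \<oplus> (Conductor G3 \<parallel> Inductor L1)))"

definition N8 :: "real \<Rightarrow> real \<Rightarrow> real \<Rightarrow> real \<Rightarrow> real \<Rightarrow> network" where
  "N8 G1 G2 R3 C1 L1 =
     Conductor G1 \<parallel> (Capacitor C1 \<oplus> (Conductor G2 \<parallel> (Resistor R3 \<oplus> Inductor L1)))"

definition N9 :: "real \<Rightarrow> real \<Rightarrow> real \<Rightarrow> real \<Rightarrow> real \<Rightarrow> network" where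
  "N9 G1 G2 R3 C1 L1 =
     Conductor G1 \<parallel> (Inductor L1 \<oplus> (Conductor G2 \<parallel> (Resistor R3 \<oplus> Capacitor C1)))"

subsection \<open>Networks with three energy storage elements\<close>

definition N10 :: "real \<Rightarrow> real \<Rightarrow> real \<Rightarrow> real \<Rightarrow> real \<Rightarrow> real \<Rightarrow> real \<Rightarrow> real \<Rightarrow> network" where
  "N10 R1 R2 G3 R4 R5 C1 L1 L2 =
     Resistor R4 \<oplus> ((Resistor R5 \<oplus> Inductor L2) \<parallel>
       (Resistor R1 \<oplus> (Inductor L1 \<parallel> (Resistor R2 \<oplus> (Conductor G3 \<parallel> Capacitor C1)))))"

definition N11 :: "real \<Rightarrow> real \<Rightarrow> real \<Rightarrow> real \<Rightarrow> real \<Rightarrow> real \<Rightarrow> real \<Rightarrow> real \<Rightarrow> network" where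
  "N11 R1 R2 G3 R4 R5 C1 L1 L2 =
     Resistor R4 \<oplus> ((Resistor R5 \<oplus> Inductor L2) \<parallel>
       (Resistor R1 \<oplus> (Capacitor C1 \<parallel> (Resistor R2 \<oplus> (Conductor G3 \<parallel> Inductor L1)))))"

definition N12 :: "real \<Rightarrow> real \<Rightarrow> real \<Rightarrow> real \<Rightarrow> real \<Rightarrow> real \<Rightarrow> real \<Rightarrow> real \<Rightarrow> network" where
  "N12 G1 G2 R3 R4 R5 C1 L1 L2 =
     Resistor R4 \<oplus> ((Resistor R5 \<oplus> Inductor L2) \<parallel> Conductor G1 \<parallel>
       (Capacitor C1 \<oplus> (Conductor G2 \<parallel> (Resistor R3 \<oplus> Inductor L1))))"

definition N13 :: "real \<Rightarrow> real \<Rightarrow> real \<Rightarrow> real \<Rightarrow> real \<Rightarrow> real \<Rightarrow> real \<Rightarrow> real \<Rightarrow> network" where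
  "N13 G1 G2 R3 R4 R5 C1 L1 L2 =
     Resistor R4 \<oplus> ((Resistor R5 \<oplus> Inductor L2) \<parallel> Conductor G1 \<parallel>
       (Inductor L1 \<oplus> (Conductor G2 \<parallel> (Resistor R3 \<oplus> Capacitor C1))))"

definition class_N10 :: "network set" where
  "class_N10 = {N10 R1 R2 G3 R4 R5 C1 L1 L2 | R1 R2 G3 R4 R5 C1 L1 L2.
     R1 \<ge> 0 \<and> R2 \<ge> 0 \<and> G3 \<ge> 0 \<and> R4 \<ge> 0 \<and> R5 \<ge> 0 \<and> C1 > 0 \<and> L1 > 0 \<and> L2 > 0}"

definition class_N11 :: "network set" where
  "class_N11 = {N11 R1 R2 G3 R4 R5 C1 L1 L2 | R1 R2 G3 R4 R5 C1 L1 L2.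
     R1 \<ge> 0 \<and> R2 \<ge> 0 \<and> G3 \<ge> 0 \<and> R4 \<ge> 0 \<and> R5 \<ge> 0 \<and> C1 > 0 \<and> L1 > 0 \<and> L2 > 0}"

definition class_N12 :: "network set" where
  "class_N12 = {N12 G1 G2 R3 R4 R5 C1 L1 L2 | G1 G2 R3 R4 R5 C1 L1 L2.
     G1 \<ge> 0 \<and> G2 \<ge> 0 \<and> R3 \<ge> 0 \<and> R4 \<ge> 0 \<and> R5 \<ge> 0 \<and> C1 > 0 \<and> L1 > 0 \<and> L2 > 0}"

definition class_N13 :: "network set" where
  "class_N13 = {N13 G1 G2 R3 R4 R5 C1 L1 L2 | G1 G2 R3 R4 R5 C1 L1 L2.
     G1 \<ge> 0 \<and> G2 \<ge> 0 \<and> R3 \<ge> 0 \<and> R4 \<ge> 0 \<and> R5 \<ge> 0 \<and> C1 > 0 \<and> L1 > 0 \<and> L2 > 0}"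

definition class_N17 :: "network set" where
  "class_N17 = {N10 R1 R2 0 R4 R5 C1 L1 L2 | R1 R2 R4 R5 C1 L1 L2.
     R1 \<ge> 0 \<and> R2 \<ge> 0 \<and> R4 \<ge> 0 \<and> R5 \<ge> 0 \<and> C1 > 0 \<and> L1 > 0 \<and> L2 > 0}"

definition class_N20 :: "network set" where
  "class_N20 = {N11 R1 R2 0 R4 R5 C1 L1 L2 | R1 R2 R4 R5 C1 L1 L2.
     R1 \<ge> 0 \<and> R2 \<ge> 0 \<and> R4 \<ge> 0 \<and> R5 \<ge> 0 \<and> C1 > 0 \<and> L1 > 0 \<and> L2 > 0}"

definition class_N22 :: "network set" where
  "class_N22 = {N12 0 G2 R3 R4 R5 C1 L1 L2 | G2 R3 R4 R5 C1 L1 L2.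
     G2 \<ge> 0 \<and> R3 \<ge> 0 \<and> R4 \<ge> 0 \<and> R5 \<ge> 0 \<and> C1 > 0 \<and> L1 > 0 \<and> L2 > 0}"

definition class_N23 :: "network set" where
  "class_N23 = {N12 G1 G2 0 R4 R5 C1 L1 L2 | G1 G2 R4 R5 C1 L1 L2.
     G1 \<ge> 0 \<and> G2 \<ge> 0 \<and> R4 \<ge> 0 \<and> R5 \<ge> 0 \<and> C1 > 0 \<and> L1 > 0 \<and> L2 > 0}"

definition class_N25 :: "network set" where
  "class_N25 = {N13 0 G2 R3 R4 R5 C1 L1 L2 | G2 R3 R4 R5 C1 L1 L2.
     G2 \<ge> 0 \<and> R3 \<ge> 0 \<and> R4 \<ge> 0 \<and> R5 \<ge> 0 \<and> C1 > 0 \<and> L1 > 0 \<and> L2 > 0}"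

definition class_N26 :: "network set" where
  "class_N26 = {N13 G1 G2 0 R4 R5 C1 L1 L2 | G1 G2 R4 R5 C1 L1 L2.
     G1 \<ge> 0 \<and> G2 \<ge> 0 \<and> R4 \<ge> 0 \<and> R5 \<ge> 0 \<and> C1 > 0 \<and> L1 > 0 \<and> L2 > 0}"


section \<open>Algebraic data of a pair of quadratic polynomials\<close>

text \<open>
  Throughout, \<open>a\<close> and \<open>b\<close> have degree at most two, and \<open>a\<^sub>i\<close>, \<open>b\<^sub>i\<close> are \<open>coeff a i\<close>, \<open>coeff b i\<close>.
  Polynomials in the indeterminates \<open>u\<close>, \<open>v\<close> are given by their values at real \<open>u\<close>, \<open>v\<close>.
\<close>

definition F0 :: "real poly \<Rightarrow> real poly \<Rightarrow> real" where
  "F0 a b = det (vector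
     [vector [coeff b 2, coeff b 1, coeff b 0, 0],
      vector [coeff a 2, coeff a 1, coeff a 0, 0],
      vector [0, coeff b 2, coeff b 1, coeff b 0],
      vector [0, coeff a 2, coeff a 1, coeff a 0]] :: real^4^4)"

definition is_bezoutian :: "real poly \<Rightarrow> real poly \<Rightarrow> real^2^2 \<Rightarrow> bool" where
  "is_bezoutian a b B \<longleftrightarrow>
     (\<forall>z w. z \<noteq> w \<longrightarrow>
        (poly a z * poly b w - poly b z * poly a w) / (z - w)
          = B$1$1 + B$1$2 * w + B$2$1 * z + B$2$2 * z * w)"

definition bezoutian :: "real poly \<Rightarrow> real poly \<Rightarrow> real^2^2" where
  "bezoutian a b = (THE B. is_bezoutian a b B)"

lemma poly_deg_le_2:
  fixes p :: "real poly"
  assumes "degree p \<le> 2"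
  shows "poly p x = coeff p 0 + coeff p 1 * x + coeff p 2 * x^2"
proof -
  have "poly p x = (\<Sum>i\<le>2. coeff p i * x ^ i)"
    unfolding poly_altdef using assms
    by (intro sum.mono_neutral_left) (auto simp: coeff_eq_0)
  thus ?thesis
    by (simp add: numeral_2_eq_2)
qed

text \<open>The matrix \<open>bezoutian a b\<close> is well defined.\<close>

lemma is_bezoutian_bezoutian:
  fixes a b :: "real poly"
  assumes "degree a \<le> 2" "degree b \<le> 2"
  shows "is_bezoutian a b (bezoutian a b)"
    and "is_bezoutian a b B \<Longrightarrow> B = bezoutian a b"
proof -
  define B0 :: "real^2^2" where
    "B0 = vector
      [vector [coeff a 1 * coeff b 0 - coeff a 0 * coeff b 1,
               coeff a 2 * coeff b 0 - coeff a 0 * coeff b 2],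
       vector [coeff a 2 * coeff b 0 - coeff a 0 * coeff b 2,
               coeff a 2 * coeff b 1 - coeff a 1 * coeff b 2]]"
  have "poly a z * poly b w - poly b z * poly a w
      = (B0$1$1 + B0$1$2 * w + B0$2$1 * z + B0$2$2 * z * w) * (z - w)" for z w
    unfolding B0_def poly_deg_le_2[OF assms(1)] poly_deg_le_2[OF assms(2)] vector_2
    by algebra
  hence ex: "is_bezoutian a b B0"
    unfolding is_bezoutian_def by simp
  have uniq: "B = B'" if "is_bezoutian a b B" "is_bezoutian a b B'" for B B'
  proof -
    have eq: "B$1$1 + B$1$2 * w + B$2$1 * z + B$2$2 * z * w
            = B'$1$1 + B'$1$2 * w + B'$2$1 * z + B'$2$2 * z * w" if "z \<noteq> w" for z w
      using that \<open>is_bezoutian a b B\<close> \<open>is_bezoutian a b B'\<close> unfolding is_bezoutian_def by metis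
    show ?thesis
      using eq[of 0 1] eq[of 0 2] eq[of 1 0] eq[of 2 0] eq[of 1 2]
      by (simp add: vec_eq_iff forall_2)
  qed
  show "is_bezoutian a b (bezoutian a b)"
    unfolding bezoutian_def by (rule theI[where P = "is_bezoutian a b", OF ex]) (rule uniq[OF _ ex])
  thus "is_bezoutian a b B \<Longrightarrow> B = bezoutian a b"
    using uniq by blast
qed

definition alpha :: "real poly \<Rightarrow> real \<Rightarrow> real" where
  "alpha a u = coeff a 2 * u^2 - coeff a 1 * u + coeff a 0"

definition beta :: "real poly \<Rightarrow> real \<Rightarrow> real" where
  "beta b u = coeff b 2 * u^2 - coeff b 1 * u + coeff b 0"

definition f0 :: "real poly \<Rightarrow> real poly \<Rightarrow> real \<Rightarrow> real" where
  "f0 a b u = (vector [1, - u] v* bezoutian a b) $ 1"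

definition f1 :: "real poly \<Rightarrow> real poly \<Rightarrow> real \<Rightarrow> real" where
  "f1 a b u = (vector [1, - u] v* bezoutian a b) $ 2"

definition c2 :: "real poly \<Rightarrow> real poly \<Rightarrow> real \<Rightarrow> real" where
  "c2 a b u = f1 a b u"

definition c1 :: "real poly \<Rightarrow> real poly \<Rightarrow> real \<Rightarrow> real" where
  "c1 a b u = f0 a b u + u * f1 a b u"

definition c0 :: "real poly \<Rightarrow> real poly \<Rightarrow> real \<Rightarrow> real" where
  "c0 a b u = u * f0 a b u"

definition d2 :: "real poly \<Rightarrow> real poly \<Rightarrow> real \<Rightarrow> real \<Rightarrow> real" where
  "d2 a b u v = beta b u * coeff b 2"

definition d1 :: "real poly \<Rightarrow> real poly \<Rightarrow> real \<Rightarrow> real \<Rightarrow> real" where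
  "d1 a b u v = beta b u * (coeff b 1 - v * f1 a b u)"

definition d0 :: "real poly \<Rightarrow> real poly \<Rightarrow> real \<Rightarrow> real \<Rightarrow> real" where
  "d0 a b u v = beta b u * (coeff b 0 - v * f0 a b u)"

definition eta :: "real poly \<Rightarrow> real poly \<Rightarrow> real \<Rightarrow> real \<Rightarrow> real" where
  "eta a b u v =
     coeff b 2 * u^2 - (coeff b 1 - v * f1 a b u) * u + coeff b 0 - v * f0 a b u"

definition gamma1 :: "real poly \<Rightarrow> real poly \<Rightarrow> real \<Rightarrow> real \<Rightarrow> real" where
  "gamma1 a b u v = c1 a b u * d0 a b u v - c0 a b u * d1 a b u v"

definition gamma2 :: "real poly \<Rightarrow> real poly \<Rightarrow> real \<Rightarrow> real \<Rightarrow> real" where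
  "gamma2 a b u v = c2 a b u * d0 a b u v - c0 a b u * d2 a b u v"

definition gamma3 :: "real poly \<Rightarrow> real poly \<Rightarrow> real \<Rightarrow> real \<Rightarrow> real" where
  "gamma3 a b u v = c2 a b u * d1 a b u v - c1 a b u * d2 a b u v"

definition lambda1 :: "real poly \<Rightarrow> real poly \<Rightarrow> real \<Rightarrow> real \<Rightarrow> real" where
  "lambda1 a b u v = d1 a b u v * gamma1 a b u v - d0 a b u v * gamma2 a b u v"

definition lambda2 :: "real poly \<Rightarrow> real poly \<Rightarrow> real \<Rightarrow> real \<Rightarrow> real" where
  "lambda2 a b u v = c1 a b u * gamma3 a b u v - c2 a b u * gamma2 a b u v"

definition lambda3 :: "real poly \<Rightarrow> real poly \<Rightarrow> real \<Rightarrow> real \<Rightarrow> real" where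
  "lambda3 a b u v = d2 a b u v * gamma2 a b u v - d1 a b u v * gamma3 a b u v"

definition lambda4 :: "real poly \<Rightarrow> real poly \<Rightarrow> real \<Rightarrow> real \<Rightarrow> real" where
  "lambda4 a b u v = c0 a b u * gamma2 a b u v - c1 a b u * gamma1 a b u v"

definition Gamma1 :: "real poly \<Rightarrow> real poly \<Rightarrow> real" where
  "Gamma1 a b = coeff a 1 * coeff b 0 - coeff a 0 * coeff b 1"

definition Gamma2 :: "real poly \<Rightarrow> real poly \<Rightarrow> real" where
  "Gamma2 a b = coeff a 2 * coeff b 0 - coeff a 0 * coeff b 2"

definition Gamma3 :: "real poly \<Rightarrow> real poly \<Rightarrow> real" where
  "Gamma3 a b = coeff a 2 * coeff b 1 - coeff a 1 * coeff b 2"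

definition Lambda1 :: "real poly \<Rightarrow> real poly \<Rightarrow> real" where
  "Lambda1 a b = coeff b 1 * Gamma1 a b - coeff b 0 * Gamma2 a b"

definition Lambda2 :: "real poly \<Rightarrow> real poly \<Rightarrow> real" where
  "Lambda2 a b = coeff a 1 * Gamma3 a b - coeff a 2 * Gamma2 a b"

definition Lambda3 :: "real poly \<Rightarrow> real poly \<Rightarrow> real" where
  "Lambda3 a b = coeff b 2 * Gamma2 a b - coeff b 1 * Gamma3 a b"

definition Lambda4 :: "real poly \<Rightarrow> real poly \<Rightarrow> real" where
  "Lambda4 a b = coeff a 0 * Gamma2 a b - coeff a 1 * Gamma1 a b"


section \<open>Realizability conditions\<close>

definition same_sign :: "real set \<Rightarrow> bool" where
  "same_sign S \<longleftrightarrow> (\<forall>x\<in>S. x \<ge> 0) \<or> (\<forall>x\<in>S. x \<le> 0)"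

definition Q1 :: "real poly \<Rightarrow> real poly \<Rightarrow> bool" where
  "Q1 a b \<longleftrightarrow>
     same_sign {coeff a 0, coeff a 1, coeff a 2, coeff b 0, coeff b 1, coeff b 2, Lambda1 a b} \<and>
     Gamma2 a b \<ge> 0"

definition Q2 :: "real poly \<Rightarrow> real poly \<Rightarrow> bool" where
  "Q2 a b \<longleftrightarrow>
     same_sign {coeff a 0, coeff a 1, coeff a 2, coeff b 0, coeff b 1, coeff b 2, Lambda2 a b} \<and>
     Gamma2 a b \<ge> 0"

definition Q3 :: "real poly \<Rightarrow> real poly \<Rightarrow> bool" where
  "Q3 a b \<longleftrightarrow>
     same_sign {coeff a 0, coeff a 1, coeff a 2, coeff b 0, coeff b 1, coeff b 2, Lambda3 a b} \<and>
     Gamma2 a b \<le> 0"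

definition Q4 :: "real poly \<Rightarrow> real poly \<Rightarrow> bool" where
  "Q4 a b \<longleftrightarrow>
     same_sign {coeff a 0, coeff a 1, coeff a 2, coeff b 0, coeff b 1, coeff b 2, Lambda4 a b} \<and>
     Gamma2 a b \<le> 0"

definition Q5 :: "real poly \<Rightarrow> real poly \<Rightarrow> real \<Rightarrow> real \<Rightarrow> bool" where
  "Q5 a b x z \<longleftrightarrow>
     (\<forall>i\<in>{0,1,2}. coeff a i \<ge> 0 \<and> coeff b i \<ge> 0) \<and>
     same_sign {alpha a x, beta b x, z, d0 a b x z, d1 a b x z, d2 a b x z,
       f0 a b x, f1 a b x, lambda1 a b x z} \<and>
     gamma2 a b x z \<ge> 0 \<and> - beta b x * eta a b x z * F0 a b \<ge> 0 \<and>
     eta a b x z \<noteq> 0 \<and> F0 a b \<noteq> 0"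

definition Q6 :: "real poly \<Rightarrow> real poly \<Rightarrow> real \<Rightarrow> real \<Rightarrow> bool" where
  "Q6 a b x z \<longleftrightarrow>
     (\<forall>i\<in>{0,1,2}. coeff a i \<ge> 0 \<and> coeff b i \<ge> 0) \<and>
     same_sign {alpha a x, beta b x, z, d0 a b x z, d1 a b x z, d2 a b x z,
       f0 a b x, f1 a b x, lambda3 a b x z} \<and>
     gamma2 a b x z \<le> 0 \<and> beta b x * eta a b x z * F0 a b \<le> 0 \<and>
     eta a b x z \<noteq> 0 \<and> F0 a b \<noteq> 0"

definition Q7 :: "real poly \<Rightarrow> real poly \<Rightarrow> real \<Rightarrow> real \<Rightarrow> bool" where
  "Q7 a b x z \<longleftrightarrow>
     (\<forall>i\<in>{0,1,2}. coeff a i \<ge> 0 \<and> coeff b i \<ge> 0) \<and>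
     same_sign {alpha a x, beta b x, z, d0 a b x z, d1 a b x z, d2 a b x z,
       f0 a b x, f1 a b x, lambda4 a b x z} \<and>
     gamma2 a b x z \<le> 0 \<and> beta b x * eta a b x z * F0 a b \<le> 0 \<and>
     eta a b x z \<noteq> 0 \<and> F0 a b \<noteq> 0"

definition Q8 :: "real poly \<Rightarrow> real poly \<Rightarrow> real \<Rightarrow> real \<Rightarrow> bool" where
  "Q8 a b x z \<longleftrightarrow>
     (\<forall>i\<in>{0,1,2}. coeff a i \<ge> 0 \<and> coeff b i \<ge> 0) \<and>
     same_sign {alpha a x, beta b x, z, d0 a b x z, d1 a b x z, d2 a b x z,
       f0 a b x, f1 a b x, lambda2 a b x z} \<and>
     gamma2 a b x z \<ge> 0 \<and> - beta b x * eta a b x z * F0 a b \<ge> 0 \<and>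
     eta a b x z \<noteq> 0 \<and> F0 a b \<noteq> 0"

definition F1 :: "real poly \<Rightarrow> real poly \<Rightarrow> real \<Rightarrow> real \<Rightarrow> bool" where
  "F1 a b x z \<longleftrightarrow> lambda1 a b x z = 0"

definition F2 :: "real poly \<Rightarrow> real poly \<Rightarrow> real \<Rightarrow> real \<Rightarrow> bool" where
  "F2 a b x z \<longleftrightarrow> lambda3 a b x z = 0"

definition F3_i :: "real poly \<Rightarrow> real poly \<Rightarrow> real \<Rightarrow> real \<Rightarrow> bool" where
  "F3_i a b x z \<longleftrightarrow> lambda4 a b x z = 0"

definition F3_ii :: "real poly \<Rightarrow> real poly \<Rightarrow> real \<Rightarrow> real \<Rightarrow> bool" where
  "F3_ii a b x z \<longleftrightarrow> d0 a b x z = 0"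

definition F3 :: "real poly \<Rightarrow> real poly \<Rightarrow> real \<Rightarrow> real \<Rightarrow> bool" where
  "F3 a b x z \<longleftrightarrow> F3_i a b x z \<or> F3_ii a b x z"

definition F4_i :: "real poly \<Rightarrow> real poly \<Rightarrow> real \<Rightarrow> real \<Rightarrow> bool" where
  "F4_i a b x z \<longleftrightarrow> lambda2 a b x z = 0"

definition F4_ii :: "real poly \<Rightarrow> real poly \<Rightarrow> real \<Rightarrow> real \<Rightarrow> bool" where
  "F4_ii a b x z \<longleftrightarrow> d2 a b x z = 0"

definition F4 :: "real poly \<Rightarrow> real poly \<Rightarrow> real \<Rightarrow> real \<Rightarrow> bool" where
  "F4 a b x z \<longleftrightarrow> F4_i a b x z \<or> F4_ii a b x z"

end

theory Submission
  imports Defs "HOL-Computational_Algebra.Field_as_Ring"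
begin

text \<open>
  \<^bold>\<open>Two energy storage elements.\<close> With \<open>\<Gamma>\<^sub>1, \<Gamma>\<^sub>2, \<Gamma>\<^sub>3\<close> the entries of the Bezoutian of \<open>p\<close> and \<open>q\<close>,
  \<open>F\<^sub>0 = \<Gamma>\<^sub>1 \<Gamma>\<^sub>3 - \<Gamma>\<^sub>2\<^sup>2\<close> is its determinant. Adding a resistor leaves the Bezoutian unchanged, inversion
  changes its sign, and the sum of two first-order impedances has as Bezoutian a combination of two
  rank one matrices whose signs are those of the elements (inductor or capacitor) involved. So networks with two
  inductors give semidefinite Bezoutians and networks with one element of each kind indefinite ones;
  in the latter case one of (Q1)--(Q4) holds, and these conditions survive the addition of resistors.

  \<^bold>\<open>Three energy storage elements.\<close> If \<open>Z = R + (((s + x) / y) \<parallel> W)\<close> is biquadratic, a cancellation must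
  occur, and it forces \<open>W = c / d\<close> with \<open>c = (s + x) g\<close>, \<open>d = b - y g\<close> and \<open>a = R b + (s + x) g\<close>. Up to the
  factor \<open>\<beta>\<close> these are the \<open>c\<close> and \<open>d\<close> of the statement (with \<open>\<beta> z = y\<close>), so (Q5)--(Q8) express that \<open>c / d\<close> satisfies
  one of (Q1)--(Q4) with \<open>F\<^sub>0 < 0\<close>, which realizes \<open>W\<close>. Conversely, decrease \<open>y\<close> with \<open>x\<close> fixed: either
  \<open>c\<close> and \<open>d\<close> acquire a common factor, or \<open>y = 0\<close> is reached, and in both cases two energy storage
  elements suffice; or one of the \<open>\<lambda>\<^sub>i\<close> vanishes on the way.
\<close>

text \<open>Signs of Bezoutians do not settle everything: that the sum of an RC and an RL impedance
  satisfies one of (Q1)--(Q4) is a genuine inequality, \<open>RC_plus_RL_ineq\<close>. Elsewhere two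
  symmetries save work: \<open>Z\<close> to \<open>1/Z\<close>, which exchanges inductors with
  capacitors, and \<open>s\<close> to \<open>1/s\<close>, which reverses the coefficients. Fractions
  built up from a network have nonnegative coefficients but need not be reduced, so the classes
  speak of arbitrary representatives and must admit \<open>F0 = 0\<close>. Since \<open>Z\<close> is
  reduced and of degree two, that case is excluded at the end. Two facts control the descent in
  \<open>y\<close>. First, \<open>F0 c (d y)\<close> is \<open>F0 a b\<close> times a function
  affine in \<open>y\<close> with value 1 at 0, so its sign can change only where \<open>d\<close>
  acquires the factor \<open>s + x\<close> of \<open>c\<close>. Secondly, \<open>Gamma2\<close> does
  not decrease as \<open>y\<close> falls. Hence the region of (Q1) and (Q2) is not left through
  \<open>Gamma2 = 0\<close>, while that of (Q3) and (Q4) may be; but there (Q3) or (Q4) turns into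
  (Q1) or (Q2).\<close>

lemma coeff_quadratic [simp]:
  "coeff [:p0, p1, p2:] 2 = p2" "coeff [:p0, p1:] 2 = 0" "coeff [:p0:] 2 = 0"
  by (simp_all add: numeral_2_eq_2)

lemma quadratic_eqI:
  fixes p :: "'a::zero poly"
  assumes "degree p \<le> 2"
  shows "p = [:coeff p 0, coeff p 1, coeff p 2:]"
proof (rule poly_eqI)
  fix n :: nat
  consider "n = 0" | "n = 1" | "n = 2" | "n > 2" by linarith
  then show "coeff p n = coeff [:coeff p 0, coeff p 1, coeff p 2:] n"
  proof cases
    case 4
    with assms show ?thesis
      by (cases n) (auto simp: coeff_pCons coeff_eq_0 split: nat.split)
  qed (simp_all add: coeff_pCons)
qed

lemma degree_quadratic: "degree [:p0, p1, p2:] \<le> 2"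
  by (simp add: numeral_2_eq_2)

section \<open>Bezoutian, resultant and sign conditions of two quadratics\<close>

lemma det_4:
  "det (A::'a::comm_ring_1^4^4) =
     A$1$1 * (A$2$2 * (A$3$3 * A$4$4 - A$3$4 * A$4$3) - A$2$3 * (A$3$2 * A$4$4 - A$3$4 * A$4$2)
       + A$2$4 * (A$3$2 * A$4$3 - A$3$3 * A$4$2))
   - A$1$2 * (A$2$1 * (A$3$3 * A$4$4 - A$3$4 * A$4$3) - A$2$3 * (A$3$1 * A$4$4 - A$3$4 * A$4$1)
       + A$2$4 * (A$3$1 * A$4$3 - A$3$3 * A$4$1))
   + A$1$3 * (A$2$1 * (A$3$2 * A$4$4 - A$3$4 * A$4$2) - A$2$2 * (A$3$1 * A$4$4 - A$3$4 * A$4$1)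
       + A$2$4 * (A$3$1 * A$4$2 - A$3$2 * A$4$1))
   - A$1$4 * (A$2$1 * (A$3$2 * A$4$3 - A$3$3 * A$4$2) - A$2$2 * (A$3$1 * A$4$3 - A$3$3 * A$4$1)
       + A$2$3 * (A$3$1 * A$4$2 - A$3$2 * A$4$1))"
proof -
  have f1: "finite {2::4, 3, 4}" "1 \<notin> {2::4, 3, 4}" by auto
  have f2: "finite {3::4, 4}" "2 \<notin> {3::4, 4}" by auto
  have f3: "finite {4::4}" "3 \<notin> {4::4}" by auto
  show ?thesis
    unfolding det_def UNIV_4
    unfolding sum_over_permutations_insert[OF f1]
    unfolding sum_over_permutations_insert[OF f2]
    unfolding sum_over_permutations_insert[OF f3]
    unfolding permutes_sing
    by (simp add: sign_swap_id permutation_swap_id permutation_compose sign_compose sign_id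
        swap_id_eq algebra_simps)
qed

lemma vector_4:
  "(vector [x,y,z,w] :: 'a::zero^4)$1 = x" "(vector [x,y,z,w] :: 'a::zero^4)$2 = y"
  "(vector [x,y,z,w] :: 'a::zero^4)$3 = z" "(vector [x,y,z,w] :: 'a::zero^4)$4 = w"
  unfolding vector_def by simp_all

lemma F0_Gamma: "F0 a b = Gamma1 a b * Gamma3 a b - (Gamma2 a b)^2"
  unfolding F0_def det_4 vector_4 Gamma1_def Gamma2_def Gamma3_def by algebra

lemma bezoutian_Gamma:
  assumes "degree a \<le> 2" "degree b \<le> 2"
  shows "bezoutian a b = vector [vector [Gamma1 a b, Gamma2 a b], vector [Gamma2 a b, Gamma3 a b]]"
proof -
  define B :: "real^2^2" where
    "B = vector [vector [Gamma1 a b, Gamma2 a b], vector [Gamma2 a b, Gamma3 a b]]"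
  have "poly a z * poly b w - poly b z * poly a w
      = (B$1$1 + B$1$2 * w + B$2$1 * z + B$2$2 * z * w) * (z - w)" for z w
    unfolding B_def poly_deg_le_2[OF assms(1)] poly_deg_le_2[OF assms(2)] vector_2
      Gamma1_def Gamma2_def Gamma3_def
    by algebra
  hence "is_bezoutian a b B"
    unfolding is_bezoutian_def by simp
  from is_bezoutian_bezoutian(2)[OF assms this] show ?thesis
    unfolding B_def by simp
qed

lemma
  assumes "degree a \<le> 2" "degree b \<le> 2"
  shows f0_Gamma: "f0 a b u = Gamma1 a b - u * Gamma2 a b"
    and f1_Gamma: "f1 a b u = Gamma2 a b - u * Gamma3 a b"
  unfolding f0_def f1_def bezoutian_Gamma[OF assms] vector_matrix_mult_def
  by (simp_all add: sum_2)

lemmas Gamma_Lambda_defs = Gamma1_def Gamma2_def Gamma3_def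
  Lambda1_def Lambda2_def Lambda3_def Lambda4_def

text \<open>This is the passage to \<open>1/Z\<close>, by which \<open>N8\<close> and
  \<open>N9\<close> are reduced to \<open>N6\<close> and \<open>N7\<close>.\<close>

lemma swap_Gamma_Lambda:
  "Gamma1 q p = - Gamma1 p q" "Gamma2 q p = - Gamma2 p q" "Gamma3 q p = - Gamma3 p q"
  "Lambda1 q p = Lambda4 p q" "Lambda2 q p = Lambda3 p q"
  "Lambda3 q p = Lambda2 p q" "Lambda4 q p = Lambda1 p q"
  "F0 q p = F0 p q"
  unfolding F0_Gamma Gamma_Lambda_defs by algebra+

lemma same_sign7: "same_sign {x1,x2,x3,x4,x5,x6,x7} \<longleftrightarrow>
   (0 \<le> x1 \<and> 0 \<le> x2 \<and> 0 \<le> x3 \<and> 0 \<le> x4 \<and> 0 \<le> x5 \<and> 0 \<le> x6 \<and> 0 \<le> x7) \<or>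
   (x1 \<le> 0 \<and> x2 \<le> 0 \<and> x3 \<le> 0 \<and> x4 \<le> 0 \<and> x5 \<le> 0 \<and> x6 \<le> 0 \<and> x7 \<le> 0)"
  unfolding same_sign_def ball_simps by (simp only: simp_thms)

lemma swap_Q: "Q1 q p \<longleftrightarrow> Q4 p q" "Q2 q p \<longleftrightarrow> Q3 p q" "Q3 q p \<longleftrightarrow> Q2 p q" "Q4 q p \<longleftrightarrow> Q1 p q"
proof -
  have "{x1, x2, x3, x4, x5, x6, l} = {x4, x5, x6, x1, x2, x3, l}" for x1 x2 x3 x4 x5 x6 l :: real
    by (simp add: insert_commute)
  note set_eq = this[of "coeff q 0"]
  show "Q1 q p \<longleftrightarrow> Q4 p q" "Q2 q p \<longleftrightarrow> Q3 p q" "Q3 q p \<longleftrightarrow> Q2 p q" "Q4 q p \<longleftrightarrow> Q1 p q"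
    unfolding Q1_def Q2_def Q3_def Q4_def swap_Gamma_Lambda[of q p] set_eq
      neg_0_le_iff_le neg_le_0_iff_le by (rule refl)+
qed

lemma smult_Gamma_Lambda:
  "Gamma1 (smult k p) (smult k q) = k^2 * Gamma1 p q"
  "Gamma2 (smult k p) (smult k q) = k^2 * Gamma2 p q"
  "Gamma3 (smult k p) (smult k q) = k^2 * Gamma3 p q"
  "Lambda1 (smult k p) (smult k q) = k * (k^2 * Lambda1 p q)"
  "Lambda2 (smult k p) (smult k q) = k * (k^2 * Lambda2 p q)"
  "Lambda3 (smult k p) (smult k q) = k * (k^2 * Lambda3 p q)"
  "Lambda4 (smult k p) (smult k q) = k * (k^2 * Lambda4 p q)"
  "F0 (smult k p) (smult k q) = k^4 * F0 p q"
  unfolding F0_Gamma Gamma_Lambda_defs coeff_smult by algebra+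

lemma smult_Q:
  assumes "k > 0"
  shows "Q1 (smult k p) (smult k q) \<longleftrightarrow> Q1 p q" "Q2 (smult k p) (smult k q) \<longleftrightarrow> Q2 p q"
    "Q3 (smult k p) (smult k q) \<longleftrightarrow> Q3 p q" "Q4 (smult k p) (smult k q) \<longleftrightarrow> Q4 p q"
proof -
  have scale: "0 \<le> k * x \<longleftrightarrow> 0 \<le> x" "k * x \<le> 0 \<longleftrightarrow> x \<le> 0"
    "0 \<le> k^2 * x \<longleftrightarrow> 0 \<le> x" "k^2 * x \<le> 0 \<longleftrightarrow> x \<le> 0" for x
    using assms by (simp_all add: zero_le_mult_iff mult_le_0_iff)
  show "Q1 (smult k p) (smult k q) \<longleftrightarrow> Q1 p q" "Q2 (smult k p) (smult k q) \<longleftrightarrow> Q2 p q"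
    "Q3 (smult k p) (smult k q) \<longleftrightarrow> Q3 p q" "Q4 (smult k p) (smult k q) \<longleftrightarrow> Q4 p q"
    unfolding Q1_def Q2_def Q3_def Q4_def smult_Gamma_Lambda coeff_smult same_sign7
    by (simp_all only: scale)
qed

lemma coprime_no_common_root:
  fixes a b :: "real poly"
  assumes "coprime a b" "poly a r = 0"
  shows "poly b r \<noteq> 0"
proof
  assume "poly b r = 0"
  with assms have "is_unit [:- r, 1:]"
    by (meson coprime_common_divisor poly_eq_0_iff_dvd)
  thus False by (simp add: is_unit_pCons_iff)
qed

text \<open>A singular Bezoutian has a kernel vector. If \<open>g3 \<noteq> 0\<close> it is
  \<open>(1, r)\<close>, and \<open>r\<close> is a common root; if \<open>g3 = 0\<close> the whole
  matrix vanishes and the polynomials are proportional.\<close>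

lemma F0_nonzero:
  assumes "degree a \<le> 2" "degree b \<le> 2" "coprime a b" "coeff a 2 \<noteq> 0 \<or> coeff b 2 \<noteq> 0"
  shows "F0 a b \<noteq> 0"
proof
  assume "F0 a b = 0"
  obtain a0 a1 a2 where a: "a = [:a0, a1, a2:]" using quadratic_eqI[OF assms(1)] by blast
  obtain b0 b1 b2 where b: "b = [:b0, b1, b2:]" using quadratic_eqI[OF assms(2)] by blast
  define g1 g2 g3 where g: "g1 = a1*b0 - a0*b1" "g2 = a2*b0 - a0*b2" "g3 = a2*b1 - a1*b2"
  have F: "g1 * g3 = g2^2" using \<open>F0 a b = 0\<close>
    by (simp add: F0_Gamma Gamma_Lambda_defs a b g)
  have top: "a2 \<noteq> 0 \<or> b2 \<noteq> 0" using assms(4) a b by simp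
  show False
  proof (cases "g3 = 0")
    case False
    define r where "r = - g2 / g3"
    have r: "g3 * r + g2 = 0" "g2 * r + g1 = 0"
      using False F by (simp_all add: r_def field_simps power2_eq_square)
    \<comment> \<open>The values of \<open>a\<close> and \<open>b\<close> at \<open>r\<close> form a
      vector proportional to both \<open>(a2, b2)\<close> and \<open>(a1, b1)\<close>, which are
      independent because \<open>g3 \<noteq> 0\<close>.\<close>
    have "a2 * poly b r = b2 * poly a r" "a1 * poly b r = b1 * poly a r"
      using r unfolding a b g by (simp_all; algebra)+
    hence "g3 * poly a r = 0" "g3 * poly b r = 0" unfolding g by algebra+
    with False coprime_no_common_root[OF assms(3)] show False by auto
  next
    case True
    hence g2: "g2 = 0" using F by simp
    \<comment> \<open>The minors satisfy \<open>a2*g1 - a1*g2 + a0*g3 = 0\<close>, and likewise with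
      the coefficients of \<open>b\<close>.\<close>
    have "a2 * g1 = 0" "b2 * g1 = 0" using True g2 unfolding g by algebra+
    hence g1: "g1 = 0" using top by auto
    have "smult a2 b = smult b2 a" using g1 g2 True unfolding a b g by simp
    with top have "a dvd b \<and> a2 \<noteq> 0 \<or> b dvd a \<and> b2 \<noteq> 0"
      by (metis dvd_smult_cancel dvd_triv_right dvd_refl dvd_smult)
    with assms(3) have "is_unit a \<and> a2 \<noteq> 0 \<or> is_unit b \<and> b2 \<noteq> 0"
      by (metis coprime_absorb_left coprime_absorb_right)
    thus False unfolding a b by (auto simp: is_unit_pCons_iff)
  qed
qed

section \<open>Calculus of impedances\<close>

lemma Fract_eq_0_iff: "q \<noteq> 0 \<Longrightarrow> Fract p q = 0 \<longleftrightarrow> p = 0"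
  using eq_fract(1)[of q 1 p 0] by (simp only: Zero_fract_def) simp

lemma recip_imp_Fract:
  "q \<noteq> 0 \<Longrightarrow> recip_imp (Some (Fract p q)) = (if p = 0 then None else Some (Fract q p))"
  by (simp add: Fract_eq_0_iff inverse_fract)

lemma recip_recip_imp [simp]: "recip_imp (recip_imp z) = z"
  by (cases z) auto

lemma add_imp_Fract:
  "q \<noteq> 0 \<Longrightarrow> s \<noteq> 0 \<Longrightarrow> add_imp (Some (Fract p q)) (Some (Fract r s)) = Some (Fract (p * s + r * q) (q * s))"
  by simp

lemma add_imp_commute: "add_imp y z = add_imp z y"
  by (cases y; cases z) (simp_all add: add.commute)

lemma add_imp_assoc: "add_imp (add_imp x y) z = add_imp x (add_imp y z)"
  by (cases x; cases y; cases z) (simp_all add: add.assoc)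

lemma add_imp_None [simp]: "add_imp None z = None" "add_imp z None = None"
  by (cases z; simp)+

lemma add_imp_zero: "add_imp (Some 0) z = z"
  by (cases z) simp_all

lemma impedance_Resistor: "impedance (Resistor R) = Some (Fract [:R:] 1)"
  by simp

lemma impedance_Inductor: "impedance (Inductor L) = Some (Fract [:0, L:] 1)"
  by simp

lemma impedance_Capacitor: "C \<noteq> 0 \<Longrightarrow> impedance (Capacitor C) = Some (Fract 1 [:0, C:])"
  by (simp add: recip_imp_Fract del: recip_imp.simps)

lemma impedance_Series:
  assumes "impedance N = Some (Fract p q)" "impedance M = Some (Fract r s)" "q \<noteq> 0" "s \<noteq> 0"
  shows "impedance (N \<oplus> M) = Some (Fract (p * s + r * q) (q * s))"
  using assms by simp

text \<open>A short circuit has admittance \<open>None\<close>, so \<open>p = 0\<close> or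
  \<open>r = 0\<close> bypasses the addition of fractions and is a case of its own.\<close>

lemma impedance_Parallel:
  assumes "impedance N = Some (Fract p q)" "impedance M = Some (Fract r s)"
    and "q \<noteq> 0" "s \<noteq> 0" "p * s + q * r \<noteq> 0"
  shows "impedance (N \<parallel> M) = Some (Fract (p * r) (p * s + q * r))"
proof -
  have zero: "recip_imp (add_imp (recip_imp (Some 0)) z) = Some 0"
    "recip_imp (add_imp z (recip_imp (Some 0))) = Some 0" for z by simp_all
  show ?thesis
  proof (cases "p = 0 \<or> r = 0")
    case True
    thus ?thesis using assms(1,2) zero by (auto simp: fract_collapse)
  next
    case False
    thus ?thesis using assms(3-5) unfolding impedance.simps(6) assms(1,2)
      by (simp add: recip_imp_Fract add_imp_Fract add_ac mult_ac del: recip_imp.simps add_imp.simps)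
  qed
qed

text \<open>The conductor is treated together with its partner because \<open>Conductor 0\<close>
  alone has impedance \<open>None\<close> and is no fraction to which
  \<open>impedance_Parallel\<close> could apply.\<close>

lemma impedance_Conductor_Parallel:
  assumes "impedance M = Some (Fract r s)" "s \<noteq> 0" "s + smult G r \<noteq> 0"
  shows "impedance (Conductor G \<parallel> M) = Some (Fract r (s + smult G r))"
proof (cases "r = 0")
  case True
  have "recip_imp (add_imp z (recip_imp (Some 0))) = Some 0" for z by simp
  with True assms(1) show ?thesis by (simp add: fract_collapse del: recip_imp.simps)
next
  case False
  thus ?thesis using assms(2,3) unfolding impedance.simps assms(1)
    by (simp add: recip_imp_Fract add_imp_Fract add_ac add_imp_zero del: recip_imp.simps(2) add_imp.simps)
qed

lemma impedance_N6:
  assumes "R1 \<ge> 0" "R2 \<ge> 0" "G3 \<ge> 0" "C1 > 0" "L1 > 0"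
  defines "q \<equiv> [:1 + R2*G3, R2*C1 + L1*G3, L1*C1:]"
  shows "impedance (N6 R1 R2 G3 C1 L1) = Some (Fract (smult R1 q + [:0, L1*(1+R2*G3), L1*R2*C1:]) q)"
proof -
  have a: "impedance (Conductor G3 \<parallel> Capacitor C1) = Some (Fract 1 [:G3, C1:])"
    using impedance_Conductor_Parallel[OF impedance_Capacitor, of C1 G3] assms by (simp del: impedance.simps)
  have b: "impedance (Resistor R2 \<oplus> (Conductor G3 \<parallel> Capacitor C1))
      = Some (Fract [:1 + R2*G3, R2*C1:] [:G3, C1:])"
    using impedance_Series[OF impedance_Resistor a, of R2] assms by (simp add: algebra_simps one_pCons del: impedance.simps)
  have c: "impedance (Inductor L1 \<parallel> (Resistor R2 \<oplus> (Conductor G3 \<parallel> Capacitor C1)))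
      = Some (Fract [:0, L1*(1+R2*G3), L1*R2*C1:] q)"
    using impedance_Parallel[OF impedance_Inductor b, of L1] assms by (simp add: algebra_simps q_def del: impedance.simps)
  show ?thesis unfolding N6_def
    using impedance_Series[OF impedance_Resistor c, of R1] assms by (simp add: q_def algebra_simps del: impedance.simps)
qed

lemma impedance_N7:
  assumes "R1 \<ge> 0" "R2 \<ge> 0" "G3 \<ge> 0" "C1 > 0" "L1 > 0"
  defines "q \<equiv> [:1, R2*C1 + L1*G3, L1*C1*(1+R2*G3):]"
  shows "impedance (N7 R1 R2 G3 C1 L1) = Some (Fract (smult R1 q + [:R2, L1*(1+R2*G3):]) q)"
proof -
  have a: "impedance (Conductor G3 \<parallel> Inductor L1) = Some (Fract [:0, L1:] [:1, G3 * L1:])"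
    using impedance_Conductor_Parallel[OF impedance_Inductor, of G3 L1] assms by (simp add: one_pCons del: impedance.simps)
  have b: "impedance (Resistor R2 \<oplus> (Conductor G3 \<parallel> Inductor L1))
      = Some (Fract [:R2, L1*(1+R2*G3):] [:1, G3 * L1:])"
    using impedance_Series[OF impedance_Resistor a, of R2] assms by (simp add: algebra_simps del: impedance.simps)
  have c: "impedance (Capacitor C1 \<parallel> (Resistor R2 \<oplus> (Conductor G3 \<parallel> Inductor L1)))
      = Some (Fract [:R2, L1*(1+R2*G3):] q)"
    using impedance_Parallel[OF impedance_Capacitor b, of C1] assms by (simp add: algebra_simps q_def del: impedance.simps)
  show ?thesis unfolding N7_def
    using impedance_Series[OF impedance_Resistor c, of R1] assms by (simp add: q_def algebra_simps del: impedance.simps)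
qed

text \<open>The two networks are dual: series and parallel, resistances and conductances, inductors
  and capacitors trade places, hence the swapped last arguments.\<close>

lemma impedance_N8: "impedance (N8 G1 G2 R3 C1 L1) = recip_imp (impedance (N6 G1 G2 R3 L1 C1))"
  by (simp only: N8_def N6_def impedance.simps recip_recip_imp)

lemma impedance_N9: "impedance (N9 G1 G2 R3 C1 L1) = recip_imp (impedance (N7 G1 G2 R3 L1 C1))"
  by (simp only: N9_def N7_def impedance.simps recip_recip_imp)

section \<open>Realization of biquadratic impedances by two energy storage elements\<close>

lemma Fract_smult: "k \<noteq> 0 \<Longrightarrow> Fract (smult k p) (smult k q) = Fract p (q :: 'a::field poly)"
  using mult_fract_cancel[of "[:k:]" p q] by simp

lemma impedance_N5:
  assumes "R1 \<ge> 0" "R2 > 0" "G3 \<ge> 0" "L1 > 0" "L2 > 0"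
  defines "q \<equiv> [:R2, L2 + L1*(1+R2*G3), L1*L2*G3:]"
  shows "impedance (N5 R1 R2 G3 L1 L2) = Some (Fract (smult R1 q + [:0, L2*R2, L1*L2*(1+R2*G3):]) q)"
proof -
  have a: "impedance (Conductor G3 \<parallel> Inductor L1) = Some (Fract [:0, L1:] [:1, G3 * L1:])"
    using impedance_Conductor_Parallel[OF impedance_Inductor, of G3 L1] assms
    by (simp add: one_pCons del: impedance.simps)
  have b: "impedance (Resistor R2 \<oplus> (Conductor G3 \<parallel> Inductor L1))
      = Some (Fract [:R2, L1*(1+R2*G3):] [:1, G3 * L1:])"
    using impedance_Series[OF impedance_Resistor a, of R2] assms
    by (simp add: algebra_simps del: impedance.simps)
  have c: "impedance (Inductor L2 \<parallel> (Resistor R2 \<oplus> (Conductor G3 \<parallel> Inductor L1)))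
      = Some (Fract [:0, L2*R2, L1*L2*(1+R2*G3):] q)"
    using impedance_Parallel[OF impedance_Inductor b, of L2] assms
    by (simp add: algebra_simps q_def del: impedance.simps)
  show ?thesis unfolding N5_def
    using impedance_Series[OF impedance_Resistor c, of R1] assms
    by (simp add: q_def algebra_simps del: impedance.simps)
qed

text \<open>The sign conditions tolerate zero coefficients; \<open>F0 < 0\<close> removes those that
  would spoil an element value. If \<open>q0 = 0\<close>, then \<open>g1 = g2 = 0\<close>; if
  \<open>q2 = 0\<close>, then \<open>F0\<close> is \<open>p2\<close> times \<open>Lambda1\<close>;
  if \<open>g1 \<le> 0\<close>, the last condition on \<open>Lambda1\<close> forces
  \<open>g2 = 0\<close> and then \<open>g1 = 0\<close>. Each time \<open>F0\<close> is
  nonnegative.\<close>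

lemma Q1_coeff_pos:
  fixes p0 p1 p2 q0 q1 q2 :: real
  assumes nonneg: "p0 \<ge> 0" "p1 \<ge> 0" "p2 \<ge> 0" "q0 \<ge> 0" "q1 \<ge> 0" "q2 \<ge> 0"
  defines "g1 \<equiv> p1*q0 - p0*q1" and "g2 \<equiv> p2*q0 - p0*q2" and "g3 \<equiv> p2*q1 - p1*q2"
  assumes l: "q1*g1 - q0*g2 \<ge> 0" and g2: "g2 \<ge> 0" and F: "g1*g3 - g2^2 < 0"
  shows "q0 > 0" "q2 > 0" "g1 > 0"
proof -
  show q0: "q0 > 0"
  proof (rule ccontr)
    assume "\<not> q0 > 0"
    hence 0: "q0 = 0" using nonneg by simp
    have "p0 * q2 \<ge> 0" using nonneg by simp
    hence z: "g2 = 0" using g2 0 unfolding g2_def by simp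
    have "- (p0 * q1^2) \<ge> 0" using l 0 unfolding g1_def by (simp add: power2_eq_square algebra_simps)
    moreover have "p0 * q1^2 \<ge> 0" using nonneg by simp
    ultimately have "p0 * q1^2 = 0" by linarith
    hence "g1 = 0" using 0 unfolding g1_def by auto
    with z F show False by simp
  qed
  show "q2 > 0"
  proof (rule ccontr)
    assume "\<not> q2 > 0"
    hence 0: "q2 = 0" using nonneg by simp
    have "g1*g3 - g2^2 = p2 * (q1*g1 - q0*g2)" using 0 unfolding g1_def g2_def g3_def by algebra
    also have "\<dots> \<ge> 0" using l nonneg by simp
    finally show False using F by simp
  qed
  show "g1 > 0"
  proof (rule ccontr)
    assume c: "\<not> g1 > 0"
    hence "q1 * g1 \<le> 0" using nonneg by (simp add: mult_nonneg_nonpos)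
    moreover have "q0 * g2 \<ge> 0" using q0 g2 by simp
    ultimately have "q0 * g2 = 0" "q1 * g1 = 0" using l by linarith+
    hence z: "g2 = 0" "q1 = 0 \<or> g1 = 0" using q0 by auto
    moreover have "g1 = 0" if "q1 = 0" using that c nonneg unfolding g1_def
      by (metis diff_zero linorder_not_less mult_nonneg_nonneg mult_zero_right order_antisym)
    ultimately show False using F by auto
  qed
qed

lemma Q1_signs:
  assumes "Q1 p q" "F0 p q < 0"
  shows "coeff q 0 \<noteq> 0" "coeff q 2 \<noteq> 0" "Gamma1 p q > 0" "coeff q 0 * coeff q 2 > 0"
    "coeff p 0 / coeff q 0 \<ge> 0" "coeff q 2 * Lambda1 p q \<ge> 0" "Gamma2 p q \<ge> 0"
proof -
  show G2: "Gamma2 p q \<ge> 0" using assms(1) by (simp add: Q1_def)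
  have "(coeff q 0 > 0 \<and> coeff q 2 > 0 \<or> coeff q 0 < 0 \<and> coeff q 2 < 0) \<and> Gamma1 p q > 0"
    using assms(1) unfolding Q1_def same_sign7
  proof (elim conjE disjE, goal_cases)
    case 1
    show ?case using Q1_coeff_pos[of "coeff p 0" "coeff p 1" "coeff p 2" "coeff q 0" "coeff q 1" "coeff q 2"] 1 assms(2)
      unfolding Gamma_Lambda_defs F0_Gamma by simp
  next
    case 2
    show ?case using Q1_coeff_pos[of "- coeff p 0" "- coeff p 1" "- coeff p 2" "- coeff q 0" "- coeff q 1" "- coeff q 2"] 2 assms(2)
      unfolding Gamma_Lambda_defs F0_Gamma by simp
  qed
  thus "coeff q 0 \<noteq> 0" "coeff q 2 \<noteq> 0" "Gamma1 p q > 0" "coeff q 0 * coeff q 2 > 0"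
    by (auto simp: zero_less_mult_iff)
  show "coeff p 0 / coeff q 0 \<ge> 0" "coeff q 2 * Lambda1 p q \<ge> 0"
    using assms(1) unfolding Q1_def same_sign7 by (auto simp: zero_le_divide_iff zero_le_mult_iff)
qed

text \<open>Substituting \<open>1/s\<close> for \<open>s\<close> reverses the coefficients and turns
  (Q3) into (Q1).\<close>

lemma Q3_signs:
  assumes "Q3 p q" "F0 p q < 0"
  shows "coeff q 0 \<noteq> 0" "coeff q 2 \<noteq> 0" "Gamma3 p q < 0" "coeff q 0 * coeff q 2 > 0"
    "coeff p 2 / coeff q 2 \<ge> 0" "coeff q 0 * Lambda3 p q \<ge> 0" "Gamma2 p q \<le> 0"
proof -
  let ?r = "\<lambda>p. [:coeff p 2, coeff p 1, coeff p 0:] :: real poly"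
  have eq: "Gamma1 (?r p) (?r q) = - Gamma3 p q" "Gamma2 (?r p) (?r q) = - Gamma2 p q"
    "Gamma3 (?r p) (?r q) = - Gamma1 p q" "Lambda1 (?r p) (?r q) = Lambda3 p q"
    unfolding Gamma_Lambda_defs by (simp_all add: algebra_simps)
  have "Q1 (?r p) (?r q)" using assms(1) unfolding Q1_def Q3_def eq same_sign7 by auto
  moreover have "F0 (?r p) (?r q) < 0" using assms(2) unfolding F0_Gamma eq by (simp add: mult.commute)
  ultimately show "coeff q 0 \<noteq> 0" "coeff q 2 \<noteq> 0" "Gamma3 p q < 0" "coeff q 0 * coeff q 2 > 0"
    "coeff p 2 / coeff q 2 \<ge> 0" "coeff q 0 * Lambda3 p q \<ge> 0" "Gamma2 p q \<le> 0"
    using Q1_signs[of "?r p" "?r q"] unfolding eq by (simp_all add: mult.commute)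
qed

text \<open>The resistances are limits of the impedance: at \<open>s = 0\<close> the inductor is a
  short circuit, so \<open>R1 = p0/q0\<close>; at infinity it is open and the capacitor is a short
  circuit, so \<open>R1 + R2 = p2/q2\<close>. The other values come from matching the denominators
  up to a factor.\<close>

lemma N6_realization:
  assumes "degree p \<le> 2" "degree q \<le> 2" "Q1 p q" "F0 p q < 0"
  defines "R1 \<equiv> coeff p 0 / coeff q 0" and "R2 \<equiv> Gamma2 p q / (coeff q 0 * coeff q 2)"
    and "G3 \<equiv> - coeff q 2 * Lambda1 p q / F0 p q" and "C1 \<equiv> - ((coeff q 2)^2) * Gamma1 p q / F0 p q"
    and "L1 \<equiv> Gamma1 p q / (coeff q 0)^2"
  shows "R1 \<ge> 0" "R2 \<ge> 0" "G3 \<ge> 0" "C1 > 0" "L1 > 0"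
    and "impedance (N6 R1 R2 G3 C1 L1) = Some (Fract p q)"
proof -
  note S = Q1_signs[OF assms(3,4)]
  show pos: "R1 \<ge> 0" "R2 \<ge> 0" "G3 \<ge> 0" "C1 > 0" "L1 > 0"
    using S assms(4) unfolding R1_def R2_def G3_def C1_def L1_def
    by (auto simp: divide_pos_neg divide_nonpos_pos divide_nonneg_neg divide_nonneg_pos divide_nonpos_neg divide_neg_neg)
  obtain p0 p1 p2 where p: "p = [:p0, p1, p2:]" using quadratic_eqI[OF assms(1)] by blast
  obtain q0 q1 q2 where q: "q = [:q0, q1, q2:]" using quadratic_eqI[OF assms(2)] by blast
  define g1 g2 g3 F l where g: "g1 = p1*q0 - p0*q1" "g2 = p2*q0 - p0*q2" "g3 = p2*q1 - p1*q2"
    and F: "F = g1*g3 - g2^2" and l: "l = q1*g1 - q0*g2"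
  have G: "Gamma1 p q = g1" "Gamma2 p q = g2" "Lambda1 p q = l" "F0 p q = F"
    unfolding p q g F l F0_Gamma Gamma_Lambda_defs by simp_all
  have nz: "q0 \<noteq> 0" "q2 \<noteq> 0" "g1 \<noteq> 0" "F \<noteq> 0" using S assms(4) unfolding G by (auto simp: q)
  have R: "R1 = p0/q0" "R2 = g2/(q0*q2)" "G3 = -q2*l/F" "C1 = -(q2^2)*g1/F" "L1 = g1/q0^2"
    unfolding R1_def R2_def G3_def C1_def L1_def G by (simp_all add: p q)
  \<comment> \<open>The factor between the denominator of the network and \<open>q\<close>, read off
    from the leading coefficients, \<open>L1*C1 = k*q2\<close>.\<close>
  define k where "k = - q2 * g1^2 / (q0^2 * F)"
  have D0: "1 + R2*G3 = k * q0"
  proof -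
    have eq: "q0*F - g2*l = - q2 * g1^2" unfolding F l g by algebra
    have "1 + R2*G3 = (q0*F - g2*l) / (q0*F)" unfolding R using nz by (simp add: field_simps)
    thus ?thesis unfolding eq k_def using nz by (simp add: power2_eq_square)
  qed
  have D1: "R2*C1 + L1*G3 = k * q1"
    unfolding R k_def using nz by (simp add: field_simps power2_eq_square l)
  have D2: "L1*C1 = k * q2" unfolding R k_def using nz by (simp add: field_simps power2_eq_square)
  have E1: "L1 * (1 + R2*G3) = k * (p1 - R1 * q1)" unfolding D0 unfolding R g k_def
    using nz by (simp add: field_simps power2_eq_square)
  have "L1 * R2 * C1 = R2 * (L1 * C1)" by simp
  also have "\<dots> = k * (p2 - R1 * q2)" unfolding D2 unfolding R g
    using nz by (simp add: field_simps)
  finally have E2: "L1 * R2 * C1 = k * (p2 - R1 * q2)" .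
  have E0: "p0 = R1 * q0" using nz R by simp
  have "[:1 + R2*G3, R2*C1 + L1*G3, L1*C1:] = smult k q"
    unfolding D0 D1 D2 q by simp
  moreover have "smult R1 (smult k q) + [:0, L1*(1+R2*G3), L1*R2*C1:] = smult k p"
    unfolding E1 E2 p q E0 by (simp add: algebra_simps)
  moreover have "k \<noteq> 0" using nz by (simp add: k_def)
  ultimately show "impedance (N6 R1 R2 G3 C1 L1) = Some (Fract p q)"
    using impedance_N6[OF pos] by (simp only: Fract_smult not_False_eq_True)
qed

text \<open>Here the capacitor is the short circuit at infinity, so \<open>R1 = p2/q2\<close>, and
  \<open>R1 + R2 = p0/q0\<close> is the value at \<open>s = 0\<close>. The denominator of the
  network has constant term 1, which makes \<open>1/q0\<close> the factor of
  proportionality.\<close>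

lemma N7_realization:
  assumes "degree p \<le> 2" "degree q \<le> 2" "Q3 p q" "F0 p q < 0"
  defines "R1 \<equiv> coeff p 2 / coeff q 2" and "R2 \<equiv> - Gamma2 p q / (coeff q 0 * coeff q 2)"
    and "G3 \<equiv> - coeff q 0 * Lambda3 p q / F0 p q" and "C1 \<equiv> - ((coeff q 2)^2) / Gamma3 p q"
    and "L1 \<equiv> F0 p q / ((coeff q 0)^2 * Gamma3 p q)"
  shows "R1 \<ge> 0" "R2 \<ge> 0" "G3 \<ge> 0" "C1 > 0" "L1 > 0"
    and "impedance (N7 R1 R2 G3 C1 L1) = Some (Fract p q)"
proof -
  note S = Q3_signs[OF assms(3,4)]
  show pos: "R1 \<ge> 0" "R2 \<ge> 0" "G3 \<ge> 0" "C1 > 0" "L1 > 0"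
    using S assms(4) unfolding R1_def R2_def G3_def C1_def L1_def
    by (auto simp: divide_pos_neg divide_nonpos_pos divide_nonneg_neg divide_nonneg_pos divide_nonpos_neg divide_neg_neg mult_pos_neg)
  obtain p0 p1 p2 where p: "p = [:p0, p1, p2:]" using quadratic_eqI[OF assms(1)] by blast
  obtain q0 q1 q2 where q: "q = [:q0, q1, q2:]" using quadratic_eqI[OF assms(2)] by blast
  define g1 g2 g3 F l where g: "g1 = p1*q0 - p0*q1" "g2 = p2*q0 - p0*q2" "g3 = p2*q1 - p1*q2"
    and F: "F = g1*g3 - g2^2" and l: "l = q2*g2 - q1*g3"
  have G: "Gamma3 p q = g3" "Gamma2 p q = g2" "Lambda3 p q = l" "F0 p q = F"
    unfolding p q g F l F0_Gamma Gamma_Lambda_defs by simp_all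
  have nz: "q0 \<noteq> 0" "q2 \<noteq> 0" "g3 \<noteq> 0" "F \<noteq> 0" using S assms(4) unfolding G by (auto simp: q)
  have R: "R1 = p2/q2" "R2 = -g2/(q0*q2)" "G3 = -q0*l/F" "C1 = -(q2^2)/g3" "L1 = F/(q0^2*g3)"
    unfolding R1_def R2_def G3_def C1_def L1_def G by (simp_all add: p q)
  have D0: "1 + R2*G3 = - q0*g3^2/(q2*F)"
  proof -
    have "q2*F + g2*l = - q0 * g3^2" unfolding F l g by algebra
    thus ?thesis unfolding R using nz by (simp add: field_simps power2_eq_square)
  qed
  have D1: "R2*C1 + L1*G3 = 1/q0 * q1"
    unfolding R using nz by (simp add: field_simps power2_eq_square l)
  have D2: "L1*C1*(1 + R2*G3) = 1/q0 * q2" unfolding D0 unfolding R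
    using nz by (simp add: field_simps power2_eq_square)
  have E1: "L1 * (1 + R2*G3) = 1/q0 * (p1 - R1 * q1)" unfolding D0 unfolding R
    using nz by (simp add: field_simps power2_eq_square) (simp add: g algebra_simps)
  have E0: "R2 = 1/q0 * (p0 - R1 * q0)" using nz unfolding R g by (simp add: field_simps)
  have E2: "p2 = R1 * q2" using nz R by simp
  have "[:1, R2*C1 + L1*G3, L1*C1*(1+R2*G3):] = smult (1/q0) q"
    unfolding D1 D2 q using nz by simp
  moreover have "smult R1 (smult (1/q0) q) + [:R2, L1*(1+R2*G3):] = smult (1/q0) p"
    unfolding E1 unfolding p q E2 using E0 nz by (simp add: algebra_simps)
  moreover have "1/q0 \<noteq> 0" using nz by simp
  ultimately show "impedance (N7 R1 R2 G3 C1 L1) = Some (Fract p q)"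
    using impedance_N7[OF pos] by (simp only: Fract_smult not_False_eq_True)
qed

lemma Q4_signs:
  assumes "Q4 p q" "F0 p q < 0"
  shows "coeff p 0 \<noteq> 0" "coeff p 2 \<noteq> 0" "Gamma1 p q < 0"
  using Q1_signs[of q p] assms by (simp_all add: swap_Q[of q p] swap_Gamma_Lambda[of q p])

lemma Q2_signs:
  assumes "Q2 p q" "F0 p q < 0"
  shows "coeff p 0 \<noteq> 0" "coeff p 2 \<noteq> 0" "Gamma3 p q > 0"
  using Q3_signs[of q p] assms by (simp_all add: swap_Q[of q p] swap_Gamma_Lambda[of q p])

lemma N8_realization:
  assumes "degree p \<le> 2" "degree q \<le> 2" "Q4 p q" "F0 p q < 0"
  defines "G1 \<equiv> coeff q 0 / coeff p 0" and "G2 \<equiv> - Gamma2 p q / (coeff p 0 * coeff p 2)"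
    and "R3 \<equiv> - coeff p 2 * Lambda4 p q / F0 p q" and "C1 \<equiv> - Gamma1 p q / (coeff p 0)^2"
    and "L1 \<equiv> (coeff p 2)^2 * Gamma1 p q / F0 p q"
  shows "G1 \<ge> 0" "G2 \<ge> 0" "R3 \<ge> 0" "C1 > 0" "L1 > 0"
    and "impedance (N8 G1 G2 R3 C1 L1) = Some (Fract p q)"
proof -
  have Q: "Q1 q p" "F0 q p < 0" using assms by (simp_all add: swap_Q[of q p] swap_Gamma_Lambda[of q p])
  note N = N6_realization[OF assms(2,1) Q]
  show "G1 \<ge> 0" "G2 \<ge> 0" "R3 \<ge> 0" "C1 > 0" "L1 > 0"
    using N(1-5) unfolding G1_def G2_def R3_def C1_def L1_def swap_Gamma_Lambda[of q p] by simp_all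
  have "p \<noteq> 0" "q \<noteq> 0" using Q1_signs[OF Q] assms(4) unfolding F0_Gamma Gamma_Lambda_defs by auto
  thus "impedance (N8 G1 G2 R3 C1 L1) = Some (Fract p q)"
    using N(6) unfolding impedance_N8 G1_def G2_def R3_def C1_def L1_def swap_Gamma_Lambda[of q p]
    by (simp add: recip_imp_Fract del: recip_imp.simps)
qed

lemma N9_realization:
  assumes "degree p \<le> 2" "degree q \<le> 2" "Q2 p q" "F0 p q < 0"
  defines "G1 \<equiv> coeff q 2 / coeff p 2" and "G2 \<equiv> Gamma2 p q / (coeff p 0 * coeff p 2)"
    and "R3 \<equiv> - coeff p 0 * Lambda2 p q / F0 p q"
    and "C1 \<equiv> - F0 p q / ((coeff p 0)^2 * Gamma3 p q)" and "L1 \<equiv> (coeff p 2)^2 / Gamma3 p q"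
  shows "G1 \<ge> 0" "G2 \<ge> 0" "R3 \<ge> 0" "C1 > 0" "L1 > 0"
    and "impedance (N9 G1 G2 R3 C1 L1) = Some (Fract p q)"
proof -
  have Q: "Q3 q p" "F0 q p < 0" using assms by (simp_all add: swap_Q[of q p] swap_Gamma_Lambda[of q p])
  note N = N7_realization[OF assms(2,1) Q]
  show "G1 \<ge> 0" "G2 \<ge> 0" "R3 \<ge> 0" "C1 > 0" "L1 > 0"
    using N(1-5) unfolding G1_def G2_def R3_def C1_def L1_def swap_Gamma_Lambda[of q p] by simp_all
  have "p \<noteq> 0" "q \<noteq> 0" using Q3_signs[OF Q] assms(4) unfolding F0_Gamma Gamma_Lambda_defs by auto
  thus "impedance (N9 G1 G2 R3 C1 L1) = Some (Fract p q)"
    using N(6) unfolding impedance_N9 G1_def G2_def R3_def C1_def L1_def swap_Gamma_Lambda[of q p]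
    by (simp add: recip_imp_Fract del: recip_imp.simps)
qed

text \<open>A definite Bezoutian with nonnegative diagonal has \<open>g1, g3 > 0\<close>. Two
  identities between the minors then give \<open>g2 > 0\<close> and \<open>l > 0\<close>, so (Q1)
  holds by itself and all element values are defined.\<close>

lemma N5_realization:
  assumes "degree p \<le> 2" "degree q \<le> 2"
    and nonneg: "\<And>i. coeff p i \<ge> 0" "\<And>i. coeff q i \<ge> 0"
    and "Gamma1 p q \<ge> 0" "Gamma3 p q \<ge> 0" "F0 p q > 0"
  defines "R1 \<equiv> coeff p 0 / coeff q 0" and "R2 \<equiv> (Gamma1 p q)^2 / (coeff q 0 * Lambda1 p q)"
    and "G3 \<equiv> coeff q 2 * Lambda1 p q / F0 p q" and "L1 \<equiv> Gamma1 p q * F0 p q / (Lambda1 p q)^2"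
    and "L2 \<equiv> Gamma1 p q / (coeff q 0)^2"
  shows "Q1 p q" "R1 \<ge> 0" "R2 > 0" "G3 \<ge> 0" "L1 > 0" "L2 > 0"
    and "impedance (N5 R1 R2 G3 L1 L2) = Some (Fract p q)"
proof -
  obtain p0 p1 p2 where p: "p = [:p0, p1, p2:]" using quadratic_eqI[OF assms(1)] by blast
  obtain q0 q1 q2 where q: "q = [:q0, q1, q2:]" using quadratic_eqI[OF assms(2)] by blast
  define g1 g2 g3 F l where g: "g1 = p1*q0 - p0*q1" "g2 = p2*q0 - p0*q2" "g3 = p2*q1 - p1*q2"
    and F: "F = g1*g3 - g2^2" and l: "l = q1*g1 - q0*g2"
  have G: "Gamma1 p q = g1" "Gamma2 p q = g2" "Gamma3 p q = g3" "Lambda1 p q = l" "F0 p q = F"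
    unfolding p q g F l F0_Gamma Gamma_Lambda_defs by simp_all
  have nn: "p0 \<ge> 0" "p1 \<ge> 0" "p2 \<ge> 0" "q0 \<ge> 0" "q1 \<ge> 0" "q2 \<ge> 0"
    using nonneg(1)[of 0] nonneg(1)[of 1] nonneg(1)[of 2] nonneg(2)[of 0] nonneg(2)[of 1] nonneg(2)[of 2]
    unfolding p q by simp_all
  have "g1 * g3 > 0" using assms(7) unfolding G F by (smt (verit) zero_le_power2)
  hence g13: "g1 > 0" "g3 > 0" using assms(5,6) unfolding G by (auto simp: zero_less_mult_iff)
  have q0: "q0 > 0"
  proof (rule ccontr)
    assume "\<not> q0 > 0"
    hence "q0 = 0" using nn by simp
    hence "g1 \<le> 0" unfolding g using nn by simp
    with g13 show False by simp
  qed
  have "q1 * g2 = q2 * g1 + q0 * g3" unfolding g by algebra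
  also have "\<dots> > 0" using nn g13 q0 by (simp add: add_nonneg_pos)
  finally have g2: "g2 > 0" using nn by (auto simp: zero_less_mult_iff)
  have FF: "F > 0" using assms(7) unfolding G .
  have "l * g2 = q2 * g1^2 + q0 * F" unfolding l F g by algebra
  also have "\<dots> > 0" using nn q0 FF by (simp add: add_nonneg_pos)
  finally have lpos: "l > 0" using g2 by (auto simp: zero_less_mult_iff)
  show "Q1 p q" unfolding Q1_def same_sign7 G using nn lpos g2 by (simp add: p q)
  have R: "R1 = p0/q0" "R2 = g1^2/(q0*l)" "G3 = q2*l/F" "L1 = g1*F/l^2" "L2 = g1/q0^2"
    unfolding R1_def R2_def G3_def L1_def L2_def G by (simp_all add: p q)
  show pos: "R1 \<ge> 0" "R2 > 0" "G3 \<ge> 0" "L1 > 0" "L2 > 0"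
    unfolding R using nn q0 lpos g13 FF by simp_all
  \<comment> \<open>Again the ratio of the denominators, now from the constant coefficients,
    \<open>R2 = k*q0\<close>.\<close>
  define k where "k = g1^2 / (q0^2 * l)"
  have nz: "q0 \<noteq> 0" "g1 \<noteq> 0" "l \<noteq> 0" "F \<noteq> 0" using q0 g13 lpos FF by auto
  have D0: "R2 = k * q0" unfolding R k_def using nz by (simp add: field_simps power2_eq_square)
  have lF: "q0*F + q2*g1^2 = g2*l" unfolding l F g by algebra
  have S: "L1 * (1 + R2*G3) = g1 * g2 / (q0 * l)"
  proof -
    have "1 + R2*G3 = (q0*F + q2*g1^2) / (q0 * F)" unfolding R using nz by (simp add: field_simps)
    thus ?thesis unfolding lF unfolding R using nz by (simp add: field_simps power2_eq_square)
  qed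
  have D1: "L2 + L1*(1 + R2*G3) = k * q1" unfolding S unfolding R k_def using nz
    by (simp add: field_simps power2_eq_square) (simp add: l algebra_simps)
  have D2: "L1*L2*G3 = k * q2" unfolding R k_def using nz by (simp add: field_simps power2_eq_square)
  have E1: "L2*R2 = k * (p1 - R1 * q1)" unfolding R k_def using nz
    by (simp add: field_simps power2_eq_square) (simp add: g algebra_simps)
  have "L1*L2*(1+R2*G3) = L2 * (L1 * (1+R2*G3))" by simp
  also have "\<dots> = k * (p2 - R1 * q2)" unfolding S unfolding R k_def using nz
    by (simp add: field_simps power2_eq_square) (simp add: g algebra_simps)
  finally have E2: "L1*L2*(1+R2*G3) = k * (p2 - R1 * q2)" .
  have E0: "p0 = R1 * q0" using nz R by simp
  have "[:R2, L2 + L1*(1+R2*G3), L1*L2*G3:] = smult k q"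
    unfolding D1 D2 q using D0 by simp
  moreover have "smult R1 (smult k q) + [:0, L2*R2, L1*L2*(1+R2*G3):] = smult k p"
    unfolding E1 E2 unfolding p q E0 by (simp add: algebra_simps)
  moreover have "k \<noteq> 0" using nz by (simp add: k_def)
  ultimately show "impedance (N5 R1 R2 G3 L1 L2) = Some (Fract p q)"
    using impedance_N5[OF pos] by (simp only: Fract_smult not_False_eq_True)
qed

section \<open>Networks with at most two energy storage elements\<close>

definition nonneg_poly :: "real poly \<Rightarrow> bool" where
  "nonneg_poly p \<longleftrightarrow> (\<forall>i. coeff p i \<ge> 0)"

lemma nonneg_polyD: "nonneg_poly p \<Longrightarrow> coeff p i \<ge> 0"
  by (simp add: nonneg_poly_def)

lemma nonneg_poly_add: "nonneg_poly p \<Longrightarrow> nonneg_poly q \<Longrightarrow> nonneg_poly (p + q)"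
  by (simp add: nonneg_poly_def)

lemma nonneg_poly_mult: "nonneg_poly p \<Longrightarrow> nonneg_poly q \<Longrightarrow> nonneg_poly (p * q)"
  by (simp add: nonneg_poly_def coeff_mult sum_nonneg)

lemma nonneg_poly_smult: "0 \<le> k \<Longrightarrow> nonneg_poly p \<Longrightarrow> nonneg_poly (smult k p)"
  by (simp add: nonneg_poly_def)

lemma nonneg_poly_pCons [simp]: "nonneg_poly (pCons c p) \<longleftrightarrow> c \<ge> 0 \<and> nonneg_poly p"
  by (auto simp: nonneg_poly_def coeff_pCons split: nat.splits)

lemma nonneg_poly_0 [simp]: "nonneg_poly 0"
  by (simp add: nonneg_poly_def)

text \<open>The nonpositive alternative in \<open>same_sign\<close> forces all coefficients to
  vanish, and with them the \<open>Lambda\<close>, so it contributes no further case.\<close>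

lemma Q_nonneg_iff:
  assumes "nonneg_poly p" "nonneg_poly q"
  shows "Q1 p q \<longleftrightarrow> Lambda1 p q \<ge> 0 \<and> Gamma2 p q \<ge> 0"
    "Q2 p q \<longleftrightarrow> Lambda2 p q \<ge> 0 \<and> Gamma2 p q \<ge> 0"
    "Q3 p q \<longleftrightarrow> Lambda3 p q \<ge> 0 \<and> Gamma2 p q \<le> 0"
    "Q4 p q \<longleftrightarrow> Lambda4 p q \<ge> 0 \<and> Gamma2 p q \<le> 0"
proof -
  have nn: "coeff p i \<ge> 0" "coeff q i \<ge> 0" for i using assms by (simp_all add: nonneg_polyD)
  have z: "coeff p i \<le> 0 \<longleftrightarrow> coeff p i = 0" "coeff q i \<le> 0 \<longleftrightarrow> coeff q i = 0" for i
    using nn[of i] by auto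
  show "Q1 p q \<longleftrightarrow> Lambda1 p q \<ge> 0 \<and> Gamma2 p q \<ge> 0"
    "Q2 p q \<longleftrightarrow> Lambda2 p q \<ge> 0 \<and> Gamma2 p q \<ge> 0"
    "Q3 p q \<longleftrightarrow> Lambda3 p q \<ge> 0 \<and> Gamma2 p q \<le> 0"
    "Q4 p q \<longleftrightarrow> Lambda4 p q \<ge> 0 \<and> Gamma2 p q \<le> 0"
    unfolding Q1_def Q2_def Q3_def Q4_def same_sign7 z
    by (auto simp: nn Gamma_Lambda_defs)
qed

definition resistive :: "impedance set" where
  "resistive = insert None {Some (Fract [:r:] 1) | r. r \<ge> 0}"

text \<open>The sign is \<open>1\<close> for an inductor and \<open>-1\<close> for a capacitor. The
  fraction may be reducible, so resistive impedances belong to both classes; \<open>None\<close> is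
  the open circuit.\<close>

definition first_order :: "real \<Rightarrow> impedance set" where
  "first_order \<sigma> = insert None {Some (Fract [:p0, p1:] [:q0, q1:]) | p0 p1 q0 q1.
     p0 \<ge> 0 \<and> p1 \<ge> 0 \<and> q0 \<ge> 0 \<and> q1 \<ge> 0 \<and> [:q0, q1:] \<noteq> 0 \<and> \<sigma> * (p1 * q0 - p0 * q1) \<ge> 0}"

text \<open>Semidefiniteness of the Bezoutian, expressed by its diagonal entries and its determinant
  \<open>F0\<close>.\<close>

definition definite_biquad :: "real \<Rightarrow> impedance set" where
  "definite_biquad \<sigma> = insert None {Some (Fract p q) | p q.
     degree p \<le> 2 \<and> degree q \<le> 2 \<and> nonneg_poly p \<and> nonneg_poly q \<and> q \<noteq> 0 \<and>
     \<sigma> * Gamma1 p q \<ge> 0 \<and> \<sigma> * Gamma3 p q \<ge> 0 \<and> F0 p q \<ge> 0}"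

text \<open>The alternative \<open>F0 p q = 0\<close> covers pairs with a common factor or with both
  leading coefficients zero; no sign condition is claimed for them.\<close>

definition indefinite_biquad :: "impedance set" where
  "indefinite_biquad = insert None {Some (Fract p q) | p q.
     degree p \<le> 2 \<and> degree q \<le> 2 \<and> nonneg_poly p \<and> nonneg_poly q \<and> q \<noteq> 0 \<and>
     (F0 p q = 0 \<or> F0 p q < 0 \<and> (Q1 p q \<or> Q2 p q \<or> Q3 p q \<or> Q4 p q))}"

lemma resistive_recip:
  assumes "z \<in> resistive" shows "recip_imp z \<in> resistive"
  using assms unfolding resistive_def
proof (elim insertE CollectE exE conjE)
  fix r assume z: "z = Some (Fract [:r:] 1)" and "(r::real) \<ge> 0"
  show "recip_imp z \<in> insert None {Some (Fract [:r:] 1) | r. r \<ge> 0}"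
  proof (cases "r = 0")
    case False
    hence "recip_imp z = Some (Fract [:1/r:] 1)"
      unfolding z by (simp add: recip_imp_Fract eq_fract(1) one_pCons del: recip_imp.simps)
    with \<open>r \<ge> 0\<close> show ?thesis by auto
  qed (simp add: z fract_collapse)
qed (auto simp: fract_collapse intro!: exI[of _ 0])

lemma first_orderI:
  assumes "p0 \<ge> 0" "p1 \<ge> 0" "q0 \<ge> 0" "q1 \<ge> 0" "[:q0, q1:] \<noteq> 0" "\<sigma> * (p1 * q0 - p0 * q1) \<ge> 0"
  shows "Some (Fract [:p0, p1:] [:q0, q1:]) \<in> first_order \<sigma>"
  using assms unfolding first_order_def by blast

lemma first_orderE:
  assumes "z \<in> first_order \<sigma>" "z \<noteq> None"
  obtains p0 p1 q0 q1 where "z = Some (Fract [:p0, p1:] [:q0, q1:])" "[:q0, q1:] \<noteq> 0"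
    "p0 \<ge> 0" "p1 \<ge> 0" "q0 \<ge> 0" "q1 \<ge> 0" "\<sigma> * (p1 * q0 - p0 * q1) \<ge> 0"
  using assms unfolding first_order_def by blast

lemma zero_eq_Fract: "Some 0 = Some (Fract (0::real poly) 1)"
  by (simp add: fract_collapse)

lemma first_order_recip:
  assumes "z \<in> first_order \<sigma>" shows "recip_imp z \<in> first_order (- \<sigma>)"
proof (cases z)
  case None
  thus ?thesis using first_orderI[of 0 0 1 0 "- \<sigma>"] by (simp add: fract_collapse)
next
  case (Some w)
  then obtain p0 p1 q0 q1 where z: "z = Some (Fract [:p0, p1:] [:q0, q1:])" "[:q0, q1:] \<noteq> 0"
    "p0 \<ge> 0" "p1 \<ge> 0" "q0 \<ge> 0" "q1 \<ge> 0" "\<sigma> * (p1 * q0 - p0 * q1) \<ge> 0"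
    using first_orderE[OF assms] by blast
  show ?thesis
  proof (cases "[:p0, p1:] = 0")
    case True
    hence "recip_imp z = None" unfolding z(1) by (simp add: fract_collapse)
    thus ?thesis by (simp add: first_order_def)
  next
    case False
    have "- \<sigma> * (q1 * p0 - q0 * p1) = \<sigma> * (p1 * q0 - p0 * q1)" by algebra
    hence "Some (Fract [:q0, q1:] [:p0, p1:]) \<in> first_order (- \<sigma>)"
      using False z(3-7) by (intro first_orderI) simp_all
    thus ?thesis using False unfolding z(1) recip_imp_Fract[OF z(2)] by (simp only: if_False)
  qed
qed

lemma definite_biquadI:
  assumes "degree p \<le> 2" "degree q \<le> 2" "nonneg_poly p" "nonneg_poly q" "q \<noteq> 0"
    "\<sigma> * Gamma1 p q \<ge> 0" "\<sigma> * Gamma3 p q \<ge> 0" "F0 p q \<ge> 0"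
  shows "Some (Fract p q) \<in> definite_biquad \<sigma>"
  using assms unfolding definite_biquad_def by blast

lemma indefinite_biquadI:
  assumes "degree p \<le> 2" "degree q \<le> 2" "nonneg_poly p" "nonneg_poly q" "q \<noteq> 0"
    "F0 p q = 0 \<or> F0 p q < 0 \<and> (Q1 p q \<or> Q2 p q \<or> Q3 p q \<or> Q4 p q)"
  shows "Some (Fract p q) \<in> indefinite_biquad"
  using assms unfolding indefinite_biquad_def by blast

lemma definite_biquad_recip:
  assumes "z \<in> definite_biquad \<sigma>" shows "recip_imp z \<in> definite_biquad (- \<sigma>)"
proof (cases z)
  case None
  have "Some (Fract 0 1) \<in> definite_biquad (- \<sigma>)"
    by (intro definite_biquadI) (auto simp: F0_Gamma Gamma_Lambda_defs one_pCons)
  thus ?thesis using None zero_eq_Fract by simp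
next
  case (Some w)
  with assms obtain p q where pq: "z = Some (Fract p q)" "degree p \<le> 2" "degree q \<le> 2"
    "nonneg_poly p" "nonneg_poly q" "q \<noteq> 0" "\<sigma> * Gamma1 p q \<ge> 0" "\<sigma> * Gamma3 p q \<ge> 0" "F0 p q \<ge> 0"
    unfolding definite_biquad_def by blast
  show ?thesis
  proof (cases "p = 0")
    case True thus ?thesis using pq by (simp add: fract_collapse definite_biquad_def)
  next
    case False
    thus ?thesis using pq unfolding pq(1) recip_imp_Fract[OF pq(6)]
      by (auto intro!: definite_biquadI simp: swap_Gamma_Lambda[of q p])
  qed
qed

lemma indefinite_biquad_recip:
  assumes "z \<in> indefinite_biquad" shows "recip_imp z \<in> indefinite_biquad"
proof (cases z)
  case None
  have "Some (Fract 0 1) \<in> indefinite_biquad"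
    by (intro indefinite_biquadI) (auto simp: F0_Gamma Gamma_Lambda_defs one_pCons)
  thus ?thesis using None zero_eq_Fract by simp
next
  case (Some w)
  with assms obtain p q where pq: "z = Some (Fract p q)" "degree p \<le> 2" "degree q \<le> 2"
    "nonneg_poly p" "nonneg_poly q" "q \<noteq> 0"
    "F0 p q = 0 \<or> F0 p q < 0 \<and> (Q1 p q \<or> Q2 p q \<or> Q3 p q \<or> Q4 p q)"
    unfolding indefinite_biquad_def by blast
  show ?thesis
  proof (cases "p = 0")
    case True thus ?thesis using pq by (simp add: fract_collapse indefinite_biquad_def)
  next
    case False
    have "F0 q p = 0 \<or> F0 q p < 0 \<and> (Q1 q p \<or> Q2 q p \<or> Q3 q p \<or> Q4 q p)"
      using pq(7) unfolding swap_Q[of q p] swap_Gamma_Lambda[of q p] by blast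
    thus ?thesis using False pq unfolding pq(1) recip_imp_Fract[OF pq(6)]
      by (auto intro!: indefinite_biquadI)
  qed
qed

lemma add_resistance_Fract:
  "q \<noteq> 0 \<Longrightarrow> add_imp (Some (Fract p q)) (Some (Fract [:r:] 1)) = Some (Fract (p + smult r q) q)"
  by simp

lemma add_resistance_Gamma_Lambda:
  "Gamma1 (p + smult r q) q = Gamma1 p q" "Gamma2 (p + smult r q) q = Gamma2 p q"
  "Gamma3 (p + smult r q) q = Gamma3 p q"
  "Lambda1 (p + smult r q) q = Lambda1 p q" "Lambda3 (p + smult r q) q = Lambda3 p q"
  "Lambda2 (p + smult r q) q = Lambda2 p q - r * Lambda3 p q"
  "Lambda4 (p + smult r q) q = Lambda4 p q - r * Lambda1 p q"
  "F0 (p + smult r q) q = F0 p q"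
  unfolding F0_Gamma Gamma_Lambda_defs coeff_add coeff_smult by algebra+

lemma degree_add_smult: "degree p \<le> n \<Longrightarrow> degree q \<le> n \<Longrightarrow> degree (p + smult r q) \<le> n"
  by (meson degree_add_le degree_smult_le order_trans)

text \<open>A series resistor leaves \<open>Lambda1\<close> and \<open>Lambda3\<close> alone and
  adds \<open>- r * Lambda3\<close> to \<open>Lambda2\<close> and \<open>- r * Lambda1\<close> to
  \<open>Lambda4\<close>. These increments are nonnegative under (Q2) and (Q4): for instance
  \<open>p2*Lambda3 + q2*Lambda2 = - Gamma3^2\<close>, with \<open>p2 > 0\<close> and
  \<open>q2*Lambda2 \<ge> 0\<close>, bounds \<open>Lambda3\<close> from above.\<close>

lemma Q_add_resistance:
  assumes "nonneg_poly p" "nonneg_poly q" "r \<ge> 0" "F0 p q < 0"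
    and "Q1 p q \<or> Q2 p q \<or> Q3 p q \<or> Q4 p q"
  shows "Q1 (p + smult r q) q \<or> Q2 (p + smult r q) q \<or> Q3 (p + smult r q) q \<or> Q4 (p + smult r q) q"
proof -
  have nn: "nonneg_poly (p + smult r q)"
    using assms by (simp add: nonneg_poly_add nonneg_poly_smult)
  note iff = Q_nonneg_iff[OF assms(1,2)] Q_nonneg_iff[OF nn assms(2)]
  have "r * Lambda3 p q \<le> 0" if "Q2 p q"
  proof -
    have "coeff p 2 > 0" using Q2_signs[OF that assms(4)] nonneg_polyD[OF assms(1), of 2] by simp
    moreover have "coeff p 2 * Lambda3 p q + coeff q 2 * Lambda2 p q = - ((Gamma3 p q)^2)"
      unfolding Gamma_Lambda_defs by algebra
    moreover have "coeff q 2 * Lambda2 p q \<ge> 0"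
      using that iff nonneg_polyD[OF assms(2)] by simp
    ultimately have "coeff p 2 * Lambda3 p q \<le> 0" by (smt (verit) zero_le_power2)
    hence "Lambda3 p q \<le> 0" using \<open>coeff p 2 > 0\<close> by (simp add: mult_le_0_iff)
    thus ?thesis using assms(3) by (simp add: mult_nonneg_nonpos)
  qed
  moreover have "r * Lambda1 p q \<le> 0" if "Q4 p q"
  proof -
    have "coeff p 0 > 0" using Q4_signs[OF that assms(4)] nonneg_polyD[OF assms(1), of 0] by simp
    moreover have "coeff p 0 * Lambda1 p q + coeff q 0 * Lambda4 p q = - ((Gamma1 p q)^2)"
      unfolding Gamma_Lambda_defs by algebra
    moreover have "coeff q 0 * Lambda4 p q \<ge> 0"
      using that iff nonneg_polyD[OF assms(2)] by simp
    ultimately have "coeff p 0 * Lambda1 p q \<le> 0" by (smt (verit) zero_le_power2)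
    hence "Lambda1 p q \<le> 0" using \<open>coeff p 0 > 0\<close> by (simp add: mult_le_0_iff)
    thus ?thesis using assms(3) by (simp add: mult_nonneg_nonpos)
  qed
  ultimately show ?thesis
    using assms(5) unfolding iff add_resistance_Gamma_Lambda by auto
qed

lemma add_imp_resistive:
  assumes "y \<in> resistive"
  shows "z \<in> resistive \<Longrightarrow> add_imp z y \<in> resistive"
    and "z \<in> first_order \<sigma> \<Longrightarrow> add_imp z y \<in> first_order \<sigma>"
    and "z \<in> definite_biquad \<sigma> \<Longrightarrow> add_imp z y \<in> definite_biquad \<sigma>"
    and "z \<in> indefinite_biquad \<Longrightarrow> add_imp z y \<in> indefinite_biquad"
proof -
  consider "y = None" | r where "y = Some (Fract [:r:] 1)" "r \<ge> 0"
    using assms unfolding resistive_def by blast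
  note y = this
  show "add_imp z y \<in> resistive" if "z \<in> resistive"
    using y
  proof cases
    case (2 r)
    show ?thesis using that unfolding resistive_def
    proof (elim insertE CollectE exE conjE)
      fix t assume "z = Some (Fract [:t:] 1)" "(t::real) \<ge> 0"
      hence "add_imp z y = Some (Fract [:t + r:] 1)" "t + r \<ge> 0" using 2 by (simp_all add: one_pCons)
      thus "add_imp z y \<in> insert None {Some (Fract [:r:] 1) | r. r \<ge> 0}" by blast
    qed simp
  qed (simp add: resistive_def)
  show "add_imp z y \<in> first_order \<sigma>" if "z \<in> first_order \<sigma>"
    using y
  proof cases
    case (2 r)
    show ?thesis
    proof (cases "z = None")
      case False
      with that obtain p0 p1 q0 q1 where z: "z = Some (Fract [:p0, p1:] [:q0, q1:])" "[:q0, q1:] \<noteq> 0"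
        "p0 \<ge> 0" "p1 \<ge> 0" "q0 \<ge> 0" "q1 \<ge> 0" "\<sigma> * (p1 * q0 - p0 * q1) \<ge> 0"
        by (rule first_orderE)
      have "add_imp z y = Some (Fract [:p0 + r * q0, p1 + r * q1:] [:q0, q1:])"
        unfolding z 2 add_resistance_Fract[OF z(2)] by simp
      moreover have "\<sigma> * ((p1 + r * q1) * q0 - (p0 + r * q0) * q1) = \<sigma> * (p1 * q0 - p0 * q1)"
        by algebra
      moreover have "p0 + r * q0 \<ge> 0" "p1 + r * q1 \<ge> 0" using z 2 by simp_all
      ultimately show ?thesis using first_orderI[of "p0 + r * q0" "p1 + r * q1" q0 q1 \<sigma>] z by metis
    qed (simp add: first_order_def)
  qed (simp add: first_order_def)
  show "add_imp z y \<in> definite_biquad \<sigma>" if "z \<in> definite_biquad \<sigma>"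
    using y
  proof cases
    case (2 r)
    show ?thesis using that unfolding definite_biquad_def[of \<sigma>]
    proof (elim insertE CollectE exE conjE)
      fix p q assume z: "z = Some (Fract p q)" "degree p \<le> 2" "degree q \<le> 2"
        "nonneg_poly p" "nonneg_poly q" "q \<noteq> 0" "\<sigma> * Gamma1 p q \<ge> 0" "\<sigma> * Gamma3 p q \<ge> 0" "F0 p q \<ge> 0"
      show "add_imp z y \<in> insert None {Some (Fract p q) | p q.
     degree p \<le> 2 \<and> degree q \<le> 2 \<and> nonneg_poly p \<and> nonneg_poly q \<and> q \<noteq> 0 \<and>
     \<sigma> * Gamma1 p q \<ge> 0 \<and> \<sigma> * Gamma3 p q \<ge> 0 \<and> F0 p q \<ge> 0}"
        unfolding z(1) 2 add_resistance_Fract[OF z(6)] definite_biquad_def[symmetric]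
        by (rule definite_biquadI)
           (use z 2 in \<open>simp_all add: add_resistance_Gamma_Lambda degree_add_smult
              nonneg_poly_add nonneg_poly_smult\<close>)
    qed simp
  qed (simp add: definite_biquad_def)
  show "add_imp z y \<in> indefinite_biquad" if "z \<in> indefinite_biquad"
    using y
  proof cases
    case (2 r)
    show ?thesis using that unfolding indefinite_biquad_def
    proof (elim insertE CollectE exE conjE)
      fix p q assume z: "z = Some (Fract p q)" "degree p \<le> 2" "degree q \<le> 2"
        "nonneg_poly p" "nonneg_poly q" "q \<noteq> 0"
        "F0 p q = 0 \<or> F0 p q < 0 \<and> (Q1 p q \<or> Q2 p q \<or> Q3 p q \<or> Q4 p q)"
      show "add_imp z y \<in> insert None {Some (Fract p q) | p q.
     degree p \<le> 2 \<and> degree q \<le> 2 \<and> nonneg_poly p \<and> nonneg_poly q \<and> q \<noteq> 0 \<and>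
     (F0 p q = 0 \<or> F0 p q < 0 \<and> (Q1 p q \<or> Q2 p q \<or> Q3 p q \<or> Q4 p q))}"
        unfolding z(1) 2 add_resistance_Fract[OF z(6)] indefinite_biquad_def[symmetric]
        by (rule indefinite_biquadI)
           (use z 2 Q_add_resistance[OF z(4,5) 2(2)] in \<open>auto simp: add_resistance_Gamma_Lambda degree_add_smult
              nonneg_poly_add nonneg_poly_smult\<close>)
    qed simp
  qed (simp add: indefinite_biquad_def)
qed

text \<open>The Bezoutian of the sum is \<open>m\<close> times the square of the vector
  \<open>(s0, s1)\<close> plus \<open>n\<close> times the square of \<open>(q0, q1)\<close>; so its
  determinant is \<open>m*n\<close> times the squared determinant of these two vectors.\<close>

lemma add_first_order_Gamma:
  fixes p0 p1 q0 q1 r0 r1 s0 s1 :: real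
  defines "p \<equiv> [:p0, p1:] * [:s0, s1:] + [:r0, r1:] * [:q0, q1:]" and "q \<equiv> [:q0, q1:] * [:s0, s1:]"
    and "m \<equiv> p1 * q0 - p0 * q1" and "n \<equiv> r1 * s0 - r0 * s1"
  shows "Gamma1 p q = m * s0^2 + n * q0^2" "Gamma2 p q = m * s0 * s1 + n * q0 * q1"
    "Gamma3 p q = m * s1^2 + n * q1^2" "F0 p q = m * n * (q0 * s1 - q1 * s0)^2"
    "degree p \<le> 2" "degree q \<le> 2"
    "p = [:p0 * s0 + r0*q0, p0 * s1 + p1 * s0 + r0*q1 + r1*q0, p1 * s1 + r1*q1:]"
    "q = [:q0 * s0, q0 * s1 + q1 * s0, q1 * s1:]"
proof -
  show p: "p = [:p0 * s0 + r0*q0, p0 * s1 + p1 * s0 + r0*q1 + r1*q0, p1 * s1 + r1*q1:]"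
    and q: "q = [:q0 * s0, q0 * s1 + q1 * s0, q1 * s1:]"
    unfolding p_def q_def by (simp_all add: algebra_simps)
  show "Gamma1 p q = m * s0^2 + n * q0^2" "Gamma2 p q = m * s0 * s1 + n * q0 * q1"
    "Gamma3 p q = m * s1^2 + n * q1^2" "F0 p q = m * n * (q0 * s1 - q1 * s0)^2"
    unfolding p q F0_Gamma Gamma_Lambda_defs m_def n_def by (simp_all; algebra)+
  show "degree p \<le> 2" "degree q \<le> 2" unfolding p q by (rule degree_quadratic)+
qed

lemma add_imp_first_order_same:
  assumes "z \<in> first_order \<sigma>" "y \<in> first_order \<sigma>" "\<sigma>^2 = 1"
  shows "add_imp z y \<in> definite_biquad \<sigma>"
proof (cases "z = None \<or> y = None")
  case True
  thus ?thesis by (auto simp: definite_biquad_def)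
next
  case False
  then obtain p0 p1 q0 q1 r0 r1 s0 s1 where z: "z = Some (Fract [:p0, p1:] [:q0, q1:])" "[:q0, q1:] \<noteq> 0"
      "p0 \<ge> 0" "p1 \<ge> 0" "q0 \<ge> 0" "q1 \<ge> 0" "\<sigma> * (p1 * q0 - p0 * q1) \<ge> 0"
    and y: "y = Some (Fract [:r0, r1:] [:s0, s1:])" "[:s0, s1:] \<noteq> 0"
      "r0 \<ge> 0" "r1 \<ge> 0" "s0 \<ge> 0" "s1 \<ge> 0" "\<sigma> * (r1 * s0 - r0 * s1) \<ge> 0"
    using assms(1,2) unfolding first_order_def by blast
  note G = add_first_order_Gamma
  have F: "(p1 * q0 - p0 * q1) * (r1 * s0 - r0 * s1) \<ge> 0"
  proof -
    have "(p1 * q0 - p0 * q1) * (r1 * s0 - r0 * s1)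
        = \<sigma>^2 * ((p1 * q0 - p0 * q1) * (r1 * s0 - r0 * s1))" using assms(3) by simp
    also have "\<dots> = (\<sigma> * (p1 * q0 - p0 * q1)) * (\<sigma> * (r1 * s0 - r0 * s1))" by algebra
    also have "\<dots> \<ge> 0" by (intro mult_nonneg_nonneg z(7) y(7))
    finally show ?thesis .
  qed
  have S: "\<sigma> * ((p1 * q0 - p0 * q1) * x^2 + (r1 * s0 - r0 * s1) * w^2) \<ge> 0" for x w
  proof -
    have "\<sigma> * ((p1 * q0 - p0 * q1) * x^2 + (r1 * s0 - r0 * s1) * w^2)
      = (\<sigma> * (p1 * q0 - p0 * q1)) * x^2 + (\<sigma> * (r1 * s0 - r0 * s1)) * w^2" by algebra
    thus ?thesis using z(7) y(7) by simp
  qed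
  show ?thesis unfolding z(1) y(1) add_imp_Fract[OF z(2) y(2)]
  proof (rule definite_biquadI)
    show "[:q0, q1:] * [:s0, s1:] \<noteq> 0" using z(2) y(2) by (metis no_zero_divisors)
    show "nonneg_poly ([:p0, p1:] * [:s0, s1:] + [:r0, r1:] * [:q0, q1:])" "nonneg_poly ([:q0, q1:] * [:s0, s1:])"
      using z y by (intro nonneg_poly_add nonneg_poly_mult; simp)+
  qed (use G F S in \<open>simp_all only: zero_le_mult_iff zero_le_power2 simp_thms\<close>)
qed

text \<open>The two alternatives are \<open>Lambda2 \<ge> 0\<close> and
  \<open>Lambda1 \<ge> 0\<close> for the sum of an RC and an RL impedance. If
  \<open>Lambda1 < 0\<close>, then together with \<open>Gamma2 \<ge> 0\<close> the pole of the RC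
  part is no farther from the origin than that of the RL part (\<open>star\<close>), and this makes
  \<open>Lambda2\<close> a sum of two nonnegative terms.\<close>

lemma RC_plus_RL_ineq:
  fixes a0 a1 b0 b1 r0 r1 s0 s1 :: real
  assumes nonneg: "a0 \<ge> 0" "a1 \<ge> 0" "b0 \<ge> 0" "b1 \<ge> 0" "r0 \<ge> 0" "r1 \<ge> 0" "s0 \<ge> 0" "s1 \<ge> 0"
  defines "m \<equiv> a0 * b1 - a1 * b0" and "n \<equiv> r1 * s0 - r0 * s1"
  defines "p1 \<equiv> a0 * s1 + a1 * s0 + r0*b1 + r1*b0" and "p2 \<equiv> a1 * s1 + r1*b1"
    and "g1 \<equiv> n * b0^2 - m * s0^2" and "g2 \<equiv> n * b0 * b1 - m * s0 * s1" and "g3 \<equiv> n * b1^2 - m * s1^2"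
  assumes m: "m \<ge> 0" and n: "n \<ge> 0" and g2: "g2 \<ge> 0"
  shows "p1 * g3 - p2 * g2 \<ge> 0 \<or> (b0 * s1 + b1 * s0) * g1 - b0 * s0 * g2 \<ge> 0"
proof (rule disjCI)
  assume l: "\<not> (b0 * s1 + b1 * s0) * g1 - b0 * s0*g2 \<ge> 0"
  have "(b0 * s1 + b1 * s0) * g1 - b0 * s0*g2 = n * b0^3 * s1 - m * b1 * s0^3"
    unfolding g1_def g2_def by algebra
  hence l1: "n * b0^3 * s1 < m * b1 * s0^3" using l by linarith
  have "n * b0^3 * s1 \<ge> 0" using nonneg n by simp
  hence pos: "m * b1 * s0^3 > 0" using l1 by linarith
  have b1: "b1 > 0" and s0: "s0 > 0" using pos nonneg by (auto simp: zero_less_mult_iff zero_less_power_eq order_le_less)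
  \<comment> \<open>The summands are \<open>u + A / (b0 + b1*s)\<close> and
    \<open>w + B*s / (s0 + s1*s)\<close>; the resistances \<open>u\<close> and \<open>w\<close>
    enter only through their sum \<open>t\<close>.\<close>
  define A B u w t where "A = m / b1" and "B = n / s0" and "u = a1 / b1" and "w = r0 / s0" and "t = u + w"
  have AB: "m = A * b1" "n = B * s0" "A \<ge> 0" "B \<ge> 0" "t \<ge> 0"
    using b1 s0 m n nonneg by (simp_all add: A_def B_def t_def u_def w_def)
  have g2': "A * s1 \<le> B * b0"
  proof -
    have "g2 = (b1 * s0) * (B * b0 - A * s1)" unfolding g2_def AB by algebra
    moreover have "b1 * s0 > 0" using b1 s0 by simp
    ultimately show ?thesis using g2 by (simp add: zero_le_mult_iff)
  qed
  \<comment> \<open>Otherwise \<open>l1\<close>, multiplied by \<open>s1\<close> and combined with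
    \<open>g2'\<close>, compares \<open>(b0*s1)^2\<close> with the smaller \<open>(b1*s0)^2\<close>
    under the common factor \<open>B*b0\<close>. That factor must vanish, whence
    \<open>A = 0\<close> by \<open>g2'\<close>, against \<open>pos\<close>.\<close>
  have star: "b0 * s1 \<le> b1 * s0"
  proof (rule ccontr)
    assume "\<not> b0 * s1 \<le> b1 * s0"
    hence c: "b1 * s0 < b0 * s1" by simp
    have "s0 * (B * b0^3 * s1) < s0 * (A * b1^2 * s0^2)" using l1 unfolding AB by (simp add: power2_eq_square power3_eq_cube algebra_simps)
    hence "B * b0^3 * s1 < A * b1^2 * s0^2" using s0 by simp
    hence "B * b0^3 * s1 * s1 \<le> A * b1^2 * s0^2 * s1" using nonneg by (simp add: mult_right_mono)
    also have "\<dots> = (A * s1) * (b1 * s0)^2" by algebra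
    also have "\<dots> \<le> (B * b0) * (b1 * s0)^2" using g2' by (simp add: mult_right_mono)
    finally have 1: "(B * b0) * (b0 * s1)^2 \<le> (B * b0) * (b1 * s0)^2" by (simp add: power2_eq_square power3_eq_cube algebra_simps)
    have "(b1 * s0)^2 < (b0 * s1)^2" using c b1 s0 by (simp add: power_strict_mono)
    with 1 have "B * b0 \<le> 0" by (metis linorder_not_less mult_less_cancel_left_pos)
    moreover have "s1 > 0" using c b1 s0 nonneg
      by (metis linorder_not_less mult_nonneg_nonneg mult_zero_right nle_le order_less_le)
    ultimately have "A = 0" using g2' AB by (metis linorder_not_less mult_pos_pos order_antisym_conv order_trans)
    with pos AB show False by simp
  qed
  have l3: "A * b0 * s1^3 - B * s0^2 * b1^2 \<le> 0"
  proof -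
    have "A * b0 * s1^3 = (A * s1) * (b0 * s1^2)" by algebra
    also have "\<dots> \<le> (B * b0) * (b0 * s1^2)" using g2' nonneg by (simp add: mult_right_mono)
    also have "\<dots> = B * (b0 * s1)^2" by algebra
    also have "\<dots> \<le> B * (b1 * s0)^2" using star nonneg AB by (simp add: mult_left_mono power_mono)
    finally show ?thesis by (simp add: power_mult_distrib algebra_simps)
  qed
  have "B * (b0 * s1) \<le> B * (s0 * b1)" "(A * s1) * s1 \<le> (B * b0) * s1"
    using star g2' AB nonneg by (simp_all add: mult_left_mono mult_right_mono mult.commute)
  hence l2: "B * (2 * s0 * b1 - b0 * s1) - A * s1^2 \<ge> 0" by (simp add: power2_eq_square algebra_simps)
  have a0: "a0 = A + u * b0" and r1: "r1 = B + w * s1"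
    using b1 s0 unfolding A_def B_def m_def n_def u_def w_def by (simp_all add: field_simps)
  have a1: "a1 = u * b1" and r0: "r0 = w * s0" using b1 s0 by (simp_all add: u_def w_def)
  have p: "p1 = A * s1 + B * b0 + t * (b0 * s1 + b1 * s0)" "p2 = B * b1 + t * (b1 * s1)"
    unfolding p1_def p2_def a0 r1 a1 r0 t_def by algebra+
  have "p1 * g3 - p2 * g2 = A * b1 * s1 * (B * (2 * s0 * b1 - b0 * s1) - A * s1^2)
      + t * b1 * (- (A * b0 * s1^3 - B * s0^2 * b1^2))"
    unfolding p g2_def g3_def AB(1,2) by algebra
  also have "\<dots> \<ge> 0" using l2 l3 AB b1 nonneg by (intro add_nonneg_nonneg mult_nonneg_nonneg) simp_all
  finally show "p1 * g3 - p2 * g2 \<ge> 0" .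
qed

lemma add_imp_first_order_opposite:
  assumes "z \<in> first_order (-1)" "y \<in> first_order 1"
  shows "add_imp z y \<in> indefinite_biquad"
proof (cases "z = None \<or> y = None")
  case True
  thus ?thesis by (auto simp: indefinite_biquad_def)
next
  case False
  then obtain p0 p1 q0 q1 r0 r1 s0 s1 where z: "z = Some (Fract [:p0, p1:] [:q0, q1:])" "[:q0, q1:] \<noteq> 0"
      "p0 \<ge> 0" "p1 \<ge> 0" "q0 \<ge> 0" "q1 \<ge> 0" "- 1 * (p1 * q0 - p0 * q1) \<ge> 0"
    and y: "y = Some (Fract [:r0, r1:] [:s0, s1:])" "[:s0, s1:] \<noteq> 0"
      "r0 \<ge> 0" "r1 \<ge> 0" "s0 \<ge> 0" "s1 \<ge> 0" "1 * (r1 * s0 - r0 * s1) \<ge> 0"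
    using assms(1,2) unfolding first_order_def by blast
  let ?p = "[:p0, p1:] * [:s0, s1:] + [:r0, r1:] * [:q0, q1:]" and ?q = "[:q0, q1:] * [:s0, s1:]"
  note G = add_first_order_Gamma
  have nn: "nonneg_poly ?p" "nonneg_poly ?q"
    using z y by (intro nonneg_poly_add nonneg_poly_mult; simp)+
  have mn: "p0 * q1 - p1 * q0 \<ge> 0" "r1 * s0 - r0 * s1 \<ge> 0" using z y by simp_all
  have "F0 ?p ?q = - ((p0 * q1 - p1 * q0) * (r1 * s0 - r0 * s1) * (q0 * s1 - q1 * s0)^2)"
    unfolding G(4) by algebra
  moreover have "(p0 * q1 - p1 * q0) * (r1 * s0 - r0 * s1) * (q0 * s1 - q1 * s0)^2 \<ge> 0"
    using mn by simp
  ultimately have F: "F0 ?p ?q \<le> 0" by linarith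
  have coeffs: "coeff ?p 0 = p0 * s0 + r0*q0" "coeff ?p 1 = p0 * s1 + p1 * s0 + r0*q1 + r1*q0"
    "coeff ?p 2 = p1 * s1 + r1*q1" "coeff ?q 0 = q0 * s0" "coeff ?q 1 = q0 * s1 + q1 * s0" "coeff ?q 2 = q1 * s1"
    unfolding G(7,8) by simp_all
  have "Q1 ?p ?q \<or> Q2 ?p ?q \<or> Q3 ?p ?q \<or> Q4 ?p ?q"
  proof (cases "Gamma2 ?p ?q \<ge> 0")
    case True
    have "Lambda2 ?p ?q \<ge> 0 \<or> Lambda1 ?p ?q \<ge> 0"
      using RC_plus_RL_ineq[of p0 p1 q0 q1 r0 r1 s0 s1] z y True
      unfolding Lambda1_def Lambda2_def G(1-3) coeffs by (simp add: algebra_simps)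
    thus ?thesis using True unfolding Q_nonneg_iff[OF nn] by blast
  next
    case False
    \<comment> \<open>The substitution of 1/s for s exchanges the two summands.\<close>
    have "Lambda4 ?p ?q \<ge> 0 \<or> Lambda3 ?p ?q \<ge> 0"
      using RC_plus_RL_ineq[of r1 r0 s1 s0 p1 p0 q1 q0] z y False
      unfolding Lambda3_def Lambda4_def G(1-3) coeffs by (simp add: algebra_simps)
    thus ?thesis using False unfolding Q_nonneg_iff[OF nn] by auto
  qed
  moreover have "?q \<noteq> 0" using z(2) y(2) by (metis no_zero_divisors)
  ultimately show ?thesis using F nn G(5,6) unfolding z(1) y(1) add_imp_Fract[OF z(2) y(2)]
    by (intro indefinite_biquadI) auto
qed

text \<open>The arguments count capacitors and inductors, in this order. \<open>UNIV\<close> beyond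
  two elements lets the induction run over all networks without a bound on their parts.\<close>

fun impedance_class :: "nat \<Rightarrow> nat \<Rightarrow> impedance set" where
  "impedance_class 0 0 = resistive"
| "impedance_class 0 (Suc 0) = first_order 1"
| "impedance_class (Suc 0) 0 = first_order (-1)"
| "impedance_class (Suc 0) (Suc 0) = indefinite_biquad"
| "impedance_class 0 (Suc (Suc 0)) = definite_biquad 1"
| "impedance_class (Suc (Suc 0)) 0 = definite_biquad (-1)"
| "impedance_class _ _ = UNIV"

lemma impedance_class_UNIV: "m + n > 2 \<Longrightarrow> impedance_class m n = UNIV"
  by (cases "(m, n)" rule: impedance_class.cases) auto

text \<open>Reciprocals belong to dual networks, hence the exchange of \<open>m\<close> and
  \<open>n\<close>. With this, sums are the only connections that have to be examined.\<close>

lemma impedance_class_recip: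
  "z \<in> impedance_class m n \<Longrightarrow> recip_imp z \<in> impedance_class n m"
  using resistive_recip[of z] first_order_recip[of z 1] first_order_recip[of z "-1"]
    definite_biquad_recip[of z 1] definite_biquad_recip[of z "-1"] indefinite_biquad_recip[of z]
  by (cases "(m, n)" rule: impedance_class.cases) simp_all

lemma impedance_class_add_resistive:
  assumes "y \<in> resistive" "z \<in> impedance_class m n"
  shows "add_imp z y \<in> impedance_class m n"
  using assms(2) add_imp_resistive[OF assms(1), of z]
  by (cases "(m, n)" rule: impedance_class.cases) simp_all

lemma impedance_class_add:
  assumes "z \<in> impedance_class m n" "y \<in> impedance_class k l"
  shows "add_imp z y \<in> impedance_class (m + k) (n + l)"
proof -
  consider "m + k + (n + l) > 2" | "m = 0 \<and> n = 0" | "k = 0 \<and> l = 0" | "m + n = 1" "k + l = 1"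
    by linarith
  thus ?thesis
  proof cases
    case 1
    thus ?thesis by (simp add: impedance_class_UNIV)
  next
    case 2
    with assms show ?thesis using impedance_class_add_resistive[of z y k l]
      by (simp add: add_imp_commute)
  next
    case 3
    with assms show ?thesis using impedance_class_add_resistive[of y z m n] by simp
  next
    case 4
    hence "m = 1 \<and> n = 0 \<or> m = 0 \<and> n = 1" "k = 1 \<and> l = 0 \<or> k = 0 \<and> l = 1" by linarith+
    moreover have "add_imp z y \<in> indefinite_biquad" if "z \<in> first_order 1" "y \<in> first_order (-1)"
      using add_imp_first_order_opposite[OF that(2,1)] by (simp add: add_imp_commute)
    ultimately show ?thesis
      using assms add_imp_first_order_same[of z 1 y] add_imp_first_order_same[of z "-1" y]
        add_imp_first_order_opposite[of z y]
      by (elim disjE conjE) (simp_all add: numeral_2_eq_2)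
  qed
qed

lemma impedance_in_class:
  "admissible N \<Longrightarrow> impedance N \<in> impedance_class (num_capacitors N) (num_inductors N)"
proof (induction N)
  case (Resistor R)
  thus ?case by (auto simp: resistive_def)
next
  case (Conductor G)
  have "Some (Fract [:G:] 1) \<in> resistive" using Conductor by (auto simp: resistive_def)
  from resistive_recip[OF this] show ?case by (simp del: recip_imp.simps)
next
  case (Inductor L)
  thus ?case using first_orderI[of 0 L 1 0 1] by (simp add: one_pCons)
next
  case (Capacitor C)
  have "Some (Fract [:0, C:] 1) \<in> first_order 1"
    using Capacitor first_orderI[of 0 C 1 0 1] by (simp add: one_pCons)
  from first_order_recip[OF this] show ?case by (simp del: recip_imp.simps)
next
  case (Series N M)
  thus ?case using impedance_class_add by simp
next
  case (Parallel N M)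
  hence "recip_imp (impedance N) \<in> impedance_class (num_inductors N) (num_capacitors N)"
    "recip_imp (impedance M) \<in> impedance_class (num_inductors M) (num_capacitors M)"
    by (simp_all add: impedance_class_recip)
  thus ?case by (simp add: impedance_class_recip impedance_class_add)
qed

lemma admissible_N5:
  "R1 \<ge> 0 \<Longrightarrow> R2 \<ge> 0 \<Longrightarrow> G3 \<ge> 0 \<Longrightarrow> L1 > 0 \<Longrightarrow> L2 > 0 \<Longrightarrow> admissible (N5 R1 R2 G3 L1 L2)"
  by (simp add: N5_def)

text \<open>Reducedness makes \<open>p\<close> and \<open>q\<close> the multiples of
  \<open>a\<close> and \<open>b\<close> by one polynomial \<open>h\<close>. As \<open>a\<close> or
  \<open>b\<close> already has degree two, the degree bounds leave only a constant
  \<open>h\<close>.\<close>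

lemma Fract_coprime_eqE:
  fixes a b p q :: "real poly"
  assumes "coprime a b" "coeff a 2 \<noteq> 0 \<or> coeff b 2 \<noteq> 0" "b \<noteq> 0"
    and "degree p \<le> 2" "degree q \<le> 2" "q \<noteq> 0" "Fract a b = Fract p q"
  obtains k where "k \<noteq> 0" "p = smult k a" "q = smult k b"
proof -
  have eq: "a * q = p * b" using eq_fract(1)[OF assms(3,6), of a p] assms(7) by (rule iffD1)
  hence "b dvd a * q" by simp
  moreover have "coprime b a" using assms(1) by (simp add: coprime_commute)
  ultimately have "b dvd q" by (simp only: coprime_dvd_mult_right_iff)
  then obtain h where h: "q = b * h" ..
  hence p: "p = a * h" using eq assms(3) by simp
  have "h \<noteq> 0" using h assms(6) by auto
  have "degree h = 0"
  proof -
    have "degree a \<ge> 2 \<or> degree b \<ge> 2" using assms(2) le_degree by blast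
    moreover have "a \<noteq> 0 \<Longrightarrow> degree a + degree h \<le> 2"
      using assms(4) \<open>h \<noteq> 0\<close> unfolding p by (simp add: degree_mult_eq)
    moreover have "degree b + degree h \<le> 2"
      using assms(3,5) \<open>h \<noteq> 0\<close> unfolding h by (simp add: degree_mult_eq)
    ultimately show ?thesis by (cases "a = 0") auto
  qed
  then obtain k where "h = [:k:]" by (rule degree_eq_zeroE)
  with h p \<open>h \<noteq> 0\<close> that[of k] show ?thesis by simp
qed

section \<open>Biquadratic impedances in lowest terms\<close>

locale biquadratic =
  fixes a b :: "real poly"
  assumes degree: "degree a \<le> 2" "degree b \<le> 2"
    and coprime: "coprime a b"
    and top: "coeff a 2 \<noteq> 0 \<or> coeff b 2 \<noteq> 0"
    and pos: "\<exists>i\<in>{0,1,2}. coeff b i > 0"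
begin

lemma b_nonzero: "b \<noteq> 0"
  using pos by auto

lemma F0_ne: "F0 a b \<noteq> 0"
  using F0_nonzero degree coprime top by blast

text \<open>The sign of \<open>k\<close> is settled by comparing a positive coefficient of
  \<open>b\<close> with the nonnegative ones of \<open>q\<close>.\<close>

lemma scaled:
  assumes "degree p \<le> 2" "degree q \<le> 2" "q \<noteq> 0" "nonneg_poly q" "Fract a b = Fract p q"
  obtains k where "k > 0" "p = smult k a" "q = smult k b"
proof -
  obtain k where k: "k \<noteq> 0" "p = smult k a" "q = smult k b"
    using Fract_coprime_eqE[OF coprime top b_nonzero assms(1-3,5)] .
  obtain i where i: "coeff b i > 0" using pos by blast
  have "k * coeff b i \<ge> 0" using assms(4) k(3) nonneg_polyD by fastforce
  hence "k > 0" using i k(1) by (simp add: zero_le_mult_iff)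
  with k that show ?thesis by blast
qed

lemma not_first_order: "Some (Fract a b) \<notin> first_order \<sigma>"
proof
  assume "Some (Fract a b) \<in> first_order \<sigma>"
  then obtain p0 p1 q0 q1 where z: "Some (Fract a b) = Some (Fract [:p0, p1:] [:q0, q1:])" "[:q0, q1:] \<noteq> 0"
    by (elim first_orderE) auto
  have deg: "degree [:r, t:] \<le> 2" for r t :: real by simp
  obtain k where "k \<noteq> 0" "[:p0, p1:] = smult k a" "[:q0, q1:] = smult k b"
    using Fract_coprime_eqE[OF coprime top b_nonzero deg deg z(2)] z(1) by blast
  hence "coeff (smult k a) 2 = 0" "coeff (smult k b) 2 = 0"
    by (metis coeff_quadratic(2))+
  with top \<open>k \<noteq> 0\<close> show False by simp
qed

lemma resistive_subset: "resistive \<subseteq> first_order \<sigma>"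
proof
  fix z assume "z \<in> resistive"
  thus "z \<in> first_order \<sigma>"
    unfolding resistive_def using first_orderI[of _ 0 1 0 \<sigma>]
    by (auto simp: one_pCons) (simp add: first_order_def)
qed

lemma not_resistive: "Some (Fract a b) \<notin> resistive"
  using resistive_subset not_first_order by blast

text \<open>With fewer than two storage elements the impedance would be resistive or of first order,
  which a reduced fraction of degree two is not.\<close>

lemma two_element_class:
  assumes "Some (Fract a b) \<in> SP_impedances 1 1 \<or> Some (Fract a b) \<in> SP_impedances 0 2"
  shows "Some (Fract a b) \<in> indefinite_biquad \<or> Some (Fract a b) \<in> definite_biquad 1"
proof -
  obtain N where N: "admissible N" "Some (Fract a b) = impedance N"
    "num_capacitors N \<le> 1 \<and> num_inductors N \<le> 1 \<or> num_capacitors N = 0 \<and> num_inductors N \<le> 2"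
    using assms unfolding SP_impedances_def by auto
  have "Some (Fract a b) \<in> impedance_class (num_capacitors N) (num_inductors N)"
    using impedance_in_class[OF N(1)] N(2) by simp
  moreover have "(num_capacitors N, num_inductors N) \<in> {(0,0), (1,0), (0,1), (1,1), (0,2)}"
    using N(3) by (auto simp: le_Suc_eq numeral_2_eq_2)
  ultimately show ?thesis using not_resistive not_first_order
    by (auto simp: numeral_2_eq_2)
qed

lemma indefinite_biquad_Q:
  assumes "Some (Fract a b) \<in> indefinite_biquad"
  shows "F0 a b < 0" "Q1 a b \<or> Q2 a b \<or> Q3 a b \<or> Q4 a b"
proof -
  obtain p q where pq: "Fract a b = Fract p q" "degree p \<le> 2" "degree q \<le> 2"
    "nonneg_poly q" "q \<noteq> 0"
    "F0 p q = 0 \<or> F0 p q < 0 \<and> (Q1 p q \<or> Q2 p q \<or> Q3 p q \<or> Q4 p q)"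
    using assms unfolding indefinite_biquad_def by blast
  obtain k where k: "k > 0" "p = smult k a" "q = smult k b"
    using scaled pq by metis
  have "k^4 > 0" using k by simp
  thus "F0 a b < 0" "Q1 a b \<or> Q2 a b \<or> Q3 a b \<or> Q4 a b"
    using pq(6) F0_ne unfolding k(2,3) smult_Gamma_Lambda smult_Q[OF k(1)]
    by (auto simp: mult_less_0_iff)
qed

lemma definite_biquad_signs:
  assumes "Some (Fract a b) \<in> definite_biquad 1"
  shows "F0 a b > 0" "Gamma1 a b \<ge> 0" "Gamma3 a b \<ge> 0" "nonneg_poly a" "nonneg_poly b"
proof -
  obtain p q where pq: "Fract a b = Fract p q" "degree p \<le> 2" "degree q \<le> 2"
    "nonneg_poly p" "nonneg_poly q" "q \<noteq> 0" "Gamma1 p q \<ge> 0" "Gamma3 p q \<ge> 0" "F0 p q \<ge> 0"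
    using assms unfolding definite_biquad_def by auto
  obtain k where k: "k > 0" "p = smult k a" "q = smult k b"
    using scaled pq by metis
  have "k^4 > 0" "k^2 > 0" using k by simp_all
  thus "F0 a b > 0" "Gamma1 a b \<ge> 0" "Gamma3 a b \<ge> 0"
    using pq(7-9) F0_ne unfolding k(2,3) smult_Gamma_Lambda by (auto simp: zero_le_mult_iff)
  show "nonneg_poly a" "nonneg_poly b"
    using pq(4,5) k(1) unfolding k(2,3) nonneg_poly_def by (simp_all add: zero_le_mult_iff)
qed

lemma two_element_realization:
  assumes "Some (Fract a b) \<in> SP_impedances 1 1 \<or> Some (Fract a b) \<in> SP_impedances 0 2"
  shows "(Q1 a b \<and> F0 a b < 0 \<and>
          (let R1 = coeff a 0 / coeff b 0;
               R2 = Gamma2 a b / (coeff b 0 * coeff b 2);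
               G3 = - coeff b 2 * Lambda1 a b / F0 a b;
               C1 = - ((coeff b 2)^2) * Gamma1 a b / F0 a b;
               L1 = Gamma1 a b / (coeff b 0)^2;
               N = N6 R1 R2 G3 C1 L1
           in admissible N \<and> impedance N = Some (Fract a b))) \<or>
        (Q3 a b \<and> F0 a b < 0 \<and>
          (let R1 = coeff a 2 / coeff b 2;
               R2 = - Gamma2 a b / (coeff b 0 * coeff b 2);
               G3 = - coeff b 0 * Lambda3 a b / F0 a b;
               C1 = - ((coeff b 2)^2) / Gamma3 a b;
               L1 = F0 a b / ((coeff b 0)^2 * Gamma3 a b);
               N = N7 R1 R2 G3 C1 L1
           in admissible N \<and> impedance N = Some (Fract a b))) \<or>
        (Q4 a b \<and> F0 a b < 0 \<and>
          (let G1 = coeff b 0 / coeff a 0;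
               G2 = - Gamma2 a b / (coeff a 0 * coeff a 2);
               R3 = - coeff a 2 * Lambda4 a b / F0 a b;
               C1 = - Gamma1 a b / (coeff a 0)^2;
               L1 = (coeff a 2)^2 * Gamma1 a b / F0 a b;
               N = N8 G1 G2 R3 C1 L1
           in admissible N \<and> impedance N = Some (Fract a b))) \<or>
        (Q2 a b \<and> F0 a b < 0 \<and>
          (let G1 = coeff b 2 / coeff a 2;
               G2 = Gamma2 a b / (coeff a 0 * coeff a 2);
               R3 = - coeff a 0 * Lambda2 a b / F0 a b;
               C1 = - F0 a b / ((coeff a 0)^2 * Gamma3 a b);
               L1 = (coeff a 2)^2 / Gamma3 a b;
               N = N9 G1 G2 R3 C1 L1
           in admissible N \<and> impedance N = Some (Fract a b))) \<or>
        (Q1 a b \<and> F0 a b > 0 \<and>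
          (let R1 = coeff a 0 / coeff b 0;
               R2 = (Gamma1 a b)^2 / (coeff b 0 * Lambda1 a b);
               G3 = coeff b 2 * Lambda1 a b / F0 a b;
               L1 = Gamma1 a b * F0 a b / (Lambda1 a b)^2;
               L2 = Gamma1 a b / (coeff b 0)^2;
               N = N5 R1 R2 G3 L1 L2
           in admissible N \<and> impedance N = Some (Fract a b)))"
  (is "?N6 \<or> ?N7 \<or> ?N8 \<or> ?N9 \<or> ?N5")
  using two_element_class[OF assms]
proof
  assume "Some (Fract a b) \<in> indefinite_biquad"
  note I = indefinite_biquad_Q[OF this]
  from I(2) show ?thesis
  proof (elim disjE)
    assume Q: "Q1 a b"
    have ?N6 unfolding Let_def using Q I(1) N6_realization[OF degree Q I(1)]
      by (simp only: N6_def admissible.simps simp_thms)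
    thus ?thesis by blast
  next
    assume Q: "Q2 a b"
    have ?N9 unfolding Let_def using Q I(1) N9_realization[OF degree Q I(1)]
      by (simp only: N9_def admissible.simps simp_thms)
    thus ?thesis by blast
  next
    assume Q: "Q3 a b"
    have ?N7 unfolding Let_def using Q I(1) N7_realization[OF degree Q I(1)]
      by (simp only: N7_def admissible.simps simp_thms)
    thus ?thesis by blast
  next
    assume Q: "Q4 a b"
    have ?N8 unfolding Let_def using Q I(1) N8_realization[OF degree Q I(1)]
      by (simp only: N8_def admissible.simps simp_thms)
    thus ?thesis by blast
  qed
next
  assume "Some (Fract a b) \<in> definite_biquad 1"
  note D = definite_biquad_signs[OF this]
  note R = N5_realization[OF degree nonneg_polyD[OF D(4)] nonneg_polyD[OF D(5)] D(2,3,1)]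
  have ?N5 unfolding Let_def
    by (intro conjI admissible_N5 D(1) R(1,2,4-7) less_imp_le[OF R(3)])
  thus ?thesis by blast
qed

end

text \<open>The smaller of the values at \<open>s = 0\<close> and at infinity is removed as a series
  resistor. What remains is a conductor in parallel with an inductor if \<open>g > 0\<close>, with a
  capacitor if \<open>g < 0\<close>.\<close>

lemma first_order_realizable:
  fixes p0 p1 q0 q1 :: real
  assumes "p0 \<ge> 0" "p1 \<ge> 0" "q0 \<ge> 0" "q1 \<ge> 0" "[:q0, q1:] \<noteq> 0"
  obtains M where "admissible M" "num_capacitors M + num_inductors M \<le> 1"
    "impedance M = Some (Fract [:p0, p1:] [:q0, q1:])"
proof -
  define g where "g = p1 * q0 - p0 * q1"
  consider "g = 0" | "g > 0" | "g < 0" by linarith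
  thus ?thesis
  proof cases
    case 1
    define r where "r = (if q0 = 0 then p1 / q1 else p0 / q0)"
    have "p0 = r * q0 \<and> p1 = r * q1"
    proof (cases "q0 = 0")
      case True
      hence "q1 \<noteq> 0" using assms(5) by auto
      with True 1 show ?thesis by (simp add: r_def g_def)
    next
      case False
      hence "p1 = p0 * q1 / q0" using 1 by (simp add: g_def field_simps)
      with False show ?thesis by (simp add: r_def)
    qed
    hence r: "[:p0, p1:] = smult r [:q0, q1:]" "r \<ge> 0"
      using assms by (simp_all add: r_def)
    hence "impedance (Resistor r) = Some (Fract [:p0, p1:] [:q0, q1:])"
      using assms(5) by (simp add: eq_fract(1))
    with r(2) that[of "Resistor r"] show ?thesis by simp
  next
    case 2
    have q0: "q0 > 0"
    proof (rule ccontr)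
      assume "\<not> q0 > 0"
      with assms have "q0 = 0" by simp
      with 2 assms show False by (simp add: g_def mult_less_0_iff)
    qed
    let ?M = "Conductor (q0 * q1 / g) \<parallel> Inductor (g / q0^2)"
    have num: "[:0, g / q0^2:] = smult (1/q0) [:0, g / q0:]"
      by (simp add: power2_eq_square)
    have den: "1 + smult (q0 * q1 / g) [:0, g / q0^2:] = smult (1/q0) [:q0, q1:]"
      using 2 q0 by (simp add: one_pCons power2_eq_square)
    have "impedance ?M = Some (Fract [:0, g / q0^2:] (1 + smult (q0 * q1 / g) [:0, g / q0^2:]))"
      by (rule impedance_Conductor_Parallel[OF impedance_Inductor]) (simp_all add: one_pCons)
    also have "\<dots> = Some (Fract [:0, g / q0:] [:q0, q1:])"
      unfolding den unfolding num using q0 by (subst Fract_smult) simp_all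
    finally have "impedance ?M = Some (Fract [:0, g / q0:] [:q0, q1:])" .
    note M = impedance_Series[OF impedance_Resistor this, of "p0 / q0"]
    have "impedance (Resistor (p0 / q0) \<oplus> ?M) = Some (Fract [:p0, p1:] [:q0, q1:])"
      using M assms(5) q0 by (simp add: g_def field_simps del: impedance.simps)
    with that[of "Resistor (p0 / q0) \<oplus> ?M"] assms q0 2 show ?thesis by simp
  next
    case 3
    have q1: "q1 > 0"
    proof (rule ccontr)
      assume "\<not> q1 > 0"
      with assms have "q1 = 0" by simp
      with 3 assms show False by (simp add: g_def mult_less_0_iff)
    qed
    let ?M = "Conductor (q0 * q1 / - g) \<parallel> Capacitor (q1^2 / - g)"
    have num: "1 = smult (q1 / - g) [:- g / q1:]"
      using 3 q1 by (simp add: one_pCons)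
    have den: "[:0, q1^2 / - g:] + smult (q0 * q1 / - g) 1 = smult (q1 / - g) [:q0, q1:]"
      by (simp add: one_pCons power2_eq_square)
    have "impedance ?M = Some (Fract 1 ([:0, q1^2 / - g:] + smult (q0 * q1 / - g) 1))"
      by (rule impedance_Conductor_Parallel[OF impedance_Capacitor]) (use 3 q1 in \<open>simp_all add: one_pCons\<close>)
    also have "\<dots> = Some (Fract [:- g / q1:] [:q0, q1:])"
      unfolding den by (subst num, subst Fract_smult) (use 3 q1 in simp_all)
    finally have "impedance ?M = Some (Fract [:- g / q1:] [:q0, q1:])" .
    note M = impedance_Series[OF impedance_Resistor this, of "p1 / q1"]
    have "impedance (Resistor (p1 / q1) \<oplus> ?M) = Some (Fract [:p0, p1:] [:q0, q1:])"
      using M assms(5) q1 by (simp add: g_def field_simps del: impedance.simps)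
    with that[of "Resistor (p1 / q1) \<oplus> ?M"] assms q1 3 show ?thesis by (simp add: divide_nonneg_neg divide_pos_neg divide_nonneg_pos)
  qed
qed

lemma linear_eqI:
  fixes p :: "'a::zero poly"
  assumes "degree p \<le> 1"
  shows "p = [:coeff p 0, coeff p 1:]"
proof -
  have "p = [:coeff p 0, coeff p 1, coeff p 2:]" using assms by (intro quadratic_eqI) simp
  also have "coeff p 2 = 0" using assms by (intro coeff_eq_0) simp
  finally show ?thesis by simp
qed

text \<open>The extracted branch has admittance \<open>y / (s + x)\<close>, and the numerator of
  \<open>M\<close> is divisible by \<open>s + x\<close> too. The admittances therefore add up to
  \<open>b / ((s + x) * g)\<close> without a rise in degree.\<close>

lemma impedance_lossy_inductor_Parallel:
  assumes "a = smult R b + [:x, 1:] * g" "b = d + smult y g" "y \<noteq> 0" "b \<noteq> 0" "d \<noteq> 0"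
    and M: "impedance M = Some (Fract ([:x, 1:] * g) d)"
  shows "impedance (Resistor R \<oplus> ((Resistor (x / y) \<oplus> Inductor (1 / y)) \<parallel> M)) = Some (Fract a b)"
proof -
  have l: "impedance (Resistor (x / y) \<oplus> Inductor (1 / y)) = Some (Fract (smult (1/y) [:x, 1:]) 1)"
    by (simp add: one_pCons)
  have "smult (1/y) [:x, 1:] * d + 1 * ([:x, 1:] * g) = smult (1/y) [:x, 1:] * b"
    unfolding assms(2) using assms(3) by (simp add: algebra_simps smult_add_right)
  hence "impedance ((Resistor (x / y) \<oplus> Inductor (1 / y)) \<parallel> M)
      = Some (Fract (smult (1/y) [:x, 1:] * ([:x, 1:] * g)) (smult (1/y) [:x, 1:] * b))"
    using impedance_Parallel[OF l M] assms(3-5) by (metis mult_eq_0_iff one_neq_zero pCons_eq_0_iff smult_eq_0_iff zero_neq_one divide_eq_0_iff)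
  also have "\<dots> = Some (Fract ([:x, 1:] * g) b)"
    by (subst mult_fract_cancel) (use assms(3) in auto)
  finally have "impedance ((Resistor (x / y) \<oplus> Inductor (1 / y)) \<parallel> M) = Some (Fract ([:x, 1:] * g) b)" .
  from impedance_Series[OF impedance_Resistor this one_neq_zero assms(4), of R] show ?thesis
    unfolding assms(1) by (simp del: impedance.simps)
qed

section \<open>Extraction of a lossy inductor\<close>

text \<open>In network terms \<open>x = R5/L2\<close>. The admittance parameter
  \<open>y = 1/L2\<close> is kept out of the locale because it varies during the descent, whereas
  \<open>R\<close>, \<open>x\<close> and \<open>g\<close> stay fixed.\<close>

locale inductor_extraction = biquadratic +
  fixes R x g0 g1 :: real
  assumes nonneg: "R \<ge> 0" "x \<ge> 0" "g0 \<ge> 0" "g1 \<ge> 0" "nonneg_poly b"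
    and split: "a = smult R b + [:x, 1:] * [:g0, g1:]"
begin

abbreviation g :: "real poly" where "g \<equiv> [:g0, g1:]"

definition c :: "real poly" where "c = [:x, 1:] * g"

definition d :: "real \<Rightarrow> real poly" where "d y = b - smult y g"

lemma c_eq: "c = [:x * g0, g0 + x * g1, g1:]"
  by (simp add: c_def)

lemma coeff_c: "coeff c 0 = x * g0" "coeff c 1 = g0 + x * g1" "coeff c 2 = g1"
  by (simp_all add: c_eq)

lemma coeff_d: "coeff (d y) 0 = coeff b 0 - y * g0" "coeff (d y) 1 = coeff b 1 - y * g1" "coeff (d y) 2 = coeff b 2"
  by (simp_all add: d_def)

lemma coeff_a: "coeff a 0 = R * coeff b 0 + x * g0" "coeff a 1 = R * coeff b 1 + g0 + x * g1"
  "coeff a 2 = R * coeff b 2 + g1"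
  using split coeff_c unfolding c_def by simp_all

lemma degree_cd: "degree c \<le> 2" "degree (d y) \<le> 2"
  unfolding c_eq d_def using degree(2) by (simp_all add: degree_diff_le)

lemma nonneg_c: "nonneg_poly c"
  using nonneg by (simp add: c_eq)

lemma nonneg_a: "nonneg_poly a"
  using nonneg nonneg_c unfolding split c_def by (intro nonneg_poly_add nonneg_poly_smult) simp_all

lemma nonneg_d: "nonneg_poly (d y) \<longleftrightarrow> coeff b 0 - y * g0 \<ge> 0 \<and> coeff b 1 - y * g1 \<ge> 0"
proof -
  have "d y = [:coeff b 0 - y * g0, coeff b 1 - y * g1, coeff b 2:]"
    using quadratic_eqI[OF degree_cd(2), of y] unfolding coeff_d .
  thus ?thesis using nonneg_polyD[OF nonneg(5), of 2] by simp
qed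

lemma nonneg_d_mono:
  assumes "nonneg_poly (d y)" "t \<le> y"
  shows "nonneg_poly (d t)"
  using assms nonneg(3,4) mult_right_mono[of t y g0] mult_right_mono[of t y g1]
  unfolding nonneg_d by linarith

lemma beta_poly: "beta b x = poly b (- x)"
  using poly_deg_le_2[OF degree(2)] by (simp add: beta_def)

lemma beta_nz: "beta b x \<noteq> 0"
proof
  assume "beta b x = 0"
  hence "poly b (- x) = 0" "poly a (- x) = 0" by (simp_all add: beta_poly split)
  with coprime_no_common_root[OF coprime] show False by blast
qed

lemma alpha_eq: "alpha a x = R * beta b x"
  unfolding alpha_def beta_def coeff_a by algebra

lemma f_eq: "f0 a b x = beta b x * g0" "f1 a b x = beta b x * g1"
  unfolding f0_Gamma[OF degree] f1_Gamma[OF degree] Gamma_Lambda_defs coeff_a beta_def by algebra+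

text \<open>With \<open>z = y / beta\<close> each quantity of the statement is a power of
  \<open>beta\<close> times the corresponding one of the pair \<open>c\<close>,
  \<open>d y\<close>.\<close>

lemma cd_eq:
  "c0 a b x = beta b x * coeff c 0" "c1 a b x = beta b x * coeff c 1" "c2 a b x = beta b x * coeff c 2"
  "d0 a b x (y / beta b x) = beta b x * coeff (d y) 0"
  "d1 a b x (y / beta b x) = beta b x * coeff (d y) 1"
  "d2 a b x (y / beta b x) = beta b x * coeff (d y) 2"
  unfolding c0_def c1_def c2_def d0_def d1_def d2_def f_eq coeff_c coeff_d
  using beta_nz by (simp_all add: algebra_simps)

lemma gamma_eq:
  "gamma1 a b x (y / beta b x) = (beta b x)^2 * Gamma1 c (d y)"
  "gamma2 a b x (y / beta b x) = (beta b x)^2 * Gamma2 c (d y)"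
  "gamma3 a b x (y / beta b x) = (beta b x)^2 * Gamma3 c (d y)"
  unfolding gamma1_def gamma2_def gamma3_def cd_eq Gamma_Lambda_defs by algebra+

lemma lambda_eq:
  "lambda1 a b x (y / beta b x) = beta b x * ((beta b x)^2 * Lambda1 c (d y))"
  "lambda2 a b x (y / beta b x) = beta b x * ((beta b x)^2 * Lambda2 c (d y))"
  "lambda3 a b x (y / beta b x) = beta b x * ((beta b x)^2 * Lambda3 c (d y))"
  "lambda4 a b x (y / beta b x) = beta b x * ((beta b x)^2 * Lambda4 c (d y))"
  unfolding lambda1_def lambda2_def lambda3_def lambda4_def gamma_eq cd_eq
    Lambda1_def Lambda2_def Lambda3_def Lambda4_def by algebra+

lemma eta_eq: "eta a b x (y / beta b x) = beta b x - y * (g0 - x * g1)"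
proof -
  have "y / beta b x * (beta b x * r) = y * r" for r using beta_nz by simp
  thus ?thesis unfolding eta_def f_eq by (simp add: beta_def algebra_simps)
qed

text \<open>A statement about resultants: splitting off the factor \<open>s + x\<close> leaves the
  values \<open>eta\<close> of \<open>d y\<close> and \<open>beta\<close> of \<open>b\<close> at
  \<open>- x\<close>, and the remaining resultants with \<open>g\<close> agree because
  \<open>d y\<close> and \<open>b\<close> differ by a multiple of \<open>g\<close>.\<close>

lemma F0_cd: "beta b x * F0 c (d y) = eta a b x (y / beta b x) * F0 a b"
  unfolding eta_eq unfolding F0_Gamma Gamma_Lambda_defs coeff_a coeff_c coeff_d beta_def by algebra

text \<open>All entries carry the sign of \<open>beta\<close>, which may be negative; so the
  conditions ask for equal signs and not for nonnegativity.\<close>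

lemma same_sign_data:
  assumes "y > 0" "nonneg_poly (d y)" "l \<ge> 0"
  shows "same_sign {alpha a x, beta b x, y / beta b x, d0 a b x (y / beta b x), d1 a b x (y / beta b x),
    d2 a b x (y / beta b x), f0 a b x, f1 a b x, beta b x * ((beta b x)^2 * l)}"
proof -
  have nn: "coeff (d y) i \<ge> 0" for i using assms(2) nonneg_polyD by blast
  consider "beta b x > 0" | "beta b x < 0" using beta_nz by linarith
  thus ?thesis
  proof cases
    case 1
    thus ?thesis unfolding same_sign_def cd_eq f_eq alpha_eq using nn nonneg assms
      by (intro disjI1) simp
  next
    case 2
    hence "beta b x * r \<le> 0 \<and> r * beta b x \<le> 0" if "r \<ge> 0" for r
      using that by (simp add: mult_nonpos_nonneg mult_nonneg_nonpos)
    thus ?thesis unfolding same_sign_def cd_eq f_eq alpha_eq using nn nonneg assms 2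
      by (intro disjI2) (simp add: divide_nonneg_neg)
  qed
qed

lemma Q_cd:
  assumes "y > 0" "nonneg_poly (d y)" "F0 c (d y) < 0"
  shows "Q1 c (d y) \<Longrightarrow> Q5 a b x (y / beta b x)" "Q3 c (d y) \<Longrightarrow> Q6 a b x (y / beta b x)"
    "Q4 c (d y) \<Longrightarrow> Q7 a b x (y / beta b x)" "Q2 c (d y) \<Longrightarrow> Q8 a b x (y / beta b x)"
proof -
  have nn: "\<forall>i\<in>{0,1,2}. coeff a i \<ge> 0 \<and> coeff b i \<ge> 0"
    using nonneg_a nonneg(5) nonneg_polyD by blast
  have eta: "eta a b x (y / beta b x) \<noteq> 0" using F0_cd[of y] assms(3) beta_nz by auto
  have "beta b x * eta a b x (y / beta b x) * F0 a b = (beta b x)^2 * F0 c (d y)"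
    using F0_cd[of y] by (simp add: power2_eq_square mult.assoc)
  also have "\<dots> < 0" using beta_nz assms(3) by (simp add: mult_pos_neg)
  finally have F: "beta b x * eta a b x (y / beta b x) * F0 a b \<le> 0"
    "- beta b x * eta a b x (y / beta b x) * F0 a b \<ge> 0" by simp_all
  note same = same_sign_data[OF assms(1,2)]
  note iff = Q_nonneg_iff[OF nonneg_c assms(2)]
  show "Q1 c (d y) \<Longrightarrow> Q5 a b x (y / beta b x)"
    unfolding Q5_def lambda_eq gamma_eq iff using nn eta F0_ne F same[of "Lambda1 c (d y)"] by simp
  show "Q3 c (d y) \<Longrightarrow> Q6 a b x (y / beta b x)"
    unfolding Q6_def lambda_eq gamma_eq iff using nn eta F0_ne F same[of "Lambda3 c (d y)"]
    by (simp add: mult_nonneg_nonpos)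
  show "Q4 c (d y) \<Longrightarrow> Q7 a b x (y / beta b x)"
    unfolding Q7_def lambda_eq gamma_eq iff using nn eta F0_ne F same[of "Lambda4 c (d y)"]
    by (simp add: mult_nonneg_nonpos)
  show "Q2 c (d y) \<Longrightarrow> Q8 a b x (y / beta b x)"
    unfolding Q8_def lambda_eq gamma_eq iff using nn eta F0_ne F same[of "Lambda2 c (d y)"] by simp
qed

definition reducible :: bool where
  "reducible \<longleftrightarrow> Some (Fract a b) \<in> SP_impedances 1 1 \<or> Some (Fract a b) \<in> SP_impedances 0 2 \<or>
     (\<exists>u v. u \<ge> 0 \<and> v \<noteq> 0 \<and>
        (Q5 a b u v \<and> F1 a b u v \<or> Q6 a b u v \<and> F2 a b u v \<or>
         Q7 a b u v \<and> F3 a b u v \<or> Q8 a b u v \<and> F4 a b u v))"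

lemma reducible_boundary:
  assumes "y > 0" "nonneg_poly (d y)" "F0 c (d y) < 0"
    and "Q1 c (d y) \<and> Lambda1 c (d y) = 0 \<or> Q3 c (d y) \<and> Lambda3 c (d y) = 0 \<or>
      Q4 c (d y) \<and> Lambda4 c (d y) = 0 \<or> Q2 c (d y) \<and> Lambda2 c (d y) = 0"
  shows reducible
proof -
  have "y / beta b x \<noteq> 0" using assms(1) beta_nz by simp
  with nonneg(2) Q_cd[OF assms(1-3)] assms(4) show ?thesis
    unfolding reducible_def F1_def F2_def F3_def F3_i_def F4_def F4_i_def
    by (metis lambda_eq mult_zero_right)
qed

lemma d_0: "d 0 = b"
  by (simp add: d_def)

text \<open>At \<open>y = 0\<close> the extracted branch is an open circuit. What remains is
  \<open>R\<close> in series with a realization of \<open>c / b\<close> by one inductor and one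
  capacitor.\<close>

lemma reducible_endpoint:
  assumes "F0 c b < 0" "Q1 c b \<or> Q2 c b \<or> Q3 c b \<or> Q4 c b"
  shows reducible
proof -
  note deg = degree_cd(1) degree(2)
  obtain M where M: "admissible M" "num_capacitors M = 1" "num_inductors M = 1"
    "impedance M = Some (Fract c b)"
  proof -
    consider "Q1 c b" | "Q2 c b" | "Q3 c b" | "Q4 c b" using assms(2) by blast
    thus ?thesis
    proof cases
      case 1
      note N = N6_realization[OF deg 1 assms(1)]
      from N(1-5) show ?thesis
        by (intro that[OF _ _ _ N(6)]) (simp_all add: N6_def)
    next
      case 2
      note N = N9_realization[OF deg 2 assms(1)]
      from N(1-5) show ?thesis
        by (intro that[OF _ _ _ N(6)]) (simp_all add: N9_def)
    next
      case 3
      note N = N7_realization[OF deg 3 assms(1)]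
      from N(1-5) show ?thesis
        by (intro that[OF _ _ _ N(6)]) (simp_all add: N7_def)
    next
      case 4
      note N = N8_realization[OF deg 4 assms(1)]
      from N(1-5) show ?thesis
        by (intro that[OF _ _ _ N(6)]) (simp_all add: N8_def)
    qed
  qed
  have "impedance (Resistor R \<oplus> M) = Some (Fract a b)"
    using impedance_Series[OF impedance_Resistor M(4) one_neq_zero b_nonzero, of R]
    by (simp add: split c_def)
  moreover have "admissible (Resistor R \<oplus> M)" using M nonneg by simp
  ultimately have "Some (Fract a b) \<in> SP_impedances 1 1"
    unfolding SP_impedances_def using M by (metis (mono_tags, lifting) CollectI add_0 le_refl num_capacitors.simps(1,5) num_inductors.simps(1,5))
  thus ?thesis by (simp add: reducible_def)
qed

text \<open>
  If \<open>\<beta> \<eta> < 0\<close> then reducing the extracted admittance makes \<open>\<eta>\<close> vanish; there \<open>c\<close> and \<open>d\<close> have the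
  common factor \<open>s + x\<close>, so that the remaining network has a single energy storage element.
\<close>

lemma reducible_degenerate:
  assumes "y > 0" "nonneg_poly (d y)" "beta b x * eta a b x (y / beta b x) < 0"
  shows reducible
proof -
  define D where "D = beta b x - eta a b x (y / beta b x)"
  \<comment> \<open>\<open>eta\<close> is affine in the admittance, starts at \<open>beta\<close>,
    and \<open>D\<close> is its total decrease from 0 to \<open>y\<close>; so it vanishes at the
    fraction \<open>beta / D\<close> of the way.\<close>
  define t where "t = y * (beta b x / D)"
  have bD: "beta b x * D > (beta b x)^2" unfolding D_def using assms(3) by (simp add: power2_eq_square algebra_simps)
  moreover have b2: "(beta b x)^2 > 0" using beta_nz by simp
  ultimately have "D \<noteq> 0" and pos: "beta b x / D > 0" and le: "beta b x / D \<le> 1"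
    by (auto simp: zero_less_divide_iff zero_less_mult_iff divide_le_eq power2_eq_square mult_less_cancel_left split: if_splits)
  note t = t_def
  have t0: "t > 0" and ty: "t \<le> y" 
    unfolding t using mult_pos_pos[OF assms(1) pos] mult_left_le[OF le less_imp_le[OF assms(1)]] by simp_all
  have nd: "nonneg_poly (d t)" using nonneg_d_mono[OF assms(2) ty] .
  have "D = y * (g0 - x * g1)" unfolding D_def eta_eq by simp
  moreover have "t * (g0 - x * g1) = beta b x / D * (y * (g0 - x * g1))" unfolding t by simp
  ultimately have "beta b x - t * (g0 - x * g1) = 0" using \<open>D \<noteq> 0\<close> by simp
  hence "poly (d t) (- x) = 0" by (simp add: d_def beta_poly algebra_simps)
  then obtain e where e: "d t = [:x, 1:] * e" by (metis dvdE minus_minus poly_eq_0_iff_dvd)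
  \<comment> \<open>Otherwise \<open>b\<close> is a multiple of \<open>g\<close>, which also divides
    \<open>a - R*b\<close>.\<close>
  have dt: "d t \<noteq> 0"
  proof
    assume 0: "d t = 0"
    have b: "coeff b 0 = t * g0" "coeff b 1 = t * g1" "coeff b 2 = 0"
      using arg_cong[OF 0, of "\<lambda>p. coeff p 0"] arg_cong[OF 0, of "\<lambda>p. coeff p 1"]
        arg_cong[OF 0, of "\<lambda>p. coeff p 2"] unfolding coeff_d by simp_all
    have "F0 a b = 0" unfolding F0_Gamma Gamma_Lambda_defs coeff_a b by algebra
    with F0_ne show False ..
  qed
  have "degree e \<le> 1"
  proof -
    have "e \<noteq> 0" using dt e by auto
    hence "degree (d t) = 1 + degree e" unfolding e by (subst degree_mult_eq) auto
    thus ?thesis using degree_cd(2)[of t] by simp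
  qed
  then obtain e0 e1 where ee: "e = [:e0, e1:]" using linear_eqI by blast
  have ed: "coeff (d t) 0 = x * e0" "coeff (d t) 1 = e0 + x * e1" "coeff (d t) 2 = e1"
    unfolding e ee by simp_all
  have e1: "e1 \<ge> 0" using nonneg_polyD[OF nd, of 2] ed by simp
  have e0: "e0 \<ge> 0"
  proof (cases "x = 0")
    case True
    thus ?thesis using nonneg_polyD[OF nd, of 1] ed by simp
  next
    case False
    thus ?thesis using nonneg_polyD[OF nd, of 0] ed nonneg(2) by (simp add: zero_le_mult_iff)
  qed
  have e_nz: "[:e0, e1:] \<noteq> 0" using dt e ee by auto
  obtain M where M: "admissible M" "num_capacitors M + num_inductors M \<le> 1"
    "impedance M = Some (Fract g [:e0, e1:])"
    using first_order_realizable[OF nonneg(3,4) e0 e1 e_nz] .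
  have "Fract ([:x, 1:] * g) (d t) = Fract g [:e0, e1:]" unfolding e ee by (rule mult_fract_cancel) simp
  hence "impedance M = Some (Fract ([:x, 1:] * g) (d t))" using M(3) by simp
  moreover have "b = d t + smult t g" by (simp add: d_def)
  ultimately have imp: "impedance (Resistor R \<oplus> ((Resistor (x / t) \<oplus> Inductor (1 / t)) \<parallel> M)) = Some (Fract a b)"
    using impedance_lossy_inductor_Parallel[OF split _ _ b_nonzero dt] t0 by blast
  let ?N = "Resistor R \<oplus> ((Resistor (x / t) \<oplus> Inductor (1 / t)) \<parallel> M)"
  have "admissible ?N" using M nonneg t0 by simp
  \<comment> \<open>The element of \<open>M\<close> may be of either kind; together with the
    extracted inductor this gives the two alternatives.\<close>
  moreover have "num_capacitors ?N \<le> 1 \<and> num_inductors ?N \<le> 1 \<or> num_capacitors ?N \<le> 0 \<and> num_inductors ?N \<le> 2"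
    using M(2) by (simp add: numeral_2_eq_2) linarith
  ultimately show ?thesis using imp[symmetric] unfolding reducible_def SP_impedances_def by blast
qed

text \<open>The product \<open>beta * eta\<close> is affine in the admittance and positive at both
  ends: it is \<open>beta^2\<close> at 0, and at \<open>y\<close> it cannot vanish since
  \<open>F0 c (d y)\<close> does not.\<close>

lemma F0_cd_neg:
  assumes "y > 0" "F0 c (d y) < 0" "beta b x * eta a b x (y / beta b x) \<ge> 0" "0 \<le> t" "t \<le> y"
  shows "F0 c (d t) < 0"
proof -
  have eq: "(beta b x)^2 * F0 c (d s) = (beta b x * eta a b x (s / beta b x)) * F0 a b" for s
    using F0_cd[of s] by (simp add: power2_eq_square mult.assoc)
  have b2: "(beta b x)^2 > 0" using beta_nz by simp
  have y: "beta b x * eta a b x (y / beta b x) > 0 \<and> F0 a b < 0"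
    using eq[of y] assms(2,3) b2 by (smt (verit) mult_nonneg_nonneg mult_pos_neg mult_eq_0_iff mult_nonneg_nonpos)
  define h where "h = beta b x * (g0 - x * g1)"
  have eta: "beta b x * eta a b x (s / beta b x) = (beta b x)^2 - s * h" for s
    unfolding eta_eq h_def by algebra
  have "(beta b x)^2 - t * h > 0"
  proof (cases "h \<ge> 0")
    case True
    hence "t * h \<le> y * h" using assms(5) by (rule mult_right_mono[rotated])
    thus ?thesis using y unfolding eta by linarith
  next
    case False
    hence "t * h \<le> 0" using assms(4) by (simp add: mult_nonneg_nonpos)
    thus ?thesis using b2 by linarith
  qed
  hence "(beta b x)^2 * F0 c (d t) < 0" unfolding eq eta using y by (simp add: mult_pos_neg)
  thus ?thesis using b2 by (simp add: mult_less_0_iff)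
qed

lemma continuous_Gamma_Lambda:
  "continuous_on S (\<lambda>t. Lambda1 c (d t))" "continuous_on S (\<lambda>t. Lambda2 c (d t))"
  "continuous_on S (\<lambda>t. Lambda3 c (d t))" "continuous_on S (\<lambda>t. Lambda4 c (d t))"
  "continuous_on S (\<lambda>t. Gamma2 c (d t))"
  unfolding Gamma_Lambda_defs coeff_d by (intro continuous_intros)+

lemma Gamma2_antimono: "t \<le> y \<Longrightarrow> Gamma2 c (d y) \<le> Gamma2 c (d t)"
proof -
  assume "t \<le> y"
  hence "t * (g0 * g1) \<le> y * (g0 * g1)" using nonneg by (intro mult_right_mono) auto
  thus ?thesis unfolding Gamma_Lambda_defs coeff_d coeff_c by (simp add: algebra_simps)
qed

lemma zero_crossing:
  fixes f :: "real \<Rightarrow> real"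
  assumes "continuous_on {s..y} f" "f s < 0" "f y \<ge> 0" "s \<le> y"
  obtains t where "s < t" "t \<le> y" "f t = 0"
proof -
  obtain t where "s \<le> t" "t \<le> y" "f t = 0" using IVT'[of f s 0 y] assms by auto
  moreover from this assms(2) have "s \<noteq> t" by auto
  ultimately show ?thesis using that[of t] by simp
qed

text \<open>In both descents the extracted admittance \<open>y\<close> is decreased until a constraint becomes active.\<close>

lemma reducible_Gamma2_nonneg:
  assumes "y > 0" "nonneg_poly (d y)" "F0 c (d y) < 0" "Q1 c (d y) \<or> Q2 c (d y)"
  shows reducible
proof (cases "beta b x * eta a b x (y / beta b x) < 0")
  case True
  with reducible_degenerate assms show ?thesis by blast
next
  case False
  hence F: "F0 c (d t) < 0" if "0 \<le> t" "t \<le> y" for t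
    using F0_cd_neg[OF assms(1,3) _ that] by simp
  have nd: "nonneg_poly (d t)" if "t \<le> y" for t using nonneg_d_mono[OF assms(2) that] .
  note iff = Q_nonneg_iff[OF nonneg_c nd]
  have G: "Gamma2 c (d t) \<ge> 0" if "t \<le> y" for t
    using Gamma2_antimono[OF that] assms(4) iff[of y] by auto
  \<comment> \<open>One argument serves both conditions, with \<open>L\<close> the
    \<open>Lambda\<close> of the one that holds at \<open>y\<close>. If \<open>L\<close> is still
    nonnegative at 0, the endpoint is reached; otherwise \<open>L\<close> has a zero on the
    way.\<close>
  have go: reducible
    if cont: "continuous_on {0..y} (\<lambda>t. L (d t))" and ge: "L (d y) \<ge> 0"
      and *: "\<And>t. t \<le> y \<Longrightarrow> L (d t) \<ge> 0 \<Longrightarrow> Q1 c (d t) \<or> Q2 c (d t)"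
      and **: "\<And>t. t \<le> y \<Longrightarrow> L (d t) = 0 \<Longrightarrow> Q1 c (d t) \<and> Lambda1 c (d t) = 0 \<or> Q2 c (d t) \<and> Lambda2 c (d t) = 0"
    for L :: "real poly \<Rightarrow> real"
  proof (cases "L (d 0) \<ge> 0")
    case True
    thus ?thesis using reducible_endpoint *[of 0] F[of 0] assms(1) unfolding d_0 by auto
  next
    case False
    obtain t where t: "0 < t" "t \<le> y" "L (d t) = 0"
      by (rule zero_crossing[OF cont]) (use False ge assms(1) in auto)
    show ?thesis using reducible_boundary[OF t(1) nd[OF t(2)] F[OF _ t(2)]] **[OF t(2,3)] t(1) by auto
  qed
  from assms(4) show ?thesis
  proof
    assume "Q1 c (d y)"
    thus ?thesis using go[of "Lambda1 c"] iff G continuous_Gamma_Lambda(1) by auto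
  next
    assume "Q2 c (d y)"
    thus ?thesis using go[of "Lambda2 c"] iff G continuous_Gamma_Lambda(2) by auto
  qed
qed

text \<open>Where \<open>Gamma2 = 0\<close>, \<open>F0 < 0\<close> means that \<open>Gamma1\<close>
  and \<open>Gamma3\<close> have opposite signs. \<open>Lambda1\<close> and \<open>Lambda3\<close>
  are then \<open>Gamma1\<close> and \<open>- Gamma3\<close> times the same nonnegative coefficient
  of \<open>d t\<close>, so (Q3) gives (Q1); similarly (Q4) gives (Q2), with a coefficient of
  \<open>c\<close>.\<close>

lemma Q_transition:
  assumes "nonneg_poly (d t)" "F0 c (d t) < 0" "Gamma2 c (d t) = 0" "Q3 c (d t) \<or> Q4 c (d t)"
  shows "Q1 c (d t) \<or> Q2 c (d t)"
proof -
  note iff = Q_nonneg_iff[OF nonneg_c assms(1)]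
  have nn: "coeff (d t) 1 \<ge> 0" "coeff c 1 \<ge> 0" using assms(1) nonneg_c nonneg_polyD by blast+
  have F: "Gamma1 c (d t) * Gamma3 c (d t) < 0" using assms(2,3) by (simp add: F0_Gamma)
  show ?thesis using assms(4)
  proof
    assume "Q3 c (d t)"
    hence "coeff (d t) 1 * Gamma3 c (d t) \<le> 0" using iff(3) assms(3) by (simp add: Lambda3_def)
    hence "coeff (d t) 1 * Gamma1 c (d t) \<ge> 0" using nn F
      by (auto simp: mult_le_0_iff mult_less_0_iff zero_le_mult_iff)
    thus ?thesis using iff(1) assms(3) by (simp add: Lambda1_def)
  next
    assume "Q4 c (d t)"
    hence "coeff c 1 * Gamma1 c (d t) \<le> 0" using iff(4) assms(3) by (simp add: Lambda4_def)
    hence "coeff c 1 * Gamma3 c (d t) \<ge> 0" using nn F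
      by (auto simp: mult_le_0_iff mult_less_0_iff zero_le_mult_iff)
    thus ?thesis using iff(2) assms(3) by (simp add: Lambda2_def)
  qed
qed

lemma reducible_Gamma2_nonpos:
  assumes "y > 0" "nonneg_poly (d y)" "F0 c (d y) < 0" "Q3 c (d y) \<or> Q4 c (d y)"
  shows reducible
proof (cases "beta b x * eta a b x (y / beta b x) < 0")
  case True
  with reducible_degenerate assms show ?thesis by blast
next
  case False
  hence F: "F0 c (d t) < 0" if "0 \<le> t" "t \<le> y" for t
    using F0_cd_neg[OF assms(1,3) _ that] by simp
  have nd: "nonneg_poly (d t)" if "t \<le> y" for t using nonneg_d_mono[OF assms(2) that] .
  note iff = Q_nonneg_iff[OF nonneg_c nd]
  have Gy: "Gamma2 c (d y) \<le> 0" using assms(4) iff[of y] by auto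
  \<comment> \<open>By monotonicity \<open>Gamma2\<close> stays nonpositive on
    \<open>{s..y}\<close>; the descent under (Q3) or (Q4) is confined to this interval.\<close>
  obtain s where s: "0 \<le> s" "s \<le> y" "Gamma2 c (d s) \<le> 0" "s = 0 \<or> Gamma2 c (d s) = 0"
  proof (cases "Gamma2 c (d 0) \<le> 0")
    case True
    thus ?thesis using that[of 0] assms(1) by simp
  next
    case False
    have "continuous_on {0..y} (\<lambda>t. - Gamma2 c (d t))"
      by (intro continuous_on_minus continuous_Gamma_Lambda)
    then obtain t where "0 < t" "t \<le> y" "- Gamma2 c (d t) = 0"
      by (rule zero_crossing) (use False Gy assms(1) in auto)
    thus ?thesis using that[of t] by simp
  qed
  have G: "Gamma2 c (d t) \<le> 0" if "s \<le> t" for t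
    using Gamma2_antimono[OF that] s(3) by linarith
  have go: reducible
    if cont: "continuous_on {s..y} (\<lambda>t. L (d t))" and ge: "L (d y) \<ge> 0"
      and *: "\<And>t. t \<le> y \<Longrightarrow> s \<le> t \<Longrightarrow> L (d t) \<ge> 0 \<Longrightarrow> Q3 c (d t) \<or> Q4 c (d t)"
      and **: "\<And>t. t \<le> y \<Longrightarrow> s \<le> t \<Longrightarrow> L (d t) = 0 \<Longrightarrow> Q3 c (d t) \<and> Lambda3 c (d t) = 0 \<or> Q4 c (d t) \<and> Lambda4 c (d t) = 0"
    for L :: "real poly \<Rightarrow> real"
  proof (cases "L (d s) \<ge> 0")
    case True
    hence Q: "Q3 c (d s) \<or> Q4 c (d s)" using * s by blast
    show ?thesis
    proof (cases "s = 0")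
      case True
      thus ?thesis using reducible_endpoint Q F[of 0] assms(1) d_0 by auto
    next
      case False
      \<comment> \<open>From \<open>s\<close> on, the descent continues under (Q1) or (Q2).\<close>
      with s have "Gamma2 c (d s) = 0" "s > 0" by simp_all
      with Q_transition[OF nd F _ Q] s reducible_Gamma2_nonneg[OF _ nd F, of s] show ?thesis by simp
    qed
  next
    case False
    obtain t where t: "s < t" "t \<le> y" "L (d t) = 0"
      by (rule zero_crossing[OF cont]) (use False ge s in auto)
    hence "t > 0" using s(1) by simp
    thus ?thesis using reducible_boundary[OF _ nd[OF t(2)] F[OF _ t(2)]] **[OF t(2) _ t(3)] t(1) by auto
  qed
  from assms(4) show ?thesis
  proof
    assume "Q3 c (d y)"
    thus ?thesis using go[of "Lambda3 c"] iff G continuous_Gamma_Lambda(3) by auto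
  next
    assume "Q4 c (d y)"
    thus ?thesis using go[of "Lambda4 c"] iff G continuous_Gamma_Lambda(4) by auto
  qed
qed

end

section \<open>Explicit element values for the networks with three storage elements\<close>

lemma class_N10I:
  "R1 \<ge> 0 \<Longrightarrow> R2 \<ge> 0 \<Longrightarrow> G3 \<ge> 0 \<Longrightarrow> R4 \<ge> 0 \<Longrightarrow> R5 \<ge> 0 \<Longrightarrow>
    C1 > 0 \<Longrightarrow> L1 > 0 \<Longrightarrow> L2 > 0 \<Longrightarrow>
    N10 R1 R2 G3 R4 R5 C1 L1 L2 \<in> class_N10"
  unfolding class_N10_def by blast

lemma class_N17I:
  "R1 \<ge> 0 \<Longrightarrow> R2 \<ge> 0 \<Longrightarrow> G3 = 0 \<Longrightarrow> R4 \<ge> 0 \<Longrightarrow> R5 \<ge> 0 \<Longrightarrow>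
    C1 > 0 \<Longrightarrow> L1 > 0 \<Longrightarrow> L2 > 0 \<Longrightarrow>
    N10 R1 R2 G3 R4 R5 C1 L1 L2 \<in> class_N17"
  unfolding class_N17_def by blast

lemma class_N11I:
  "R1 \<ge> 0 \<Longrightarrow> R2 \<ge> 0 \<Longrightarrow> G3 \<ge> 0 \<Longrightarrow> R4 \<ge> 0 \<Longrightarrow> R5 \<ge> 0 \<Longrightarrow>
    C1 > 0 \<Longrightarrow> L1 > 0 \<Longrightarrow> L2 > 0 \<Longrightarrow>
    N11 R1 R2 G3 R4 R5 C1 L1 L2 \<in> class_N11"
  unfolding class_N11_def by blast

lemma class_N20I:
  "R1 \<ge> 0 \<Longrightarrow> R2 \<ge> 0 \<Longrightarrow> G3 = 0 \<Longrightarrow> R4 \<ge> 0 \<Longrightarrow> R5 \<ge> 0 \<Longrightarrow>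
    C1 > 0 \<Longrightarrow> L1 > 0 \<Longrightarrow> L2 > 0 \<Longrightarrow>
    N11 R1 R2 G3 R4 R5 C1 L1 L2 \<in> class_N20"
  unfolding class_N20_def by blast

lemma class_N12I:
  "G1 \<ge> 0 \<Longrightarrow> G2 \<ge> 0 \<Longrightarrow> R3 \<ge> 0 \<Longrightarrow> R4 \<ge> 0 \<Longrightarrow> R5 \<ge> 0 \<Longrightarrow>
    C1 > 0 \<Longrightarrow> L1 > 0 \<Longrightarrow> L2 > 0 \<Longrightarrow>
    N12 G1 G2 R3 R4 R5 C1 L1 L2 \<in> class_N12"
  unfolding class_N12_def by blast

lemma class_N22I:
  "G1 = 0 \<Longrightarrow> G2 \<ge> 0 \<Longrightarrow> R3 \<ge> 0 \<Longrightarrow> R4 \<ge> 0 \<Longrightarrow> R5 \<ge> 0 \<Longrightarrow>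
    C1 > 0 \<Longrightarrow> L1 > 0 \<Longrightarrow> L2 > 0 \<Longrightarrow>
    N12 G1 G2 R3 R4 R5 C1 L1 L2 \<in> class_N22"
  unfolding class_N22_def by blast

lemma class_N23I:
  "G1 \<ge> 0 \<Longrightarrow> G2 \<ge> 0 \<Longrightarrow> R3 = 0 \<Longrightarrow> R4 \<ge> 0 \<Longrightarrow> R5 \<ge> 0 \<Longrightarrow>
    C1 > 0 \<Longrightarrow> L1 > 0 \<Longrightarrow> L2 > 0 \<Longrightarrow>
    N12 G1 G2 R3 R4 R5 C1 L1 L2 \<in> class_N23"
  unfolding class_N23_def by blast

lemma class_N13I:
  "G1 \<ge> 0 \<Longrightarrow> G2 \<ge> 0 \<Longrightarrow> R3 \<ge> 0 \<Longrightarrow> R4 \<ge> 0 \<Longrightarrow> R5 \<ge> 0 \<Longrightarrow>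
    C1 > 0 \<Longrightarrow> L1 > 0 \<Longrightarrow> L2 > 0 \<Longrightarrow>
    N13 G1 G2 R3 R4 R5 C1 L1 L2 \<in> class_N13"
  unfolding class_N13_def by blast

lemma class_N25I:
  "G1 = 0 \<Longrightarrow> G2 \<ge> 0 \<Longrightarrow> R3 \<ge> 0 \<Longrightarrow> R4 \<ge> 0 \<Longrightarrow> R5 \<ge> 0 \<Longrightarrow>
    C1 > 0 \<Longrightarrow> L1 > 0 \<Longrightarrow> L2 > 0 \<Longrightarrow>
    N13 G1 G2 R3 R4 R5 C1 L1 L2 \<in> class_N25"
  unfolding class_N25_def by blast

lemma class_N26I:
  "G1 \<ge> 0 \<Longrightarrow> G2 \<ge> 0 \<Longrightarrow> R3 = 0 \<Longrightarrow> R4 \<ge> 0 \<Longrightarrow> R5 \<ge> 0 \<Longrightarrow>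
    C1 > 0 \<Longrightarrow> L1 > 0 \<Longrightarrow> L2 > 0 \<Longrightarrow>
    N13 G1 G2 R3 R4 R5 C1 L1 L2 \<in> class_N26"
  unfolding class_N26_def by blast

lemma impedance_N10:
  "impedance (N10 R1 R2 G3 R4 R5 C1 L1 L2)
    = impedance (Resistor R4 \<oplus> ((Resistor R5 \<oplus> Inductor L2) \<parallel> N6 R1 R2 G3 C1 L1))"
  by (simp only: N10_def N6_def)

lemma impedance_N11:
  "impedance (N11 R1 R2 G3 R4 R5 C1 L1 L2)
    = impedance (Resistor R4 \<oplus> ((Resistor R5 \<oplus> Inductor L2) \<parallel> N7 R1 R2 G3 C1 L1))"
  by (simp only: N11_def N7_def)

text \<open>\<open>N12\<close> groups its conductor \<open>G1\<close> with the lossy inductor,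
  \<open>N8\<close> with the rest; addition of admittances is associative.\<close>

lemma impedance_N12:
  "impedance (N12 G1 G2 R3 R4 R5 C1 L1 L2)
    = impedance (Resistor R4 \<oplus> ((Resistor R5 \<oplus> Inductor L2) \<parallel> N8 G1 G2 R3 C1 L1))"
  by (simp only: N12_def N8_def impedance.simps recip_recip_imp add_imp_assoc)

lemma impedance_N13:
  "impedance (N13 G1 G2 R3 R4 R5 C1 L1 L2)
    = impedance (Resistor R4 \<oplus> ((Resistor R5 \<oplus> Inductor L2) \<parallel> N9 G1 G2 R3 C1 L1))"
  by (simp only: N13_def N9_def impedance.simps recip_recip_imp add_imp_assoc)

text \<open>Applied with \<open>k = beta\<close>: one equation for each shape of element formula,
  showing that the powers of \<open>beta\<close> cancel.\<close>

lemma quotient_cancel: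
  fixes k p q r :: real
  assumes "k \<noteq> 0"
  shows "k * p / (k * q) = p / q" "k^2 * p / (k * q * (k * r)) = p / (q * r)"
    "- (k^2 * p) / (k * q * (k * r)) = - p / (q * r)"
    "- (k * p) * (k * (k^2 * q)) / (k^4 * r) = - p * q / r"
    "- ((k * p)^2) * (k^2 * q) / (k^4 * r) = - (p^2) * q / r"
    "(k * p)^2 * (k^2 * q) / (k^4 * r) = p^2 * q / r"
    "k^2 * p / (k * q)^2 = p / q^2" "- (k^2 * p) / (k * q)^2 = - p / q^2"
    "- ((k * p)^2) / (k^2 * q) = - (p^2) / q" "(k * p)^2 / (k^2 * q) = p^2 / q"
    "k^4 * p / ((k * q)^2 * (k^2 * r)) = p / (q^2 * r)"
    "- (k^4 * p) / ((k * q)^2 * (k^2 * r)) = - p / (q^2 * r)"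
  using assms by (simp_all add: power2_eq_square power4_eq_xxxx)

context inductor_extraction
begin

lemma data_eq:
  "c0 a b x = beta b x * coeff c 0" "c1 a b x = beta b x * coeff c 1" "c2 a b x = beta b x * coeff c 2"
  "d0 a b x z = beta b x * coeff (d (beta b x * z)) 0"
  "d1 a b x z = beta b x * coeff (d (beta b x * z)) 1"
  "d2 a b x z = beta b x * coeff (d (beta b x * z)) 2"
  "gamma1 a b x z = (beta b x)^2 * Gamma1 c (d (beta b x * z))"
  "gamma2 a b x z = (beta b x)^2 * Gamma2 c (d (beta b x * z))"
  "gamma3 a b x z = (beta b x)^2 * Gamma3 c (d (beta b x * z))"
  "lambda1 a b x z = beta b x * ((beta b x)^2 * Lambda1 c (d (beta b x * z)))"
  "lambda2 a b x z = beta b x * ((beta b x)^2 * Lambda2 c (d (beta b x * z)))"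
  "lambda3 a b x z = beta b x * ((beta b x)^2 * Lambda3 c (d (beta b x * z)))"
  "lambda4 a b x z = beta b x * ((beta b x)^2 * Lambda4 c (d (beta b x * z)))"
  "beta b x * eta a b x z * F0 a b = (beta b x)^2 * F0 c (d (beta b x * z))"
  "(beta b x)^3 * eta a b x z * F0 a b = (beta b x)^4 * F0 c (d (beta b x * z))"
  "alpha a x / beta b x = R"
proof -
  have z: "beta b x * z / beta b x = z" using beta_nz by simp
  show "c0 a b x = beta b x * coeff c 0" "c1 a b x = beta b x * coeff c 1" "c2 a b x = beta b x * coeff c 2"
    by (rule cd_eq)+
  show "d0 a b x z = beta b x * coeff (d (beta b x * z)) 0"
    "d1 a b x z = beta b x * coeff (d (beta b x * z)) 1"
    "d2 a b x z = beta b x * coeff (d (beta b x * z)) 2"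
    using cd_eq(4-6)[of "beta b x * z"] unfolding z .
  show "gamma1 a b x z = (beta b x)^2 * Gamma1 c (d (beta b x * z))"
    "gamma2 a b x z = (beta b x)^2 * Gamma2 c (d (beta b x * z))"
    "gamma3 a b x z = (beta b x)^2 * Gamma3 c (d (beta b x * z))"
    using gamma_eq[of "beta b x * z"] unfolding z .
  show "lambda1 a b x z = beta b x * ((beta b x)^2 * Lambda1 c (d (beta b x * z)))"
    "lambda2 a b x z = beta b x * ((beta b x)^2 * Lambda2 c (d (beta b x * z)))"
    "lambda3 a b x z = beta b x * ((beta b x)^2 * Lambda3 c (d (beta b x * z)))"
    "lambda4 a b x z = beta b x * ((beta b x)^2 * Lambda4 c (d (beta b x * z)))"
    using lambda_eq[of "beta b x * z"] unfolding z .
  note F = F0_cd[of "beta b x * z", unfolded z]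
  show "beta b x * eta a b x z * F0 a b = (beta b x)^2 * F0 c (d (beta b x * z))"
    using F by (simp add: power2_eq_square mult.assoc)
  show "(beta b x)^3 * eta a b x z * F0 a b = (beta b x)^4 * F0 c (d (beta b x * z))"
    using F by (simp add: power3_eq_cube power4_eq_xxxx mult.assoc)
  show "alpha a x / beta b x = R" using alpha_eq beta_nz by simp
qed

lemma impedance_extraction:
  assumes "y > 0" "F0 c (d y) < 0" "impedance M = Some (Fract c (d y))"
  shows "impedance (Resistor R \<oplus> ((Resistor (x / y) \<oplus> Inductor (1 / y)) \<parallel> M)) = Some (Fract a b)"
proof -
  have "d y \<noteq> 0" using assms(2) unfolding F0_Gamma Gamma_Lambda_defs by auto
  moreover have "b = d y + smult y g" by (simp add: d_def)
  ultimately show ?thesis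
    using impedance_lossy_inductor_Parallel[OF split _ _ b_nonzero] assms(1,3) unfolding c_def by blast
qed

text \<open>The subnetwork besides \<open>R4\<close> and the lossy inductor realizes
  \<open>c / d\<close> with the values of \<open>N6_realization\<close>; these are the listed ones
  once the powers of \<open>beta\<close> are cancelled. The other three classes use
  \<open>N7\<close>, \<open>N8\<close> and \<open>N9\<close> in the same way.\<close>

lemma N10_extraction:
  assumes "beta b x * z > 0" "F0 c (d (beta b x * z)) < 0" "Q1 c (d (beta b x * z))"
  shows "(let R1 = c0 a b x / d0 a b x z;
          R2 = gamma2 a b x z / (d0 a b x z * d2 a b x z);
          G3 = - d2 a b x z * lambda1 a b x z / ((beta b x)^3 * eta a b x z * F0 a b);
          R4 = alpha a x / beta b x;
          R5 = x / (beta b x * z);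
          C1 = - ((d2 a b x z)^2) * gamma1 a b x z / ((beta b x)^3 * eta a b x z * F0 a b);
          L1 = gamma1 a b x z / (d0 a b x z)^2;
          L2 = 1 / (beta b x * z);
          N = N10 R1 R2 G3 R4 R5 C1 L1 L2
      in beta b x \<noteq> 0 \<and> d0 a b x z \<noteq> 0 \<and> d2 a b x z \<noteq> 0 \<and> gamma1 a b x z > 0 \<and>
         N \<in> class_N10 \<and> impedance N = Some (Fract a b) \<and>
         (F1 a b x z \<longrightarrow> G3 = 0 \<and> N \<in> class_N17))"
proof -
  define y where "y = beta b x * z"
  note y = assms[folded y_def]
  note eq = data_eq(1-3) data_eq(4-15)[of z, folded y_def] data_eq(16) y_def[symmetric]
  note N = N6_realization[OF degree_cd y(3,2)]
  note S = Q1_signs[OF y(3,2)]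
  have yx: "x / y \<ge> 0" "1 / y > 0" using y(1) nonneg by simp_all
  have nz: "beta b x \<noteq> 0" "(beta b x)^2 > 0" using beta_nz by simp_all
  have "d0 a b x z \<noteq> 0" "d2 a b x z \<noteq> 0" "gamma1 a b x z > 0"
    unfolding eq using S nz by (simp_all add: mult_pos_neg)
  moreover note impedance_extraction[OF y(1,2) N(6)]
  ultimately show ?thesis
    unfolding Let_def F1_def
    unfolding eq quotient_cancel[OF beta_nz]
    by (intro conjI impI class_N10I class_N17I impedance_N10[THEN trans])
      (use N(1-5) yx nonneg(1) nz in \<open>(assumption | force)+\<close>)
qed

lemma N11_extraction:
  assumes "beta b x * z > 0" "F0 c (d (beta b x * z)) < 0" "Q3 c (d (beta b x * z))"
  shows "(let R1 = c2 a b x / d2 a b x z;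
          R2 = - gamma2 a b x z / (d0 a b x z * d2 a b x z);
          G3 = - d0 a b x z * lambda3 a b x z / ((beta b x)^3 * eta a b x z * F0 a b);
          R4 = alpha a x / beta b x;
          R5 = x / (beta b x * z);
          C1 = - ((d2 a b x z)^2) / gamma3 a b x z;
          L1 = (beta b x)^3 * eta a b x z * F0 a b / ((d0 a b x z)^2 * gamma3 a b x z);
          L2 = 1 / (beta b x * z);
          N = N11 R1 R2 G3 R4 R5 C1 L1 L2
      in beta b x \<noteq> 0 \<and> d0 a b x z \<noteq> 0 \<and> d2 a b x z \<noteq> 0 \<and> gamma3 a b x z < 0 \<and>
         N \<in> class_N11 \<and> impedance N = Some (Fract a b) \<and>
         (F2 a b x z \<longrightarrow> G3 = 0 \<and> N \<in> class_N20))"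
proof -
  define y where "y = beta b x * z"
  note y = assms[folded y_def]
  note eq = data_eq(1-3) data_eq(4-15)[of z, folded y_def] data_eq(16) y_def[symmetric]
  note N = N7_realization[OF degree_cd y(3,2)]
  note S = Q3_signs[OF y(3,2)]
  have yx: "x / y \<ge> 0" "1 / y > 0" using y(1) nonneg by simp_all
  have nz: "beta b x \<noteq> 0" "(beta b x)^2 > 0" using beta_nz by simp_all
  have "d0 a b x z \<noteq> 0" "d2 a b x z \<noteq> 0" "gamma3 a b x z < 0"
    unfolding eq using S nz by (simp_all add: mult_pos_neg)
  moreover note impedance_extraction[OF y(1,2) N(6)]
  ultimately show ?thesis
    unfolding Let_def F2_def
    unfolding eq quotient_cancel[OF beta_nz]
    by (intro conjI impI class_N11I class_N20I impedance_N11[THEN trans])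
      (use N(1-5) yx nonneg(1) nz in \<open>(assumption | force)+\<close>)
qed

lemma N12_extraction:
  assumes "beta b x * z > 0" "F0 c (d (beta b x * z)) < 0" "Q4 c (d (beta b x * z))"
  shows "(let G1 = d0 a b x z / c0 a b x;
          G2 = - gamma2 a b x z / (c0 a b x * c2 a b x);
          R3 = - c2 a b x * lambda4 a b x z / ((beta b x)^3 * eta a b x z * F0 a b);
          R4 = alpha a x / beta b x;
          R5 = x / (beta b x * z);
          C1 = - gamma1 a b x z / (c0 a b x)^2;
          L1 = (c2 a b x)^2 * gamma1 a b x z / ((beta b x)^3 * eta a b x z * F0 a b);
          L2 = 1 / (beta b x * z);
          N = N12 G1 G2 R3 R4 R5 C1 L1 L2
      in beta b x \<noteq> 0 \<and> c0 a b x \<noteq> 0 \<and> c2 a b x \<noteq> 0 \<and> gamma1 a b x z < 0 \<and>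
         N \<in> class_N12 \<and> impedance N = Some (Fract a b) \<and>
         (F3_i a b x z \<longrightarrow> R3 = 0 \<and> N \<in> class_N23) \<and>
         (F3_ii a b x z \<longrightarrow> G1 = 0 \<and> N \<in> class_N22))"
proof -
  define y where "y = beta b x * z"
  note y = assms[folded y_def]
  note eq = data_eq(1-3) data_eq(4-15)[of z, folded y_def] data_eq(16) y_def[symmetric]
  note N = N8_realization[OF degree_cd y(3,2)]
  note S = Q4_signs[OF y(3,2)]
  have yx: "x / y \<ge> 0" "1 / y > 0" using y(1) nonneg by simp_all
  have nz: "beta b x \<noteq> 0" "(beta b x)^2 > 0" using beta_nz by simp_all
  have "c0 a b x \<noteq> 0" "c2 a b x \<noteq> 0" "gamma1 a b x z < 0"
    unfolding eq using S nz by (simp_all add: mult_pos_neg)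
  moreover note impedance_extraction[OF y(1,2) N(6)]
  ultimately show ?thesis
    unfolding Let_def F3_i_def F3_ii_def
    unfolding eq quotient_cancel[OF beta_nz]
    by (intro conjI impI class_N12I class_N22I class_N23I impedance_N12[THEN trans])
      (use N(1-5) yx nonneg(1) nz in \<open>(assumption | force)+\<close>)
qed

lemma N13_extraction:
  assumes "beta b x * z > 0" "F0 c (d (beta b x * z)) < 0" "Q2 c (d (beta b x * z))"
  shows "(let G1 = d2 a b x z / c2 a b x;
          G2 = gamma2 a b x z / (c0 a b x * c2 a b x);
          R3 = - c0 a b x * lambda2 a b x z / ((beta b x)^3 * eta a b x z * F0 a b);
          R4 = alpha a x / beta b x;
          R5 = x / (beta b x * z);
          C1 = - ((beta b x)^3 * eta a b x z * F0 a b) / ((c0 a b x)^2 * gamma3 a b x z);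
          L1 = (c2 a b x)^2 / gamma3 a b x z;
          L2 = 1 / (beta b x * z);
          N = N13 G1 G2 R3 R4 R5 C1 L1 L2
      in beta b x \<noteq> 0 \<and> c0 a b x \<noteq> 0 \<and> c2 a b x \<noteq> 0 \<and> gamma3 a b x z > 0 \<and>
         N \<in> class_N13 \<and> impedance N = Some (Fract a b) \<and>
         (F4_i a b x z \<longrightarrow> R3 = 0 \<and> N \<in> class_N26) \<and>
         (F4_ii a b x z \<longrightarrow> G1 = 0 \<and> N \<in> class_N25))"
proof -
  define y where "y = beta b x * z"
  note y = assms[folded y_def]
  note eq = data_eq(1-3) data_eq(4-15)[of z, folded y_def] data_eq(16) y_def[symmetric]
  note N = N9_realization[OF degree_cd y(3,2)]
  note S = Q2_signs[OF y(3,2)]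
  have yx: "x / y \<ge> 0" "1 / y > 0" using y(1) nonneg by simp_all
  have nz: "beta b x \<noteq> 0" "(beta b x)^2 > 0" using beta_nz by simp_all
  have "c0 a b x \<noteq> 0" "c2 a b x \<noteq> 0" "gamma3 a b x z > 0"
    unfolding eq using S nz by (simp_all add: mult_pos_neg)
  moreover note impedance_extraction[OF y(1,2) N(6)]
  ultimately show ?thesis
    unfolding Let_def F4_i_def F4_ii_def
    unfolding eq quotient_cancel[OF beta_nz]
    by (intro conjI impI class_N13I class_N25I class_N26I impedance_N13[THEN trans])
      (use N(1-5) yx nonneg(1) nz in \<open>(assumption | force)+\<close>)
qed

end

section \<open>From sign conditions and from networks to an extraction\<close>

context biquadratic
begin

text \<open>The polynomial \<open>beta*a - alpha*b\<close> vanishes at \<open>- x\<close>, and its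
  quotient by \<open>s + x\<close> is \<open>f0 + f1*s\<close>, the Bezoutian form evaluated at
  \<open>- x\<close>. Dividing by \<open>beta\<close> gives the required splitting of
  \<open>a\<close>, so the main point is \<open>beta \<noteq> 0\<close>.\<close>

lemma inductor_extraction_of_signs:
  assumes coeffs: "\<forall>i\<in>{0,1,2}. coeff a i \<ge> 0 \<and> coeff b i \<ge> 0" and "x \<ge> 0" "z \<noteq> 0"
    and same: "same_sign {alpha a x, beta b x, z, d0 a b x z, d1 a b x z, d2 a b x z, f0 a b x, f1 a b x, l}"
  shows "inductor_extraction a b (alpha a x / beta b x) x (f0 a b x / beta b x) (f1 a b x / beta b x)"
    and "beta b x * z > 0" "beta b x * l \<ge> 0"
    and "beta b x * d0 a b x z \<ge> 0" "beta b x * d1 a b x z \<ge> 0"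
proof -
  have prod: "r * t \<ge> 0" if "r \<in> S" "t \<in> S" "same_sign S" for r t S
    using that unfolding same_sign_def by (auto simp: zero_le_mult_iff)
  have f: "x * f0 a b x = beta b x * coeff a 0 - alpha a x * coeff b 0"
    "f0 a b x + x * f1 a b x = beta b x * coeff a 1 - alpha a x * coeff b 1"
    "f1 a b x = beta b x * coeff a 2 - alpha a x * coeff b 2"
    unfolding f0_Gamma[OF degree] f1_Gamma[OF degree] Gamma_Lambda_defs alpha_def beta_def by algebra+
  have poly: "alpha a x = poly a (- x)" "beta b x = poly b (- x)"
    unfolding poly_deg_le_2[OF degree(1)] poly_deg_le_2[OF degree(2)] alpha_def beta_def by simp_all
  have bnz: "beta b x \<noteq> 0"
  proof
    \<comment> \<open>Then \<open>- alpha*b = (s + x) * (f0 + f1*s)\<close> with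
      \<open>alpha \<noteq> 0\<close> by coprimality. Since \<open>f0\<close> and \<open>f1\<close>
      have the sign of \<open>alpha\<close>, all coefficients of \<open>b\<close> would be
      nonpositive.\<close>
    assume 0: "beta b x = 0"
    hence "alpha a x \<noteq> 0" using coprime_no_common_root[OF coprime, of "- x"] poly by auto
    hence sq: "(alpha a x)^2 > 0" by simp
    have "alpha a x * f0 a b x \<ge> 0" "alpha a x * f1 a b x \<ge> 0"
      by (rule prod[OF _ _ same]; simp)+
    hence "alpha a x * (x * f0 a b x) \<ge> 0" "alpha a x * (f0 a b x + x * f1 a b x) \<ge> 0" "alpha a x * f1 a b x \<ge> 0"
      using assms(2) by (simp_all add: distrib_left mult.left_commute)
    moreover have "alpha a x * (x * f0 a b x) = - ((alpha a x)^2 * coeff b 0)"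
      "alpha a x * (f0 a b x + x * f1 a b x) = - ((alpha a x)^2 * coeff b 1)"
      unfolding f(1,2) 0 by algebra+
    moreover have "alpha a x * f1 a b x = - ((alpha a x)^2 * coeff b 2)" unfolding f(3) 0 by algebra
    ultimately have "(alpha a x)^2 * coeff b 0 \<le> 0 \<and> (alpha a x)^2 * coeff b 1 \<le> 0 \<and> (alpha a x)^2 * coeff b 2 \<le> 0"
      by linarith
    hence "\<forall>i\<in>{0,1,2}. coeff b i \<le> 0" using sq by (simp add: mult_le_0_iff)
    with pos show False by force
  qed
  show bz: "beta b x * z > 0"
    using prod[OF _ _ same, of "beta b x" z] bnz assms(3) by (simp add: order_less_le)
  show "beta b x * l \<ge> 0" "beta b x * d0 a b x z \<ge> 0" "beta b x * d1 a b x z \<ge> 0"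
    by (rule prod[OF _ _ same]; simp)+
  have quot: "r / t \<ge> 0" if "r \<in> S" "t \<in> S" "same_sign S" for r t :: real and S
    using that unfolding same_sign_def by (auto simp: zero_le_divide_iff)
  have "nonneg_poly [:coeff b 0, coeff b 1, coeff b 2:]" using coeffs by simp
  note ab = quadratic_eqI[OF degree(1), symmetric] quadratic_eqI[OF degree(2), symmetric]
  have nb: "nonneg_poly b" using \<open>nonneg_poly [:coeff b 0, coeff b 1, coeff b 2:]\<close> unfolding ab .
  have "smult (beta b x) a = smult (alpha a x) b + [:x, 1:] * [:f0 a b x, f1 a b x:]"
  proof -
    have eq: "beta b x * coeff a 0 = alpha a x * coeff b 0 + x * f0 a b x"
      "beta b x * coeff a 1 = alpha a x * coeff b 1 + (f0 a b x + x * f1 a b x)"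
      "beta b x * coeff a 2 = alpha a x * coeff b 2 + f1 a b x"
      using f by linarith+
    have "smult (beta b x) [:coeff a 0, coeff a 1, coeff a 2:]
        = [:beta b x * coeff a 0, beta b x * coeff a 1, beta b x * coeff a 2:]" by simp
    also have "\<dots> = smult (alpha a x) [:coeff b 0, coeff b 1, coeff b 2:] + [:x, 1:] * [:f0 a b x, f1 a b x:]"
      unfolding eq by simp
    finally have "smult (beta b x) [:coeff a 0, coeff a 1, coeff a 2:]
        = smult (alpha a x) [:coeff b 0, coeff b 1, coeff b 2:] + [:x, 1:] * [:f0 a b x, f1 a b x:]" .
    thus ?thesis unfolding ab .
  qed
  hence "smult (1 / beta b x) (smult (beta b x) a)
    = smult (1 / beta b x) (smult (alpha a x) b + [:x, 1:] * [:f0 a b x, f1 a b x:])" by (rule arg_cong)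
  hence split: "a = smult (alpha a x / beta b x) b + [:x, 1:] * [:f0 a b x / beta b x, f1 a b x / beta b x:]"
    using bnz by (simp add: smult_add_right add_divide_distrib)
  show "inductor_extraction a b (alpha a x / beta b x) x (f0 a b x / beta b x) (f1 a b x / beta b x)"
    by unfold_locales (use split nb assms(2) in \<open>auto intro!: quot[OF _ _ same]\<close>)
qed

text \<open>A McMillan degree drop from three to two can only come from a cancellation at \<open>s = - R5 / L2\<close>.\<close>

lemma extraction_of_network:
  assumes W: "impedance W = Some (Fract p q)" "degree p \<le> 2" "degree q \<le> 2" "nonneg_poly p" "nonneg_poly q"
      "F0 p q \<noteq> 0"
    and "R4 \<ge> 0" "R5 \<ge> 0" "L2 > 0"
    and imp: "impedance (Resistor R4 \<oplus> ((Resistor R5 \<oplus> Inductor L2) \<parallel> W)) = Some (Fract a b)"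
  obtains g0 g1 k where "k > 0" "inductor_extraction a b R4 (R5 / L2) g0 g1"
    "[:R5 / L2, 1:] * [:g0, g1:] = smult k p" "b - smult (1 / L2) [:g0, g1:] = smult k q"
proof -
  define x where "x = R5 / L2"
  have x0: "x \<ge> 0" using assms by (simp add: x_def)
  define l where "l = [:R5, L2:]"
  have l: "l = smult L2 [:x, 1:]" using assms by (simp add: l_def x_def)
  have lnz: "l \<noteq> 0" using assms by (simp add: l_def)
  have ln: "nonneg_poly l" using assms by (simp add: l_def)
  have qnz: "q \<noteq> 0" using W(6) unfolding F0_Gamma Gamma_Lambda_defs by auto
  define D where "D = l * q + p"
  have Dnz: "D \<noteq> 0"
  proof
    assume "D = 0"
    hence "coeff (l * q) i + coeff p i = 0" for i unfolding D_def by (metis coeff_0 coeff_add)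
    moreover have "coeff (l * q) i \<ge> 0" "coeff p i \<ge> 0" for i
      using W(4) nonneg_poly_mult[OF ln W(5)] nonneg_polyD by blast+
    ultimately have "coeff (l * q) i = 0" for i by (metis add_nonneg_eq_0_iff)
    hence "l * q = 0" by (simp add: poly_eq_iff)
    with lnz qnz show False by simp
  qed
  have "impedance (Resistor R5 \<oplus> Inductor L2) = Some (Fract l 1)" by (simp add: l_def one_pCons)
  from impedance_Parallel[OF this W(1) one_neq_zero qnz] Dnz
  have "impedance ((Resistor R5 \<oplus> Inductor L2) \<parallel> W) = Some (Fract (l * p) D)" by (simp add: D_def del: impedance.simps)
  from impedance_Series[OF impedance_Resistor this one_neq_zero Dnz, of R4]
  have "Fract a b = Fract (smult R4 D + l * p) D" unfolding imp by simp
  hence "a * D = (smult R4 D + l * p) * b" using eq_fract(1)[OF b_nonzero Dnz] by blast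
  hence eq: "(a - smult R4 b) * D = (l * p) * b" by (simp add: algebra_simps)
  define a' where "a' = a - smult R4 b"
  have "coprime a' b"
  proof (rule coprimeI)
    fix h assume "h dvd a'" "h dvd b"
    moreover from this have "h dvd a' + smult R4 b" by (intro dvd_add dvd_smult)
    ultimately show "is_unit h" using coprime unfolding a'_def by (simp add: coprime_common_divisor)
  qed
  hence "b dvd D" using eq unfolding a'_def[symmetric]
    by (metis coprime_commute coprime_dvd_mult_right_iff dvd_triv_right)
  then obtain h where h: "D = b * h" ..
  hence lp: "l * p = a' * h" using eq b_nonzero unfolding a'_def[symmetric] by simp
  have hnz: "h \<noteq> 0" using Dnz h by auto
  have dega': "degree a' \<le> 2" unfolding a'_def using degree by (simp add: degree_diff_le)
  have degl: "degree l \<le> 1" by (simp add: l_def)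
  have lp3: "degree (l * p) \<le> 3"
    using degree_mult_le[of l p] degl W(2) by linarith
  have D3: "degree D \<le> 3" unfolding D_def
    using degree_mult_le[of l q] degl W(2,3) by (intro degree_add_le) linarith+
  have c3: "coeff (l * r) 3 = L2 * coeff r 2" if "degree r \<le> 2" for r
    using that by (simp add: l_def eval_nat_numeral coeff_eq_0)
  \<comment> \<open>A constant \<open>h\<close> would leave \<open>l*p\<close> and \<open>D\<close>
    with vanishing cubic coefficients, hence \<open>p\<close> and \<open>q\<close> without quadratic
    terms, and \<open>F0 p q = 0\<close>.\<close>
  have "degree h \<noteq> 0"
  proof
    assume "degree h = 0"
    then obtain t where "h = [:t:]" by (rule degree_eq_zeroE)
    hence "coeff D 3 = 0" "coeff (l * p) 3 = 0" unfolding h lp using degree dega' by (simp_all add: coeff_eq_0)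
    moreover have "coeff p 3 = 0" using W(2) by (simp add: coeff_eq_0)
    ultimately have "coeff q 2 = 0" "coeff p 2 = 0"
      using assms(9) c3[OF W(2)] c3[OF W(3)] unfolding D_def by simp_all
    hence "F0 p q = 0" unfolding F0_Gamma Gamma_Lambda_defs by simp
    with W(6) show False by simp
  qed
  \<comment> \<open>A cancellation of degree two or more would bring both \<open>a'\<close> and
    \<open>b\<close> below degree two, against \<open>top\<close>.\<close>
  moreover have "degree h < 2"
  proof (rule ccontr)
    assume h2: "\<not> degree h < 2"
    have "degree b \<le> 1" using D3 h2 b_nonzero hnz unfolding h by (simp add: degree_mult_eq)
    moreover have "degree a' \<le> 1"
      using lp3 h2 hnz unfolding lp by (cases "a' = 0") (simp_all add: degree_mult_eq)
    ultimately have "coeff b 2 = 0" "coeff a' 2 = 0" by (simp_all add: coeff_eq_0)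
    with top show False unfolding a'_def by simp
  qed
  ultimately have deg1: "degree h = 1" by linarith
  then obtain h0 h1 where h01: "h = [:h0, h1:]" using linear_eqI[of h] by auto
  have h1: "h1 \<noteq> 0" using deg1 unfolding h01 by auto
  define r where "r = - h0 / h1"
  have hr: "poly h r = 0" using h1 by (simp add: h01 r_def)
  \<comment> \<open>At the root of \<open>h\<close> both \<open>l*p\<close> and
    \<open>l*q + p\<close> vanish, which forces \<open>p\<close> to vanish. As
    \<open>F0 p q \<noteq> 0\<close>, \<open>q\<close> does not, so \<open>r\<close> is the root of
    \<open>l\<close>.\<close>
  have "poly (l * p) r = 0" "poly D r = 0" unfolding lp h using hr by simp_all
  hence lpr: "poly l r * poly p r = 0" and Dr: "poly l r * poly q r + poly p r = 0" by (simp_all add: D_def)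
  hence pr: "poly p r = 0" by auto
  have "poly q r \<noteq> 0"
  proof
    assume qr: "poly q r = 0"
    have "coeff p 0 = - coeff p 1 * r - coeff p 2 * r^2" "coeff q 0 = - coeff q 1 * r - coeff q 2 * r^2"
      using pr qr unfolding poly_deg_le_2[OF W(2)] poly_deg_le_2[OF W(3)] by simp_all
    hence "F0 p q = 0" unfolding F0_Gamma Gamma_Lambda_defs by algebra
    with W(6) show False by simp
  qed
  hence "poly l r = 0" using Dr pr by simp
  moreover have "poly l r = L2 * (x + r)" unfolding l by (simp add: algebra_simps)
  ultimately have rx: "r = - x" using assms(9) by simp
  have hx: "h = smult h1 [:x, 1:]" using rx h1 by (simp add: h01 r_def field_simps)
  obtain w where w: "p = [:x, 1:] * w" using pr rx by (metis dvdE minus_minus poly_eq_0_iff_dvd)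
  have pnz: "p \<noteq> 0" using W(6) unfolding F0_Gamma Gamma_Lambda_defs by auto
  have "degree w \<le> 1"
  proof -
    have "w \<noteq> 0" using pnz w by auto
    hence "degree p = 1 + degree w" unfolding w by (subst degree_mult_eq) auto
    thus ?thesis using W(2) by simp
  qed
  then obtain w0 w1 where ww: "w = [:w0, w1:]" using linear_eqI by blast
  have pc: "coeff p 0 = x * w0" "coeff p 1 = w0 + x * w1" "coeff p 2 = w1"
    unfolding w ww by simp_all
  have w1: "w1 \<ge> 0" using nonneg_polyD[OF W(4), of 2] pc by simp
  have w0: "w0 \<ge> 0"
  proof (cases "x = 0")
    case True
    thus ?thesis using nonneg_polyD[OF W(4), of 1] pc by simp
  next
    case False
    thus ?thesis using nonneg_polyD[OF W(4), of 0] pc x0 by (simp add: zero_le_mult_iff)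
  qed
  have xnz: "[:x, 1:] \<noteq> 0" by simp
  have "[:x, 1:] * smult h1 b = D"
    unfolding h hx by (simp only: mult_smult_left mult_smult_right mult.commute)
  also have "\<dots> = [:x, 1:] * (smult L2 q + w)"
    unfolding D_def l w by (simp only: distrib_left mult_smult_left mult_smult_right)
  finally have "[:x, 1:] * smult h1 b = [:x, 1:] * (smult L2 q + w)" .
  hence hb: "smult h1 b = smult L2 q + w" using mult_left_cancel[OF xnz] by blast
  have "[:x, 1:] * smult L2 p = [:x, 1:] * smult h1 a'"
    using lp unfolding hx l by (simp only: mult_smult_left mult_smult_right mult.commute)
  hence ha: "smult L2 p = smult h1 a'" using mult_left_cancel[OF xnz] by blast
  have h1pos: "h1 > 0"
  proof -
    obtain i where i: "coeff b i > 0" using pos by blast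
    have "nonneg_poly (smult L2 q + w)" using W(5) assms(9) w0 w1
      unfolding ww by (intro nonneg_poly_add nonneg_poly_smult) simp_all
    hence "nonneg_poly (smult h1 b)" unfolding hb .
    hence "h1 * coeff b i \<ge> 0" using nonneg_polyD[of "smult h1 b" i] by simp
    with i h1 show ?thesis by (simp add: zero_le_mult_iff)
  qed
  define k where "k = L2 / h1"
  have k: "k > 0" using h1pos assms(9) by (simp add: k_def)
  have "smult (1 / h1) (smult h1 b) = smult (1 / h1) (smult L2 q + w)" using hb by simp
  hence bk: "b = smult k q + smult (1 / L2) (smult k w)"
    using h1 assms(9) by (simp add: k_def smult_add_right)
  have "smult (1 / h1) (smult h1 a') = smult (1 / h1) (smult L2 p)" using ha by simp
  hence ak: "a' = smult k p" using h1 by (simp add: k_def)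
  have nb: "nonneg_poly b" unfolding bk using W(5) k assms(9) w0 w1
    unfolding ww by (intro nonneg_poly_add nonneg_poly_smult) simp_all
  have kp: "[:x, 1:] * [:k * w0, k * w1:] = smult k p" unfolding w ww by (simp add: algebra_simps)
  have sp: "a = smult R4 b + [:x, 1:] * [:k * w0, k * w1:]"
    unfolding kp using ak a'_def by simp
  show ?thesis
  proof (rule that[OF k])
    show "inductor_extraction a b R4 (R5 / L2) (k * w0) (k * w1)"
      unfolding x_def[symmetric] by unfold_locales (use sp nb x0 assms(7) k w0 w1 in simp_all)
    show "[:R5 / L2, 1:] * [:k * w0, k * w1:] = smult k p" using kp unfolding x_def .
    show "b - smult (1 / L2) [:k * w0, k * w1:] = smult k q" using bk unfolding ww by simp
  qed
qed

text \<open>The descent starts at \<open>y = 1/L2\<close>, where the pair \<open>c\<close>,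
  \<open>d y\<close> is a positive multiple of \<open>p\<close>, \<open>q\<close>.\<close>

lemma reducible_network:
  assumes W: "impedance W = Some (Fract p q)" "degree p \<le> 2" "degree q \<le> 2" "nonneg_poly p" "nonneg_poly q"
      "F0 p q < 0" "Q1 p q \<or> Q2 p q \<or> Q3 p q \<or> Q4 p q"
    and R: "R4 \<ge> 0" "R5 \<ge> 0" "L2 > 0"
    and imp: "impedance (Resistor R4 \<oplus> ((Resistor R5 \<oplus> Inductor L2) \<parallel> W)) = Some (Fract a b)"
  shows "Some (Fract a b) \<in> SP_impedances 1 1 \<or> Some (Fract a b) \<in> SP_impedances 0 2 \<or>
     (\<exists>u v. u \<ge> 0 \<and> v \<noteq> 0 \<and>
        (Q5 a b u v \<and> F1 a b u v \<or> Q6 a b u v \<and> F2 a b u v \<or>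
         Q7 a b u v \<and> F3 a b u v \<or> Q8 a b u v \<and> F4 a b u v))"
proof -
  have "F0 p q \<noteq> 0" using W(6) by simp
  then obtain g0 g1 k where k: "k > 0" "inductor_extraction a b R4 (R5 / L2) g0 g1"
    "[:R5 / L2, 1:] * [:g0, g1:] = smult k p" "b - smult (1 / L2) [:g0, g1:] = smult k q"
    using extraction_of_network[OF W(1-5) _ R imp] by blast
  interpret E: inductor_extraction a b R4 "R5 / L2" g0 g1 by (rule k(2))
  have cd: "E.c = smult k p" "E.d (1 / L2) = smult k q" using k(3,4) unfolding E.c_def E.d_def by simp_all
  have y: "1 / L2 > 0" using R by simp
  have n: "nonneg_poly (E.d (1 / L2))" unfolding cd using W(5) k(1) by (simp add: nonneg_poly_smult)
  have F: "F0 E.c (E.d (1 / L2)) < 0" unfolding cd smult_Gamma_Lambda using W(6) k(1) by (simp add: mult_pos_neg)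
  have "Q1 E.c (E.d (1 / L2)) \<or> Q2 E.c (E.d (1 / L2)) \<or> Q3 E.c (E.d (1 / L2)) \<or> Q4 E.c (E.d (1 / L2))"
    unfolding cd smult_Q[OF k(1)] by (rule W(7))
  hence E.reducible using E.reducible_Gamma2_nonneg[OF y n F] E.reducible_Gamma2_nonpos[OF y n F] by blast
  thus ?thesis unfolding E.reducible_def .
qed

end

text \<open>The resistor \<open>R1\<close> can be split off since it affects neither
  \<open>F0\<close> nor \<open>Lambda1\<close> nor \<open>Gamma2\<close>. Without it these three are
  signed monomials in the element values and \<open>t\<close>.\<close>

lemma N6_biquad:
  assumes "R1 \<ge> 0" "R2 \<ge> 0" "G3 \<ge> 0" "C1 > 0" "L1 > 0"
  obtains p q where "impedance (N6 R1 R2 G3 C1 L1) = Some (Fract p q)" "degree p \<le> 2" "degree q \<le> 2"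
    "nonneg_poly p" "nonneg_poly q" "F0 p q < 0" "Q1 p q"
proof -
  define t where "t = 1 + R2 * G3"
  have t: "t > 0" using assms by (simp add: t_def add_pos_nonneg)
  define e where "e = [:0, L1 * t, L1 * R2 * C1:]"
  define q where "q = [:t, R2 * C1 + L1 * G3, L1 * C1:]"
  have imp: "impedance (N6 R1 R2 G3 C1 L1) = Some (Fract (e + smult R1 q) q)"
    using impedance_N6[OF assms] unfolding e_def q_def t_def by (simp only: add.commute)
  have nn: "nonneg_poly e" "nonneg_poly q" using assms t by (simp_all add: e_def q_def)
  hence np: "nonneg_poly (e + smult R1 q)" using assms by (simp add: nonneg_poly_add nonneg_poly_smult)
  have "F0 e q = - (L1^3 * C1 * t^2)" "Lambda1 e q = L1^2 * G3 * t^2" "Gamma2 e q = L1 * R2 * C1 * t"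
    unfolding F0_Gamma Gamma_Lambda_defs e_def q_def by (simp_all add: t_def; algebra)+
  hence sgn: "F0 e q < 0" "Lambda1 e q \<ge> 0" "Gamma2 e q \<ge> 0" using assms t by simp_all
  have "degree e \<le> 2" "degree q \<le> 2" by (simp_all add: e_def q_def degree_quadratic)
  moreover have "Q1 (e + smult R1 q) q" unfolding Q_nonneg_iff[OF np nn(2)] add_resistance_Gamma_Lambda
    using sgn by simp
  ultimately show ?thesis
    using that[OF imp _ _ np nn(2)] sgn(1) by (simp add: add_resistance_Gamma_Lambda degree_add_smult)
qed

lemma N7_biquad:
  assumes "R1 \<ge> 0" "R2 \<ge> 0" "G3 \<ge> 0" "C1 > 0" "L1 > 0"
  obtains p q where "impedance (N7 R1 R2 G3 C1 L1) = Some (Fract p q)" "degree p \<le> 2" "degree q \<le> 2"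
    "nonneg_poly p" "nonneg_poly q" "F0 p q < 0" "Q3 p q"
proof -
  define t where "t = 1 + R2 * G3"
  have t: "t > 0" using assms by (simp add: t_def add_pos_nonneg)
  define e where "e = [:R2, L1 * t:]"
  define q where "q = [:1, R2 * C1 + L1 * G3, L1 * C1 * t:]"
  have imp: "impedance (N7 R1 R2 G3 C1 L1) = Some (Fract (e + smult R1 q) q)"
    using impedance_N7[OF assms] unfolding e_def q_def t_def by (simp only: add.commute)
  have nn: "nonneg_poly e" "nonneg_poly q" using assms t by (simp_all add: e_def q_def)
  hence np: "nonneg_poly (e + smult R1 q)" using assms by (simp add: nonneg_poly_add nonneg_poly_smult)
  have "F0 e q = - (L1^3 * C1 * t^2)" "Lambda3 e q = L1^3 * C1 * G3 * t^2" "Gamma2 e q = - (L1 * R2 * C1 * t)"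
    unfolding F0_Gamma Gamma_Lambda_defs e_def q_def by (simp_all add: t_def; algebra)+
  hence sgn: "F0 e q < 0" "Lambda3 e q \<ge> 0" "Gamma2 e q \<le> 0" using assms t by simp_all
  have "degree e \<le> 2" "degree q \<le> 2" by (simp_all add: e_def q_def degree_quadratic)
  moreover have "Q3 (e + smult R1 q) q" unfolding Q_nonneg_iff[OF np nn(2)] add_resistance_Gamma_Lambda
    using sgn by simp
  ultimately show ?thesis
    using that[OF imp _ _ np nn(2)] sgn(1) by (simp add: add_resistance_Gamma_Lambda degree_add_smult)
qed

lemma recip_biquad:
  assumes "z = Some (Fract p q)" "F0 p q < 0"
  shows "recip_imp z = Some (Fract q p)"
proof -
  have "p \<noteq> 0" "q \<noteq> 0" using assms(2) unfolding F0_Gamma Gamma_Lambda_defs by auto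
  thus ?thesis unfolding assms(1) by (simp add: recip_imp_Fract del: recip_imp.simps)
qed

lemma N8_biquad:
  assumes "G1 \<ge> 0" "G2 \<ge> 0" "R3 \<ge> 0" "C1 > 0" "L1 > 0"
  obtains p q where "impedance (N8 G1 G2 R3 C1 L1) = Some (Fract p q)" "degree p \<le> 2" "degree q \<le> 2"
    "nonneg_poly p" "nonneg_poly q" "F0 p q < 0" "Q4 p q"
  using N6_biquad[OF assms(1-3,5,4)] recip_biquad impedance_N8 swap_Q(1) swap_Gamma_Lambda(8) by metis

lemma N9_biquad:
  assumes "G1 \<ge> 0" "G2 \<ge> 0" "R3 \<ge> 0" "C1 > 0" "L1 > 0"
  obtains p q where "impedance (N9 G1 G2 R3 C1 L1) = Some (Fract p q)" "degree p \<le> 2" "degree q \<le> 2"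
    "nonneg_poly p" "nonneg_poly q" "F0 p q < 0" "Q2 p q"
  using N7_biquad[OF assms(1-3,5,4)] recip_biquad impedance_N9 swap_Q(2) swap_Gamma_Lambda(8) by metis

context biquadratic
begin

lemma reducible_class:
  assumes "N \<in> class_N10 \<union> class_N11 \<union> class_N12 \<union> class_N13" "impedance N = Some (Fract a b)"
  shows "Some (Fract a b) \<in> SP_impedances 1 1 \<or> Some (Fract a b) \<in> SP_impedances 0 2 \<or>
     (\<exists>u v. u \<ge> 0 \<and> v \<noteq> 0 \<and>
        (Q5 a b u v \<and> F1 a b u v \<or> Q6 a b u v \<and> F2 a b u v \<or>
         Q7 a b u v \<and> F3 a b u v \<or> Q8 a b u v \<and> F4 a b u v))"
proof -
  obtain W p q R4 R5 L2 where *: "impedance W = Some (Fract p q)" "degree p \<le> 2" "degree q \<le> 2"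
    "nonneg_poly p" "nonneg_poly q" "F0 p q < 0" "Q1 p q \<or> Q2 p q \<or> Q3 p q \<or> Q4 p q"
    "R4 \<ge> 0" "R5 \<ge> 0" "L2 > 0"
    "impedance (Resistor R4 \<oplus> ((Resistor R5 \<oplus> Inductor L2) \<parallel> W)) = Some (Fract a b)"
    using assms(1)
  proof (elim UnE)
    assume "N \<in> class_N10"
    then obtain R1 R2 G3 R4 R5 C1 L1 L2 where N: "N = N10 R1 R2 G3 R4 R5 C1 L1 L2"
      and "R1 \<ge> 0" "R2 \<ge> 0" "G3 \<ge> 0" "R4 \<ge> 0" "R5 \<ge> 0" "C1 > 0" "L1 > 0" "L2 > 0"
      unfolding class_N10_def by blast
    thus ?thesis using N6_biquad[of R1 R2 G3 C1 L1] that assms(2) unfolding N impedance_N10 by metis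
  next
    assume "N \<in> class_N11"
    then obtain R1 R2 G3 R4 R5 C1 L1 L2 where N: "N = N11 R1 R2 G3 R4 R5 C1 L1 L2"
      and "R1 \<ge> 0" "R2 \<ge> 0" "G3 \<ge> 0" "R4 \<ge> 0" "R5 \<ge> 0" "C1 > 0" "L1 > 0" "L2 > 0"
      unfolding class_N11_def by blast
    thus ?thesis using N7_biquad[of R1 R2 G3 C1 L1] that assms(2) unfolding N impedance_N11 by metis
  next
    assume "N \<in> class_N12"
    then obtain G1 G2 R3 R4 R5 C1 L1 L2 where N: "N = N12 G1 G2 R3 R4 R5 C1 L1 L2"
      and "G1 \<ge> 0" "G2 \<ge> 0" "R3 \<ge> 0" "R4 \<ge> 0" "R5 \<ge> 0" "C1 > 0" "L1 > 0" "L2 > 0"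
      unfolding class_N12_def by blast
    thus ?thesis using N8_biquad[of G1 G2 R3 C1 L1] that assms(2) unfolding N impedance_N12 by metis
  next
    assume "N \<in> class_N13"
    then obtain G1 G2 R3 R4 R5 C1 L1 L2 where N: "N = N13 G1 G2 R3 R4 R5 C1 L1 L2"
      and "G1 \<ge> 0" "G2 \<ge> 0" "R3 \<ge> 0" "R4 \<ge> 0" "R5 \<ge> 0" "C1 > 0" "L1 > 0" "L2 > 0"
      unfolding class_N13_def by blast
    thus ?thesis using N9_biquad[of G1 G2 R3 C1 L1] that assms(2) unfolding N impedance_N13 by metis
  qed
  show ?thesis by (rule reducible_network[OF *])
qed

text \<open>The conditions (Q5)--(Q8) say that the remaining impedance \<open>c / d\<close> satisfies (Q1), (Q3), (Q4), (Q2).\<close>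

lemma extraction_of_Q:
  assumes "x \<ge> 0" "z \<noteq> 0" "Q5 a b x z \<or> Q6 a b x z \<or> Q7 a b x z \<or> Q8 a b x z"
  obtains R g0 g1 where "inductor_extraction a b R x g0 g1" "beta b x * z > 0"
    "F0 (inductor_extraction.c x g0 g1) (inductor_extraction.d b g0 g1 (beta b x * z)) < 0"
    "Q5 a b x z \<Longrightarrow> Q1 (inductor_extraction.c x g0 g1) (inductor_extraction.d b g0 g1 (beta b x * z))"
    "Q6 a b x z \<Longrightarrow> Q3 (inductor_extraction.c x g0 g1) (inductor_extraction.d b g0 g1 (beta b x * z))"
    "Q7 a b x z \<Longrightarrow> Q4 (inductor_extraction.c x g0 g1) (inductor_extraction.d b g0 g1 (beta b x * z))"
    "Q8 a b x z \<Longrightarrow> Q2 (inductor_extraction.c x g0 g1) (inductor_extraction.d b g0 g1 (beta b x * z))"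
proof -
  have coeffs: "\<forall>i\<in>{0,1,2}. coeff a i \<ge> 0 \<and> coeff b i \<ge> 0"
    using assms(3) unfolding Q5_def Q6_def Q7_def Q8_def by blast
  note S = inductor_extraction_of_signs[OF coeffs assms(1,2)]
  let ?same = "\<lambda>l. same_sign {alpha a x, beta b x, z, d0 a b x z, d1 a b x z, d2 a b x z, f0 a b x, f1 a b x, l}"
  \<comment> \<open>The last entry is the \<open>lambda\<close> of whichever condition holds; the
    extraction is the same for all four.\<close>
  obtain l where l: "?same l" using assms(3) unfolding Q5_def Q6_def Q7_def Q8_def by blast
  interpret E: inductor_extraction a b "alpha a x / beta b x" x "f0 a b x / beta b x" "f1 a b x / beta b x"
    by (rule S(1)[OF l])
  let ?d = "E.d (beta b x * z)"
  have b2: "(beta b x)^2 > 0" using E.beta_nz by simp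
  have sq: "beta b x * (beta b x * r) \<ge> 0 \<longleftrightarrow> r \<ge> 0" "(beta b x)^2 * r \<ge> 0 \<longleftrightarrow> r \<ge> 0" "(beta b x)^2 * r \<le> 0 \<longleftrightarrow> r \<le> 0" for r
    using b2 by (simp_all add: mult.assoc[symmetric] power2_eq_square[symmetric] zero_le_mult_iff mult_le_0_iff)
  have "coeff ?d 0 \<ge> 0" "coeff ?d 1 \<ge> 0" using S(4,5)[OF l] unfolding E.data_eq sq by simp_all
  hence nd: "nonneg_poly ?d" unfolding E.nonneg_d E.coeff_d by simp
  note iff = Q_nonneg_iff[OF E.nonneg_c nd]
  have "beta b x * eta a b x z * F0 a b \<le> 0"
    using assms(3) unfolding Q5_def Q6_def Q7_def Q8_def by auto
  \<comment> \<open>The conditions give the inequality only weakly; it becomes strict because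
    \<open>eta\<close>, \<open>F0\<close> and \<open>beta\<close> are nonzero.\<close>
  moreover have "beta b x * eta a b x z * F0 a b \<noteq> 0"
    using assms(3) E.beta_nz unfolding Q5_def Q6_def Q7_def Q8_def by auto
  ultimately have F: "F0 E.c ?d < 0" unfolding E.data_eq using b2 by (auto simp: mult_le_0_iff)
  show ?thesis
  proof (rule that[OF E.inductor_extraction_axioms S(2)[OF l] F])
    show "Q1 E.c ?d" if "Q5 a b x z"
      using that S(3)[of "lambda1 a b x z"] unfolding Q5_def iff E.data_eq sq by blast
    show "Q3 E.c ?d" if "Q6 a b x z"
      using that S(3)[of "lambda3 a b x z"] unfolding Q6_def iff E.data_eq sq by blast
    show "Q4 E.c ?d" if "Q7 a b x z"
      using that S(3)[of "lambda4 a b x z"] unfolding Q7_def iff E.data_eq sq by blast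
    show "Q2 E.c ?d" if "Q8 a b x z"
      using that S(3)[of "lambda2 a b x z"] unfolding Q8_def iff E.data_eq sq by blast
  qed
qed

end

theorem theorem26:
  fixes a b :: "real poly" and Z :: "real poly fract"
  assumes "degree a \<le> 2" and "degree b \<le> 2"
    and "coprime a b"
    and "coeff a 2 \<noteq> 0 \<or> coeff b 2 \<noteq> 0"
    and "\<exists>i\<in>{0,1,2}. coeff b i > 0"
    and "Z = Fract a b"
  shows
    "((\<exists>N \<in> class_N10 \<union> class_N11 \<union> class_N12 \<union> class_N13. impedance N = Some Z) \<longrightarrow>
        Some Z \<in> SP_impedances 1 1 \<or> Some Z \<in> SP_impedances 0 2 \<or>
        (\<exists>x z. x \<ge> 0 \<and> z \<noteq> 0 \<and>
           (Q5 a b x z \<and> F1 a b x z \<or> Q6 a b x z \<and> F2 a b x z \<or>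
            Q7 a b x z \<and> F3 a b x z \<or> Q8 a b x z \<and> F4 a b x z)))
     \<and>
     (Some Z \<in> SP_impedances 1 1 \<or> Some Z \<in> SP_impedances 0 2 \<longrightarrow>
        (Q1 a b \<and> F0 a b < 0 \<and>
          (let R1 = coeff a 0 / coeff b 0;
               R2 = Gamma2 a b / (coeff b 0 * coeff b 2);
               G3 = - coeff b 2 * Lambda1 a b / F0 a b;
               C1 = - ((coeff b 2)^2) * Gamma1 a b / F0 a b;
               L1 = Gamma1 a b / (coeff b 0)^2;
               N = N6 R1 R2 G3 C1 L1
           in admissible N \<and> impedance N = Some Z)) \<or>
        (Q3 a b \<and> F0 a b < 0 \<and>
          (let R1 = coeff a 2 / coeff b 2;
               R2 = - Gamma2 a b / (coeff b 0 * coeff b 2);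
               G3 = - coeff b 0 * Lambda3 a b / F0 a b;
               C1 = - ((coeff b 2)^2) / Gamma3 a b;
               L1 = F0 a b / ((coeff b 0)^2 * Gamma3 a b);
               N = N7 R1 R2 G3 C1 L1
           in admissible N \<and> impedance N = Some Z)) \<or>
        (Q4 a b \<and> F0 a b < 0 \<and>
          (let G1 = coeff b 0 / coeff a 0;
               G2 = - Gamma2 a b / (coeff a 0 * coeff a 2);
               R3 = - coeff a 2 * Lambda4 a b / F0 a b;
               C1 = - Gamma1 a b / (coeff a 0)^2;
               L1 = (coeff a 2)^2 * Gamma1 a b / F0 a b;
               N = N8 G1 G2 R3 C1 L1
           in admissible N \<and> impedance N = Some Z)) \<or>
        (Q2 a b \<and> F0 a b < 0 \<and>
          (let G1 = coeff b 2 / coeff a 2;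
               G2 = Gamma2 a b / (coeff a 0 * coeff a 2);
               R3 = - coeff a 0 * Lambda2 a b / F0 a b;
               C1 = - F0 a b / ((coeff a 0)^2 * Gamma3 a b);
               L1 = (coeff a 2)^2 / Gamma3 a b;
               N = N9 G1 G2 R3 C1 L1
           in admissible N \<and> impedance N = Some Z)) \<or>
        (Q1 a b \<and> F0 a b > 0 \<and>
          (let R1 = coeff a 0 / coeff b 0;
               R2 = (Gamma1 a b)^2 / (coeff b 0 * Lambda1 a b);
               G3 = coeff b 2 * Lambda1 a b / F0 a b;
               L1 = Gamma1 a b * F0 a b / (Lambda1 a b)^2;
               L2 = Gamma1 a b / (coeff b 0)^2;
               N = N5 R1 R2 G3 L1 L2
           in admissible N \<and> impedance N = Some Z)))
     \<and>
     (\<not> (Some Z \<in> SP_impedances 1 1 \<or> Some Z \<in> SP_impedances 0 2) \<longrightarrow>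
        (\<forall>x z. x \<ge> 0 \<and> z \<noteq> 0 \<and> Q5 a b x z \<longrightarrow>
          (let R1 = c0 a b x / d0 a b x z;
               R2 = gamma2 a b x z / (d0 a b x z * d2 a b x z);
               G3 = - d2 a b x z * lambda1 a b x z / ((beta b x)^3 * eta a b x z * F0 a b);
               R4 = alpha a x / beta b x;
               R5 = x / (beta b x * z);
               C1 = - ((d2 a b x z)^2) * gamma1 a b x z / ((beta b x)^3 * eta a b x z * F0 a b);
               L1 = gamma1 a b x z / (d0 a b x z)^2;
               L2 = 1 / (beta b x * z);
               N = N10 R1 R2 G3 R4 R5 C1 L1 L2
           in beta b x \<noteq> 0 \<and> d0 a b x z \<noteq> 0 \<and> d2 a b x z \<noteq> 0 \<and> gamma1 a b x z > 0 \<and>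
              N \<in> class_N10 \<and> impedance N = Some Z \<and>
              (F1 a b x z \<longrightarrow> G3 = 0 \<and> N \<in> class_N17)))
        \<and>
        (\<forall>x z. x \<ge> 0 \<and> z \<noteq> 0 \<and> Q6 a b x z \<longrightarrow>
          (let R1 = c2 a b x / d2 a b x z;
               R2 = - gamma2 a b x z / (d0 a b x z * d2 a b x z);
               G3 = - d0 a b x z * lambda3 a b x z / ((beta b x)^3 * eta a b x z * F0 a b);
               R4 = alpha a x / beta b x;
               R5 = x / (beta b x * z);
               C1 = - ((d2 a b x z)^2) / gamma3 a b x z;
               L1 = (beta b x)^3 * eta a b x z * F0 a b / ((d0 a b x z)^2 * gamma3 a b x z);
               L2 = 1 / (beta b x * z);
               N = N11 R1 R2 G3 R4 R5 C1 L1 L2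
           in beta b x \<noteq> 0 \<and> d0 a b x z \<noteq> 0 \<and> d2 a b x z \<noteq> 0 \<and> gamma3 a b x z < 0 \<and>
              N \<in> class_N11 \<and> impedance N = Some Z \<and>
              (F2 a b x z \<longrightarrow> G3 = 0 \<and> N \<in> class_N20)))
        \<and>
        (\<forall>x z. x \<ge> 0 \<and> z \<noteq> 0 \<and> Q7 a b x z \<longrightarrow>
          (let G1 = d0 a b x z / c0 a b x;
               G2 = - gamma2 a b x z / (c0 a b x * c2 a b x);
               R3 = - c2 a b x * lambda4 a b x z / ((beta b x)^3 * eta a b x z * F0 a b);
               R4 = alpha a x / beta b x;
               R5 = x / (beta b x * z);
               C1 = - gamma1 a b x z / (c0 a b x)^2;
               L1 = (c2 a b x)^2 * gamma1 a b x z / ((beta b x)^3 * eta a b x z * F0 a b);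
               L2 = 1 / (beta b x * z);
               N = N12 G1 G2 R3 R4 R5 C1 L1 L2
           in beta b x \<noteq> 0 \<and> c0 a b x \<noteq> 0 \<and> c2 a b x \<noteq> 0 \<and> gamma1 a b x z < 0 \<and>
              N \<in> class_N12 \<and> impedance N = Some Z \<and>
              (F3_i a b x z \<longrightarrow> R3 = 0 \<and> N \<in> class_N23) \<and>
              (F3_ii a b x z \<longrightarrow> G1 = 0 \<and> N \<in> class_N22)))
        \<and>
        (\<forall>x z. x \<ge> 0 \<and> z \<noteq> 0 \<and> Q8 a b x z \<longrightarrow>
          (let G1 = d2 a b x z / c2 a b x;
               G2 = gamma2 a b x z / (c0 a b x * c2 a b x);
               R3 = - c0 a b x * lambda2 a b x z / ((beta b x)^3 * eta a b x z * F0 a b);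
               R4 = alpha a x / beta b x;
               R5 = x / (beta b x * z);
               C1 = - ((beta b x)^3 * eta a b x z * F0 a b) / ((c0 a b x)^2 * gamma3 a b x z);
               L1 = (c2 a b x)^2 / gamma3 a b x z;
               L2 = 1 / (beta b x * z);
               N = N13 G1 G2 R3 R4 R5 C1 L1 L2
           in beta b x \<noteq> 0 \<and> c0 a b x \<noteq> 0 \<and> c2 a b x \<noteq> 0 \<and> gamma3 a b x z > 0 \<and>
              N \<in> class_N13 \<and> impedance N = Some Z \<and>
              (F4_i a b x z \<longrightarrow> R3 = 0 \<and> N \<in> class_N26) \<and>
              (F4_ii a b x z \<longrightarrow> G1 = 0 \<and> N \<in> class_N25))))"
proof -
  interpret biquadratic a b using assms(1-5) by unfold_locales
  show ?thesis unfolding assms(6)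
  proof (intro conjI impI allI, goal_cases)
    case 1
    then obtain N where "N \<in> class_N10 \<union> class_N11 \<union> class_N12 \<union> class_N13" "impedance N = Some (Fract a b)" ..
    thus ?case by (rule reducible_class)
  next
    case 2
    thus ?case by (rule two_element_realization)
  next
    case (3 x z)
    then obtain R g0 g1 where "inductor_extraction a b R x g0 g1" "beta b x * z > 0"
      "F0 (inductor_extraction.c x g0 g1) (inductor_extraction.d b g0 g1 (beta b x * z)) < 0"
      "Q1 (inductor_extraction.c x g0 g1) (inductor_extraction.d b g0 g1 (beta b x * z))"
      using extraction_of_Q[of x z] by metis
    thus ?case by (rule inductor_extraction.N10_extraction)
  next
    case (4 x z)
    then obtain R g0 g1 where "inductor_extraction a b R x g0 g1" "beta b x * z > 0"
      "F0 (inductor_extraction.c x g0 g1) (inductor_extraction.d b g0 g1 (beta b x * z)) < 0"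
      "Q3 (inductor_extraction.c x g0 g1) (inductor_extraction.d b g0 g1 (beta b x * z))"
      using extraction_of_Q[of x z] by metis
    thus ?case by (rule inductor_extraction.N11_extraction)
  next
    case (5 x z)
    then obtain R g0 g1 where "inductor_extraction a b R x g0 g1" "beta b x * z > 0"
      "F0 (inductor_extraction.c x g0 g1) (inductor_extraction.d b g0 g1 (beta b x * z)) < 0"
      "Q4 (inductor_extraction.c x g0 g1) (inductor_extraction.d b g0 g1 (beta b x * z))"
      using extraction_of_Q[of x z] by metis
    thus ?case by (rule inductor_extraction.N12_extraction)
  next
    case (6 x z)
    then obtain R g0 g1 where "inductor_extraction a b R x g0 g1" "beta b x * z > 0"
      "F0 (inductor_extraction.c x g0 g1) (inductor_extraction.d b g0 g1 (beta b x * z)) < 0"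
      "Q2 (inductor_extraction.c x g0 g1) (inductor_extraction.d b g0 g1 (beta b x * z))"
      using extraction_of_Q[of x z] by metis
    thus ?case by (rule inductor_extraction.N13_extraction)
  qed
qed

end
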